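(* Let $\lambda$ be a partition and $T\in\Omega(\lambda)$. Put $N=\mathrm{rk}(T)$ and $T_N=T|_{\lambda^{(N)}}$. Then the following equality holds in $\mathbb{Q}(q)((t))$ (the series on the right converging $t$-adically): $$\frac{\prod_{\square\in\lambda^{(N)}}\left(1-q^{-T(\square)}t^{N-|\lambda|-c(\square)}\right)}{(1-t)^{N}\,[\mu_T]_t!}\prod_{(\square_1,\square_2)\in\mathrm{I}(T_N)}\left(\frac{1-q^{T(\square_2)-T(\square_1)}t^{c(\square_2)-c(\square_1)}}{1-q^{T(\square_2)-T(\square_1)}t^{c(\square_2)-c(\square_1)+1}}\right)$$ $$=\sum_{\tau\in\mathrm{APSYT}_{\ge0}(\lambda;T)}t^{\mathrm{inv}(\tau)}\prod_{(\square_1,\square_2)\in\mathrm{Inv}(\tau)}\left(\frac{1-q^{T(\square_2)-T(\square_1)}t^{c(\square_2)-c(\square_1)-1}}{1-q^{T(\square_2)-T(\square_1)}t^{c(\square_2)-c(\square_1)+1}}\right).$$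
   Context: A partition is a finite weakly decreasing sequence of positive integers, identified with its Young diagram in English notation; the box in column $a$ and row $b$ has content $c(\square)=a-b$. For $\lambda=(\lambda_1,\dots,\lambda_r)$ and $n\ge n_\lambda:=|\lambda|+\lambda_1$ (with $\lambda_1=0$ if $\lambda=\emptyset$), $\lambda^{(n)}=(n-|\lambda|,\lambda_1,\dots,\lambda_r)$, and $\lambda^{(\infty)}=\bigcup_{n\ge n_\lambda}\lambda^{(n)}$. $\Omega(\lambda)$ is the set of $T:\lambda^{(\infty)}\to\mathbb{Z}_{\ge0}$ with finitely many nonzero values, weakly decreasing along rows and strictly decreasing along columns. $\mathrm{rk}(T)$ is the minimal $n\ge n_\lambda$ such that $T$ vanishes on $\lambda^{(\infty)}\setminus\lambda^{(n)}$. Formal products $iq^a$ are ordered by $jq^m<kq^\ell$ iff $m>\ell$, or $m=\ell$ and $j<k$. **Finite tableaux.** For a partition $\kappa$ with $|\kappa|=n$ and $T:\kappa\to\mathbb{Z}_{\ge0}$ weakly decreasing along rows and columns, $\mathrm{PSYT}_{\ge0}(\kappa)$ is the set of labellings $\tau:\kappa\to\{jq^b:1\le j\le n,b\ge0\}$ in which each $j$ occurs exactly once and which are strictly increasing along rows and columns; $\mathrm{PSYT}_{\ge0}(\kappa;T)$ is the subset of those with $\tau(\square)=iq^{T(\square)}$ for some $i$, for every box. If $\tau(\square)=iq^b$, put $c_\tau(i)=c(\square)$, $w_\tau(i)=b$. $s_j(\tau)$ exchanges the indices $j$ and $j+1$, keeping the power of $q$ in each box (defined when the result is in $\mathrm{PSYT}_{\ge0}(\kappa)$);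 $\Psi(\tau)$ replaces each $kq^a$ by $(k-1)q^a$ for $k\ge2$ and by $nq^{a+1}$ for $k=1$. The partial order on $\mathrm{PSYT}_{\ge0}(\kappa)$ is generated by: $\Psi(\tau)>\tau$; $s_i(\tau)>\tau$ if $w_\tau(i)<w_\tau(i+1)$; $s_i(\tau)>\tau$ if $w_\tau(i)=w_\tau(i+1)$ and $c_\tau(i)-c_\tau(i+1)>1$. $\mathrm{Min}(T)$ is the unique minimum of $\mathrm{PSYT}_{\ge0}(\kappa;T)$. $\mu(T)$ is the composition of $n$ whose Young subgroup of $\mathfrak{S}_n$ is generated by those $s_i$ for which $iq^a$ and $(i+1)q^a$ (same power $a$) occur in the same row of $\mathrm{Min}(T)$. **Infinite tableaux.** $\mathrm{APSYT}_{\ge0}(\lambda)$ is the set of labellings $\tau:\lambda^{(\infty)}\to\{iq^a:i\ge1,a\ge0\}$, strictly increasing along rows and columns, with only finitely many boxes having label $iq^a$ with $a>0$, and such that for each $i\ge1$ there is a unique box with $\tau(\square)=iq^a$ for some $a\ge0$. $\mathrm{APSYT}_{\ge0}(\lambda;T)$ is the subset of those $\tau$ with $\tau(\square)=iq^{T(\square)}$ for some $i$, for every box $\square$. **Inversions.** In both the finite case ($\kappa$) and the infinite case ($\lambda^{(\infty)}$), $S(T)$ is the labelling by positive integers numbering boxes in the order: $\square_1$ before $\square_2$ iff $T(\square_1)>T(\square_2)$, or $T(\square_1)=T(\square_2)$ and $\square_1$ precedes $\square_2$ in the column-standard labelling (columns left to right, each top to bottom). For $\tau$ with underlying labelling $T$,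 $\mathrm{Inv}(\tau)$ is the set of ordered pairs of boxes $(\square_1,\square_2)$ with $S(T)(\square_1)<S(T)(\square_2)$ and $i>j$, where $\tau(\square_1)=iq^a$, $\tau(\square_2)=jq^b$; $\mathrm{inv}(\tau)=|\mathrm{Inv}(\tau)|$. For finite $T$, $\mathrm{I}(T)=\mathrm{Inv}(\mathrm{Min}(T))$. For $T\in\Omega(\lambda)$, $\mu_T=\mu(T|_{\lambda^{(\mathrm{rk}(T))}})$. $[m]_t!=\prod_{i=1}^m\frac{1-t^i}{1-t}$ and $[\mu]_t!=\prod_j[\mu_j]_t!$. *)

theory Defs
  imports
    "HOL-Analysis.Analysis"
    "HOL-Computational_Algebra.Computational_Algebra"
    "HOL-Algebra.Sym_Groups"
    "HOL-Algebra.Generated_Groups"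
begin

(* A box is a pair (column, row), both counted from 1.  A label i q^a is the pair (i, a).
   Fillings and labellings of a diagram D are extensional functions on D (undefined outside D),
   so that sets of labellings contain each labelling exactly once. *)

type_synonym box = "nat \<times> nat"
type_synonym label = "nat \<times> nat"

definition box_content :: "box \<Rightarrow> int" where
  "box_content x = int (fst x) - int (snd x)"

definition is_partition :: "nat list \<Rightarrow> bool" where
  "is_partition \<kappa> \<longleftrightarrow> sorted_wrt (\<ge>) \<kappa> \<and> (\<forall>k\<in>set \<kappa>. 0 < k)"

definition diagram :: "nat list \<Rightarrow> box set" where
  "diagram \<kappa> = {(a, b). 1 \<le> b \<and> b \<le> length \<kappa> \<and> 1 \<le> a \<and> a \<le> \<kappa> ! (b - 1)}"

definition n_min :: "nat list \<Rightarrow> nat" where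
  "n_min lam = sum_list lam + (if lam = [] then 0 else hd lam)"

(* Meant for n \<ge> n_min lam.  For lam = [] and n = 0 this is [0], a row without boxes,
   whose diagram is that of the empty partition. *)
definition padded :: "nat list \<Rightarrow> nat \<Rightarrow> nat list" where
  "padded lam n = (n - sum_list lam) # lam"

definition inf_diagram :: "nat list \<Rightarrow> box set" where
  "inf_diagram lam = (\<Union>n\<in>{n_min lam..}. diagram (padded lam n))"

definition Omega :: "nat list \<Rightarrow> (box \<Rightarrow> nat) set" where
  "Omega lam = {T \<in> inf_diagram lam \<rightarrow>\<^sub>E UNIV.
     finite {x \<in> inf_diagram lam. T x \<noteq> 0} \<and>
     (\<forall>x\<in>inf_diagram lam. \<forall>y\<in>inf_diagram lam. snd x = snd y \<and> fst x < fst y \<longrightarrow> T y \<le> T x) \<and>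
     (\<forall>x\<in>inf_diagram lam. \<forall>y\<in>inf_diagram lam. fst x = fst y \<and> snd x < snd y \<longrightarrow> T y < T x)}"

definition rk :: "nat list \<Rightarrow> (box \<Rightarrow> nat) \<Rightarrow> nat" where
  "rk lam T = (LEAST n. n_min lam \<le> n \<and> (\<forall>x \<in> inf_diagram lam - diagram (padded lam n). T x = 0))"

(* j q^m < k q^l *)
definition label_less :: "label \<Rightarrow> label \<Rightarrow> bool" where
  "label_less u v \<longleftrightarrow> snd u > snd v \<or> (snd u = snd v \<and> fst u < fst v)"

definition strictly_increasing :: "box set \<Rightarrow> (box \<Rightarrow> label) \<Rightarrow> bool" where
  "strictly_increasing D \<tau> \<longleftrightarrow>
     (\<forall>x\<in>D. \<forall>y\<in>D. (snd x = snd y \<and> fst x < fst y) \<or> (fst x = fst y \<and> snd x < snd y)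
        \<longrightarrow> label_less (\<tau> x) (\<tau> y))"

subsection \<open>Finite tableaux\<close>

text \<open>A partition of n enters only through its diagram D, and n is \<^term>\<open>card D\<close>.\<close>

definition PSYT :: "box set \<Rightarrow> (box \<Rightarrow> label) set" where
  "PSYT D = {\<tau> \<in> D \<rightarrow>\<^sub>E ({1..card D} \<times> UNIV).
     (\<forall>j\<in>{1..card D}. \<exists>!x. x \<in> D \<and> fst (\<tau> x) = j) \<and> strictly_increasing D \<tau>}"

definition PSYT_of :: "box set \<Rightarrow> (box \<Rightarrow> nat) \<Rightarrow> (box \<Rightarrow> label) set" where
  "PSYT_of D T = {\<tau> \<in> PSYT D. \<forall>x\<in>D. snd (\<tau> x) = T x}"

definition box_of :: "box set \<Rightarrow> (box \<Rightarrow> label) \<Rightarrow> nat \<Rightarrow> box" where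
  "box_of D \<tau> i = (THE x. x \<in> D \<and> fst (\<tau> x) = i)"

definition c_idx :: "box set \<Rightarrow> (box \<Rightarrow> label) \<Rightarrow> nat \<Rightarrow> int" where
  "c_idx D \<tau> i = box_content (box_of D \<tau> i)"

definition w_idx :: "box set \<Rightarrow> (box \<Rightarrow> label) \<Rightarrow> nat \<Rightarrow> nat" where
  "w_idx D \<tau> i = snd (\<tau> (box_of D \<tau> i))"

definition swap_idx :: "box set \<Rightarrow> nat \<Rightarrow> (box \<Rightarrow> label) \<Rightarrow> (box \<Rightarrow> label)" where
  "swap_idx D j \<tau> = (\<lambda>x\<in>D. (Transposition.transpose j (j + 1) (fst (\<tau> x)), snd (\<tau> x)))"

definition Psi :: "box set \<Rightarrow> (box \<Rightarrow> label) \<Rightarrow> (box \<Rightarrow> label)" where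
  "Psi D \<tau> = (\<lambda>x\<in>D. case \<tau> x of (k, a) \<Rightarrow> if 2 \<le> k then (k - 1, a) else (card D, a + 1))"

(* psyt_step D \<tau> \<sigma> is a generating relation \<sigma> > \<tau>. *)
inductive psyt_step :: "box set \<Rightarrow> (box \<Rightarrow> label) \<Rightarrow> (box \<Rightarrow> label) \<Rightarrow> bool" for D where
  Psi: "\<tau> \<in> PSYT D \<Longrightarrow> Psi D \<tau> \<in> PSYT D \<Longrightarrow> psyt_step D \<tau> (Psi D \<tau>)"
| swap_w: "\<tau> \<in> PSYT D \<Longrightarrow> 1 \<le> i \<Longrightarrow> i < card D \<Longrightarrow> swap_idx D i \<tau> \<in> PSYT D \<Longrightarrow>
    w_idx D \<tau> i < w_idx D \<tau> (i + 1) \<Longrightarrow> psyt_step D \<tau> (swap_idx D i \<tau>)"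
| swap_c: "\<tau> \<in> PSYT D \<Longrightarrow> 1 \<le> i \<Longrightarrow> i < card D \<Longrightarrow> swap_idx D i \<tau> \<in> PSYT D \<Longrightarrow>
    w_idx D \<tau> i = w_idx D \<tau> (i + 1) \<Longrightarrow> c_idx D \<tau> i - c_idx D \<tau> (i + 1) > 1 \<Longrightarrow>
    psyt_step D \<tau> (swap_idx D i \<tau>)"

definition psyt_le :: "box set \<Rightarrow> (box \<Rightarrow> label) \<Rightarrow> (box \<Rightarrow> label) \<Rightarrow> bool" where
  "psyt_le D = (psyt_step D)\<^sup>*\<^sup>*"

definition Min_tab :: "box set \<Rightarrow> (box \<Rightarrow> nat) \<Rightarrow> (box \<Rightarrow> label)" where
  "Min_tab D T = (THE \<tau>. \<tau> \<in> PSYT_of D T \<and> (\<forall>\<sigma>\<in>PSYT_of D T. psyt_le D \<tau> \<sigma>))"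

definition is_composition :: "nat \<Rightarrow> nat list \<Rightarrow> bool" where
  "is_composition n \<mu> \<longleftrightarrow> (\<forall>k\<in>set \<mu>. 0 < k) \<and> sum_list \<mu> = n"

(* The permutations of {1..|\<mu>|} that preserve each of the consecutive blocks of
   sizes \<mu>_1, \<mu>_2, ... *)
definition young_subgroup :: "nat list \<Rightarrow> (nat \<Rightarrow> nat) set" where
  "young_subgroup \<mu> = {p. p permutes {1..sum_list \<mu>} \<and>
     (\<forall>j<length \<mu>. p ` {sum_list (take j \<mu>) <.. sum_list (take (Suc j) \<mu>)}
        = {sum_list (take j \<mu>) <.. sum_list (take (Suc j) \<mu>)})}"

definition row_generators :: "box set \<Rightarrow> (box \<Rightarrow> nat) \<Rightarrow> (nat \<Rightarrow> nat) set" where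
  "row_generators D T = {Transposition.transpose i (i + 1) | i. 1 \<le> i \<and> i < card D \<and>
     (\<exists>x\<in>D. \<exists>y\<in>D. \<exists>a. snd x = snd y \<and> Min_tab D T x = (i, a) \<and> Min_tab D T y = (i + 1, a))}"

definition mu :: "box set \<Rightarrow> (box \<Rightarrow> nat) \<Rightarrow> nat list" where
  "mu D T = (THE \<mu>. is_composition (card D) \<mu> \<and>
     young_subgroup \<mu> = generate (sym_group (card D)) (row_generators D T))"

subsection \<open>Infinite tableaux\<close>

definition APSYT :: "nat list \<Rightarrow> (box \<Rightarrow> label) set" where
  "APSYT lam = {\<tau> \<in> inf_diagram lam \<rightarrow>\<^sub>E ({1..} \<times> UNIV).
     strictly_increasing (inf_diagram lam) \<tau> \<and>
     finite {x \<in> inf_diagram lam. 0 < snd (\<tau> x)} \<and>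
     (\<forall>i\<ge>1. \<exists>!x. x \<in> inf_diagram lam \<and> fst (\<tau> x) = i)}"

definition APSYT_of :: "nat list \<Rightarrow> (box \<Rightarrow> nat) \<Rightarrow> (box \<Rightarrow> label) set" where
  "APSYT_of lam T = {\<tau> \<in> APSYT lam. \<forall>x\<in>inf_diagram lam. snd (\<tau> x) = T x}"

subsection \<open>Inversions\<close>

definition col_precedes :: "box \<Rightarrow> box \<Rightarrow> bool" where
  "col_precedes x y \<longleftrightarrow> fst x < fst y \<or> (fst x = fst y \<and> snd x < snd y)"

(* In the infinite case too, every box has only finitely many predecessors when T is in
   Omega, so counting them does number the boxes 1, 2, 3, ... in the given order. *)
definition S_lab :: "box set \<Rightarrow> (box \<Rightarrow> nat) \<Rightarrow> box \<Rightarrow> nat" where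
  "S_lab D T x = Suc (card {y \<in> D. T y > T x \<or> (T y = T x \<and> col_precedes y x)})"

definition Inv :: "box set \<Rightarrow> (box \<Rightarrow> label) \<Rightarrow> (box \<times> box) set" where
  "Inv D \<tau> = {(x, y). x \<in> D \<and> y \<in> D \<and>
     S_lab D (snd \<circ> \<tau>) x < S_lab D (snd \<circ> \<tau>) y \<and> fst (\<tau> x) > fst (\<tau> y)}"

definition inv_count :: "box set \<Rightarrow> (box \<Rightarrow> label) \<Rightarrow> nat" where
  "inv_count D \<tau> = card (Inv D \<tau>)"

definition I_set :: "box set \<Rightarrow> (box \<Rightarrow> nat) \<Rightarrow> (box \<times> box) set" where
  "I_set D T = Inv D (Min_tab D T)"

subsection \<open>The field Q(q)((t))\<close>

text \<open>The metric on Laurent series in the library is the t-adic one.\<close>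

type_synonym Qqt = "rat poly fract fls"

definition q :: Qqt where
  "q = fls_const (Fraction_Field.Fract [:0, 1:] 1)"

definition t :: Qqt where
  "t = fls_X"

definition t_fact :: "nat \<Rightarrow> Qqt" where
  "t_fact m = (\<Prod>i = 1..m. (1 - t ^ i) / (1 - t))"

definition t_fact_comp :: "nat list \<Rightarrow> Qqt" where
  "t_fact_comp \<mu> = prod_list (map t_fact \<mu>)"

end

(* Put z_x = q^(T x) t^(c x) and r = z_y / z_x for boxes x, y.  A factor t of t^inv together with the factor
   of an inversion (x, y) is (t - r) / (1 - t r) = (t z_x - z_y) / (z_x - t z_y).  For a finite set of n boxes
   the sum over all bijections onto {1..n} is therefore a Hall-Littlewood symmetrization and equals
   [n]_t! times the product of (1 - r) / (1 - t r) over all ordered pairs.  Adjacent boxes of a row with the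
   same value of T have r = t, so the bijections that violate the row condition contribute 0.
   Apply this to lambda^(N + k).  The boxes outside lambda^(N) form a single row block on which T vanishes, so
   the product telescopes along this block, and along every row block of lambda^(N).  It converges as k grows.
   A labelling that is not counted for k has at least k inversions between lambda^(N) and the rest, each of
   which contributes a factor divisible by t; hence the sum converges t-adically to the same limit. *)

theory Submission
  imports Defs
begin

subsection \<open>A Hall-Littlewood identity\<close>

text \<open>I(T_N) and mu_T are given by the least element of an order and by a generated group, so
  neither can be compared with a product over boxes until Min(T) is explicit. It numbers the boxes
  by increasing T and, for equal T, row by row from the top. A level set of T is a horizontal strip,
  so this reverses the reading order of S(T) on every pair except those inside a row block, that is,
  two boxes of one row with equal T. Hence the pairs of lambda^(N) split into I(T_N) and the pairs
  inside row blocks, and the latter telescope to 1 / [mu_T]_t!. The pairs of one box x of lambda^(N)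
  with the k new boxes telescope too, to 1 - q^(-T x) t^(N - |lambda| - c x) over the same
  expression with N + k for N; the upper one is the factor in the statement. The power (1 - t)^N in
  its denominator is what [N + k]_t! / [k]_t! leaves in the limit. Inversions inside lambda^(N) may
  have a pole at t = 0. One bound serves all labellings because lambda^(N) has only finitely many
  sets of pairs.\<close>

text \<open>Compare top coefficients in Lagrange interpolation: each basis product over
  \<open>A - {a}\<close> is monic of degree \<open>card A - 1\<close>, so only the weights of the
  basis products survive.\<close>

lemma lagrange_lead_coeff:
  fixes p :: "'a::field poly"
  assumes A: "finite A" and deg: "degree p < card A"
  shows "poly.coeff p (card A - 1) = (\<Sum>a\<in>A. poly p a / (\<Prod>b\<in>A - {a}. a - b))"
proof -
  define L where "L a = (\<Prod>b\<in>A - {a}. [:- b, 1:])" for a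
  define c where "c a = poly p a / (\<Prod>b\<in>A - {a}. a - b)" for a
  define P where "P = (\<Sum>a\<in>A. smult (c a) (L a))"
  have degL: "degree (L a) = card A - 1" if "a \<in> A" for a
    unfolding L_def using that A by (subst degree_prod_eq_sum_degree) auto
  have leadL: "poly.coeff (L a) (card A - 1) = 1" if "a \<in> A" for a
  proof -
    have "lead_coeff (L a) = 1"
      unfolding L_def by (subst lead_coeff_prod) simp
    then show ?thesis using degL[OF that] by simp
  qed
  have polyL: "poly (L a) x = (\<Prod>b\<in>A - {a}. x - b)" for a x
    by (simp add: L_def poly_prod)
  have "poly P x = poly p x" if x: "x \<in> A" for x
  proof -
    have "poly P x = (\<Sum>a\<in>A. c a * (\<Prod>b\<in>A - {a}. x - b))"
      by (simp add: P_def poly_sum polyL)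
    also have "\<dots> = (\<Sum>a\<in>A. if a = x then poly p x else 0)"
    proof (rule sum.cong)
      fix a assume a: "a \<in> A"
      show "c a * (\<Prod>b\<in>A - {a}. x - b) = (if a = x then poly p x else 0)"
      proof (cases "a = x")
        case True
        have "(\<Prod>b\<in>A - {x}. x - b) \<noteq> 0" using A by (simp add: prod_zero_iff)
        then show ?thesis using True by (simp add: c_def)
      next
        case False
        have "(\<Prod>b\<in>A - {a}. x - b) = 0" using False x A by (intro prod_zero) auto
        then show ?thesis using False by simp
      qed
    qed simp
    also have "\<dots> = poly p x" using x A by simp
    finally show ?thesis .
  qed
  moreover have "degree P < card A"
  proof -
    have "degree P \<le> card A - 1"
      unfolding P_def
      by (rule degree_sum_le[OF A]) (metis degree_smult_le degL)
    then show ?thesis using deg by linarith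
  qed
  ultimately have "P = p"
    using deg by (intro poly_eqI_degree[of A]) auto
  then have "poly.coeff p (card A - 1) = poly.coeff P (card A - 1)" by simp
  also have "\<dots> = (\<Sum>a\<in>A. c a)"
    using leadL by (simp add: P_def coeff_sum)
  finally show ?thesis by (simp add: c_def)
qed

text \<open>Interpolation of \<open>p\<close>, the product of the z i - u x: its top coefficient is
  (-u)^n, the node 0 contributes (-1)^n, and the node \<open>z k\<close> contributes (u - 1) (-1)^n
  times the summand of \<open>k\<close>.\<close>

lemma sum_prod_quotient:
  fixes z :: "'b \<Rightarrow> 'a::field"
  assumes A: "finite A" and inj: "inj_on z A" and z0: "\<And>x. x \<in> A \<Longrightarrow> z x \<noteq> 0" and u: "u \<noteq> 1"
  shows "(\<Sum>k\<in>A. \<Prod>i\<in>A - {k}. (z i - u * z k) / (z i - z k)) = (1 - u ^ card A) / (1 - u)"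
proof -
  define n where "n = card A"
  define p where "p = (\<Prod>i\<in>A. [:z i, - u:])"
  \<comment> \<open>A polynomial of degree n needs n + 1 nodes. At the extra node 0 the value of
    \<open>p\<close> and the denominator are both the product of the \<open>z i\<close>, up to
    sign.\<close>
  define B where "B = insert 0 (z ` A)"
  have polyp: "poly p x = (\<Prod>i\<in>A. z i - u * x)" for x
    by (simp add: p_def poly_prod algebra_simps)
  have z0': "0 \<notin> z ` A" using z0 by force
  have cardB: "card B = Suc n"
    using A z0' by (simp add: B_def n_def card_image[OF inj])
  have degp: "degree p \<le> n"
  proof -
    have "degree p \<le> (\<Sum>i\<in>A. degree [:z i, - u:])"
      unfolding p_def by (rule degree_prod_sum_le[OF A, unfolded o_def])
    also have "\<dots> \<le> (\<Sum>i\<in>A. 1)" by (intro sum_mono) simp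
    finally show ?thesis by (simp add: n_def)
  qed
  have coeffp: "poly.coeff p n = (- u) ^ n"
    using A unfolding p_def n_def
  proof (induction A rule: finite_induct)
    case empty
    then show ?case by simp
  next
    case (insert x F)
    have deg: "degree (\<Prod>i\<in>F. [:z i, - u:]) \<le> card F"
    proof -
      have "degree (\<Prod>i\<in>F. [:z i, - u:]) \<le> (\<Sum>i\<in>F. degree [:z i, - u:])"
        by (rule degree_prod_sum_le[OF insert(1), unfolded o_def])
      also have "\<dots> \<le> (\<Sum>i\<in>F. 1)" by (intro sum_mono) simp
      finally show ?thesis by simp
    qed
    have "poly.coeff (\<Prod>i\<in>F. [:z i, - u:]) (Suc (card F)) = 0"
      by (rule coeff_eq_0) (use deg in simp)
    then show ?case using insert by simp
  qed
  have "poly.coeff p (card B - 1) = (\<Sum>a\<in>B. poly p a / (\<Prod>b\<in>B - {a}. a - b))"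
    by (rule lagrange_lead_coeff) (use A degp cardB in \<open>auto simp: B_def\<close>)
  also have "\<dots> = poly p 0 / (\<Prod>b\<in>B - {0}. 0 - b)
      + (\<Sum>a\<in>z ` A. poly p a / (\<Prod>b\<in>B - {a}. a - b))"
    unfolding B_def using A z0' by (subst sum.insert) auto
  also have "(\<Prod>b\<in>B - {0}. 0 - b) = (\<Prod>i\<in>A. - z i)"
    using z0' by (simp add: B_def prod.reindex[OF inj])
  also have "poly p 0 / (\<Prod>i\<in>A. - z i) = (- 1) ^ n"
  proof -
    have "(\<Prod>i\<in>A. - z i) = (- 1) ^ n * (\<Prod>i\<in>A. z i)"
      using A unfolding n_def by (induction A rule: finite_induct) auto
    moreover have "(\<Prod>i\<in>A. z i) \<noteq> 0" using A z0 by simp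
    ultimately show ?thesis
      by (simp add: polyp field_simps flip: power_mult_distrib)
  qed
  also have "(\<Sum>a\<in>z ` A. poly p a / (\<Prod>b\<in>B - {a}. a - b)) =
      (\<Sum>k\<in>A. (u - 1) * (- 1) ^ n * (\<Prod>i\<in>A - {k}. (z i - u * z k) / (z i - z k)))"
    unfolding sum.reindex[OF inj] o_def
  proof (rule sum.cong)
    fix k assume k: "k \<in> A"
    have zk: "z k \<noteq> 0" using z0 k by simp
    have BB: "B - {z k} = insert 0 (z ` (A - {k}))"
      using inj k zk by (auto simp: B_def inj_on_def)
    have n1: "n = Suc (card (A - {k}))" using k A
      by (metis card_Suc_Diff1 n_def)
    have "(\<Prod>b\<in>B - {z k}. z k - b) = z k * (\<Prod>i\<in>A - {k}. z k - z i)"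
      unfolding BB using A z0'
      by (subst prod.insert) (auto simp: prod.reindex[OF inj_on_subset[OF inj]])
    also have "(\<Prod>i\<in>A - {k}. z k - z i) = (\<Prod>i\<in>A - {k}. (-1) * (z i - z k))"
      by (intro prod.cong) auto
    also have "\<dots> = (- 1) ^ card (A - {k}) * (\<Prod>i\<in>A - {k}. z i - z k)"
      by (simp only: prod.distrib prod_constant)
    finally have den: "(\<Prod>b\<in>B - {z k}. z k - b) =
      z k * ((- 1) ^ card (A - {k}) * (\<Prod>i\<in>A - {k}. z i - z k))" .
    have num: "poly p (z k) = (1 - u) * z k * (\<Prod>i\<in>A - {k}. z i - u * z k)"
      unfolding polyp using A k by (subst prod.remove[of _ k]) (auto simp: algebra_simps)
    have nz: "(\<Prod>i\<in>A - {k}. z i - z k) \<noteq> 0"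
      using A inj k by (auto simp: prod_zero_iff inj_on_def)
    have sq: "(- 1 :: 'a) ^ m * (- 1) ^ m = 1" for m
      by (simp flip: power_mult_distrib)
    show "poly p (z k) / (\<Prod>b\<in>B - {z k}. z k - b) =
      (u - 1) * (- 1) ^ n * (\<Prod>i\<in>A - {k}. (z i - u * z k) / (z i - z k))"
      unfolding num den prod_dividef n1 using zk nz
      by (simp add: field_simps sq)
  qed simp
  finally have "(- u) ^ n = (- 1) ^ n + (u - 1) * (- 1) ^ n *
      (\<Sum>k\<in>A. \<Prod>i\<in>A - {k}. (z i - u * z k) / (z i - z k))"
    using coeffp cardB by (simp add: sum_distrib_left)
  then have "(- 1) ^ n * u ^ n = (- 1) ^ n * (1 + (u - 1) *
      (\<Sum>k\<in>A. \<Prod>i\<in>A - {k}. (z i - u * z k) / (z i - z k)))"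
    by (simp add: power_minus[of u] algebra_simps)
  then have "u ^ n = 1 + (u - 1) *
      (\<Sum>k\<in>A. \<Prod>i\<in>A - {k}. (z i - u * z k) / (z i - z k))"
    by simp
  then show ?thesis using u by (simp add: n_def field_simps)
qed

section \<open>Symmetrization over labellings of a finite set\<close>

definition bij_labs :: "'b set \<Rightarrow> ('b \<Rightarrow> nat) set" where
  "bij_labs A = {\<sigma> \<in> extensional A. bij_betw \<sigma> A {1..card A}}"

definition rel_pairs :: "('b \<Rightarrow> 'b \<Rightarrow> bool) \<Rightarrow> 'b set \<Rightarrow> ('b \<times> 'b) set" where
  "rel_pairs R A = {(x, y). x \<in> A \<and> y \<in> A \<and> R x y}"

lemma finite_rel_pairs: "finite A \<Longrightarrow> finite (rel_pairs R A)"
  by (rule finite_subset[of _ "A \<times> A"]) (auto simp: rel_pairs_def)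

lemma finite_bij_labs:
  assumes "finite A"
  shows "finite (bij_labs A)"
proof (rule finite_subset)
  show "bij_labs A \<subseteq> A \<rightarrow>\<^sub>E {1..card A}"
    by (auto simp: bij_labs_def PiE_def dest: bij_betw_imp_funcset)
  show "finite (A \<rightarrow>\<^sub>E {1..card A})" using assms by (intro finite_PiE) auto
qed

text \<open>Each remaining \<open>i\<close> forms exactly one related pair with \<open>k\<close>,
  and \<open>e\<close> records its direction. This is the inductive step both for the symmetrization
  and for the product over an interval.\<close>

lemma prod_rel_pairs_remove:
  fixes h :: "'b \<Rightarrow> 'b \<Rightarrow> 'a::comm_monoid_mult"
  assumes A: "finite A" and k: "k \<in> A"
    and R: "\<And>x y. x \<in> A \<Longrightarrow> y \<in> A \<Longrightarrow> x \<noteq> y \<Longrightarrow> R x y \<longleftrightarrow> \<not> R y x"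
    and irr: "\<And>x. x \<in> A \<Longrightarrow> \<not> R x x"
  shows "(\<Prod>(x, y)\<in>rel_pairs R A. h x y) =
    (\<Prod>(x, y)\<in>rel_pairs R (A - {k}). h x y) * (\<Prod>i\<in>A - {k}. if R i k then h i k else h k i)"
proof -
  define e where "e i = (if R i k then (i, k) else (k, i))" for i
  have split: "rel_pairs R A = rel_pairs R (A - {k}) \<union> e ` (A - {k})"
  proof -
    have "(x, y) \<in> rel_pairs R A \<longleftrightarrow> (x, y) \<in> rel_pairs R (A - {k}) \<union> e ` (A - {k})" for x y
    proof (cases "x = k \<or> y = k")
      case True
      then show ?thesis using R[of x y] k irr[OF k]
        by (auto simp: rel_pairs_def e_def image_iff split: if_splits)
    next
      case False
      then show ?thesis by (auto simp: rel_pairs_def e_def image_iff)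
    qed
    then show ?thesis by auto
  qed
  have disj: "rel_pairs R (A - {k}) \<inter> e ` (A - {k}) = {}"
    by (auto simp: rel_pairs_def e_def)
  have inj: "inj_on e (A - {k})"
    by (auto simp: inj_on_def e_def split: if_splits)
  have fin: "finite (rel_pairs R (A - {k}))" "finite (e ` (A - {k}))"
    using A by (auto simp: finite_rel_pairs)
  have "(\<Prod>(x, y)\<in>e ` (A - {k}). h x y) = (\<Prod>i\<in>A - {k}. if R i k then h i k else h k i)"
    unfolding prod.reindex[OF inj] by (intro prod.cong) (auto simp: e_def)
  then show ?thesis
    unfolding split prod.union_disjoint[OF fin disj] by simp
qed

text \<open>A labelling amounts to the choice of the box with the largest label together with a
  labelling of the other boxes.\<close>

lemma bij_labs_top_reindex:
  fixes f :: "('b \<Rightarrow> nat) \<Rightarrow> 'a::comm_monoid_add"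
  assumes A: "finite A" and ne: "A \<noteq> {}"
  shows "sum f (bij_labs A) = (\<Sum>k\<in>A. \<Sum>\<sigma>\<in>bij_labs (A - {k}). f (\<sigma>(k := card A)))"
proof -
  define g where "g \<sigma> = inv_into A \<sigma> (card A)" for \<sigma> :: "'b \<Rightarrow> nat"
  have n0: "card A > 0" using A ne by (simp add: card_gt_0_iff)
  have gin: "g \<sigma> \<in> A \<and> \<sigma> (g \<sigma>) = card A" if "\<sigma> \<in> bij_labs A" for \<sigma>
  proof -
    have "card A \<in> \<sigma> ` A" using that n0 by (auto simp: bij_labs_def bij_betw_def)
    then show ?thesis unfolding g_def by (auto intro: inv_into_into f_inv_into_f)
  qed
  have guniq: "g \<sigma> = k" if "\<sigma> \<in> bij_labs A" "k \<in> A" "\<sigma> k = card A" for \<sigma> k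
    using gin[OF that(1)] that by (auto simp: bij_labs_def bij_betw_def inj_on_def)
  have "sum f (bij_labs A) = (\<Sum>k\<in>A. sum f {\<sigma> \<in> bij_labs A. g \<sigma> = k})"
    by (rule sum.group[symmetric]) (use gin A in \<open>auto simp: finite_bij_labs\<close>)
  also have "\<dots> = (\<Sum>k\<in>A. \<Sum>\<sigma>\<in>bij_labs (A - {k}). f (\<sigma>(k := card A)))"
  proof (rule sum.cong)
    fix k assume k: "k \<in> A"
    have c: "card A = Suc (card (A - {k}))" using A k by (metis card_Suc_Diff1)
    have extend: "\<sigma>(k := card A) \<in> bij_labs A" if s: "\<sigma> \<in> bij_labs (A - {k})" for \<sigma>
    proof -
      have "bij_betw \<sigma> (A - {k}) {1..card (A - {k})}" using s by (simp add: bij_labs_def)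
      then have "bij_betw (\<sigma>(k := card A)) (A - {k}) {1..card (A - {k})}"
        by (rule bij_betw_cong[THEN iffD1, rotated]) auto
      moreover have "bij_betw (\<sigma>(k := card A)) {k} {card A}" by simp
      moreover have "{1..card (A - {k})} \<inter> {card A} = {}" using c by auto
      ultimately have "bij_betw (\<sigma>(k := card A)) (A - {k} \<union> {k}) ({1..card (A - {k})} \<union> {card A})"
        by (rule bij_betw_combine)
      moreover have "A - {k} \<union> {k} = A" "{1..card (A - {k})} \<union> {card A} = {1..card A}"
        using k c by auto
      ultimately have "bij_betw (\<sigma>(k := card A)) A {1..card A}" by simp
      then show ?thesis using s k by (auto simp: bij_labs_def extensional_def)
    qed
    \<comment> \<open>Deleting the box resets its value to \<open>undefined\<close>, which
      membership in \<open>bij_labs (A - {k})\<close> requires there.\<close>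
    have rest: "\<sigma>(k := undefined) \<in> bij_labs (A - {k})" if s: "\<sigma> \<in> bij_labs A" "\<sigma> k = card A" for \<sigma>
    proof -
      have "bij_betw \<sigma> (A - {k}) ({1..card A} - {card A})"
        using bij_betw_DiffI[of \<sigma> A "{1..card A}" "{k}" "{card A}"] s k
        using n0 by (simp add: bij_labs_def Suc_le_eq)
      moreover have "{1..card A} - {card A} = {1..card (A - {k})}" using c by auto
      ultimately have "bij_betw \<sigma> (A - {k}) {1..card (A - {k})}" by simp
      then have "bij_betw (\<sigma>(k := undefined)) (A - {k}) {1..card (A - {k})}"
        by (rule bij_betw_cong[THEN iffD1, rotated]) auto
      then show ?thesis using s by (auto simp: bij_labs_def extensional_def)
    qed
    show "sum f {\<sigma> \<in> bij_labs A. g \<sigma> = k} = (\<Sum>\<sigma>\<in>bij_labs (A - {k}). f (\<sigma>(k := card A)))"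
    proof (rule sum.reindex_bij_witness[where j = "\<lambda>\<sigma>. \<sigma>(k := undefined)" and i = "\<lambda>\<sigma>. \<sigma>(k := card A)"])
      fix \<sigma> assume "\<sigma> \<in> {\<sigma> \<in> bij_labs A. g \<sigma> = k}"
      then have s: "\<sigma> \<in> bij_labs A" "\<sigma> k = card A" using gin by auto
      show "(\<sigma>(k := undefined))(k := card A) = \<sigma>" using s by auto
      show "\<sigma>(k := undefined) \<in> bij_labs (A - {k})" using rest s by blast
      show "f ((\<sigma>(k := undefined))(k := card A)) = f \<sigma>" using s by (simp add: fun_upd_idem)
    next
      fix \<sigma> assume s: "\<sigma> \<in> bij_labs (A - {k})"
      have "\<sigma> k = undefined" using s by (auto simp: bij_labs_def extensional_def)
      then show "(\<sigma>(k := card A))(k := undefined) = \<sigma>" by auto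
      show "\<sigma>(k := card A) \<in> {\<sigma> \<in> bij_labs A. g \<sigma> = k}"
        using extend[OF s] guniq[OF extend[OF s] k] by simp
    qed
  qed simp
  finally show ?thesis .
qed

(* The symmetrization identity \<Sum>\<^sub>w w(\<Prod>(z_i - u z_j) / (z_i - z_j)) = [n]_u!, with the Vandermonde
   product cleared.  The induction removes the box with the largest label. *)
lemma hall_littlewood:
  fixes z :: "'b \<Rightarrow> 'a::field"
  assumes "finite A" and "inj_on z A" and "\<And>x. x \<in> A \<Longrightarrow> z x \<noteq> 0" and u: "u \<noteq> 1"
    and "\<And>x y. x \<in> A \<Longrightarrow> y \<in> A \<Longrightarrow> x \<noteq> y \<Longrightarrow> R x y \<longleftrightarrow> \<not> R y x"
    and "\<And>x. x \<in> A \<Longrightarrow> \<not> R x x"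
  shows "(\<Sum>\<sigma>\<in>bij_labs A. \<Prod>(x, y)\<in>rel_pairs R A.
      if \<sigma> x < \<sigma> y then z x - u * z y else u * z x - z y) =
    (\<Prod>i=1..card A. (1 - u ^ i) / (1 - u)) * (\<Prod>(x, y)\<in>rel_pairs R A. z x - z y)"
  using assms(1-3,5,6)
proof (induction "card A" arbitrary: A)
  case 0
  then have "A = {}" by simp
  then show ?case by (auto simp: bij_labs_def rel_pairs_def bij_betw_def)
next
  case (Suc n)
  note A = Suc.prems(1) and inj = Suc.prems(2) and z0 = Suc.prems(3)
    and R = Suc.prems(4) and irr = Suc.prems(5)
  have ne: "A \<noteq> {}" using Suc.hyps(2) by auto
  let ?F = "\<lambda>\<sigma> (x, y). if \<sigma> x < \<sigma> y then z x - u * z y else u * z x - z y"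
  let ?D = "\<lambda>A. \<Prod>(x, y)\<in>rel_pairs R A. z x - z y"
  let ?n = "\<Prod>i=1..n. (1 - u ^ i) / (1 - u)"
  have step: "(\<Sum>\<sigma>\<in>bij_labs (A - {k}). prod (?F (\<sigma>(k := card A))) (rel_pairs R A)) =
      ?n * ?D A * (\<Prod>i\<in>A - {k}. (z i - u * z k) / (z i - z k))" if k: "k \<in> A" for k
  proof -
    have c: "n = card (A - {k})" using A k Suc.hyps(2) by simp
    \<comment> \<open>The box \<open>k\<close> has the largest label, so in every pair with
      \<open>k\<close> the other box has the smaller one, whichever of the two \<open>R\<close> puts
      in front.\<close>
    let ?P = "\<Prod>i\<in>A - {k}. if R i k then z i - u * z k else u * z k - z i"
    have "prod (?F (\<sigma>(k := card A))) (rel_pairs R A) = prod (?F \<sigma>) (rel_pairs R (A - {k})) * ?P"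
      if s: "\<sigma> \<in> bij_labs (A - {k})" for \<sigma>
    proof -
      have lt: "\<sigma> i < card A" if "i \<in> A - {k}" for i
      proof -
        have "\<sigma> i \<in> {1..card (A - {k})}"
          using s that unfolding bij_labs_def by (blast dest: bij_betwE)
        then show ?thesis unfolding c[symmetric] using Suc.hyps(2) by simp
      qed
      have "prod (?F (\<sigma>(k := card A))) (rel_pairs R A) =
          prod (?F (\<sigma>(k := card A))) (rel_pairs R (A - {k})) *
          (\<Prod>i\<in>A - {k}. if R i k then ?F (\<sigma>(k := card A)) (i, k) else ?F (\<sigma>(k := card A)) (k, i))"
        using prod_rel_pairs_remove[OF A k R irr, where h = "\<lambda>x y. ?F (\<sigma>(k := card A)) (x, y)"] by simp
      also have "prod (?F (\<sigma>(k := card A))) (rel_pairs R (A - {k})) = prod (?F \<sigma>) (rel_pairs R (A - {k}))"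
        by (intro prod.cong) (auto simp: rel_pairs_def)
      also have "(\<Prod>i\<in>A - {k}. if R i k then ?F (\<sigma>(k := card A)) (i, k) else ?F (\<sigma>(k := card A)) (k, i)) = ?P"
        using lt by (intro prod.cong) (auto dest: less_asym)
      finally show ?thesis .
    qed
    then have "(\<Sum>\<sigma>\<in>bij_labs (A - {k}). prod (?F (\<sigma>(k := card A))) (rel_pairs R A)) =
        (\<Sum>\<sigma>\<in>bij_labs (A - {k}). prod (?F \<sigma>) (rel_pairs R (A - {k}))) * ?P"
      by (simp add: sum_distrib_right)
    also have "(\<Sum>\<sigma>\<in>bij_labs (A - {k}). prod (?F \<sigma>) (rel_pairs R (A - {k}))) = ?n * ?D (A - {k})"
      unfolding c by (rule Suc.hyps(1)[OF c]) (use A inj z0 R irr in \<open>blast intro: inj_on_diff\<close>)+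
    \<comment> \<open>Once the Vandermonde factors of \<open>k\<close> are pulled out, what remains
      does not mention \<open>R\<close>, and its sum over \<open>k\<close> is
      \<open>sum_prod_quotient\<close>.\<close>
    also have "?P = (\<Prod>i\<in>A - {k}. (if R i k then z i - z k else z k - z i) *
        ((z i - u * z k) / (z i - z k)))"
    proof (rule prod.cong)
      fix i assume i: "i \<in> A - {k}"
      then have "z i \<noteq> z k" using inj k by (auto simp: inj_on_def)
      then show "(if R i k then z i - u * z k else u * z k - z i) =
        (if R i k then z i - z k else z k - z i) * ((z i - u * z k) / (z i - z k))"
        by (auto simp: field_simps)
    qed simp
    also have "?n * ?D (A - {k}) * (\<Prod>i\<in>A - {k}. (if R i k then z i - z k else z k - z i) *
        ((z i - u * z k) / (z i - z k))) = ?n * ?D A * (\<Prod>i\<in>A - {k}. (z i - u * z k) / (z i - z k))"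
    proof -
      have "?D A = ?D (A - {k}) * (\<Prod>i\<in>A - {k}. if R i k then z i - z k else z k - z i)"
        by (rule prod_rel_pairs_remove[OF A k]) (use R irr in blast)+
      then show ?thesis by (simp only: prod.distrib mult.assoc)
    qed
    finally show ?thesis .
  qed
  have "(\<Sum>\<sigma>\<in>bij_labs A. prod (?F \<sigma>) (rel_pairs R A)) =
      (\<Sum>k\<in>A. ?n * ?D A * (\<Prod>i\<in>A - {k}. (z i - u * z k) / (z i - z k)))"
    unfolding bij_labs_top_reindex[OF A ne] using step by simp
  also have "\<dots> = ?n * ?D A * ((1 - u ^ card A) / (1 - u))"
    unfolding sum_distrib_left[symmetric] using sum_prod_quotient[OF A inj z0 u] by simp
  also have "\<dots> = (\<Prod>i=1..card A. (1 - u ^ i) / (1 - u)) * ?D A"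
    unfolding Suc.hyps(2)[symmetric] by simp
  finally show ?case .
qed

subsection \<open>Young subgroups\<close>

lemma down_closed_eq_atLeastAtMost:
  assumes S: "S \<subseteq> {1..n}" and dc: "\<And>i j. j \<in> S \<Longrightarrow> 1 \<le> i \<Longrightarrow> i \<le> j \<Longrightarrow> i \<in> S"
  shows "S = {1..card S}"
proof (cases "S = {}")
  case False
  have fin: "finite S" using S finite_subset by blast
  have "S = {1..Max S}"
  proof (intro equalityI subsetI)
    fix x assume "x \<in> S" then show "x \<in> {1..Max S}" using fin S by auto
  next
    fix x assume "x \<in> {1..Max S}"
    then show "x \<in> S" using dc[OF Max_in[OF fin False]] by auto
  qed
  then show ?thesis by (metis card_atLeastAtMost diff_Suc_1)
qed simp

text \<open>An adjacent swap changes a statistic in two summands only; this evaluates the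
  change.\<close>

lemma sum_diff_two_points:
  fixes g h :: "'b \<Rightarrow> 'a::ab_group_add"
  assumes "finite A" and "a \<in> A" "b \<in> A" "a \<noteq> b" and "\<And>x. x \<in> A \<Longrightarrow> x \<noteq> a \<Longrightarrow> x \<noteq> b \<Longrightarrow> g x = h x"
  shows "sum g A - sum h A = (g a - h a) + (g b - h b)"
proof -
  have "sum g A - sum h A = (\<Sum>x\<in>A. g x - h x)" by (simp add: sum_subtractf)
  also have "\<dots> = (\<Sum>x\<in>{a, b}. g x - h x)"
    using assms by (intro sum.mono_neutral_right) auto
  finally show ?thesis using assms(4) by simp
qed

section \<open>Recovering a composition from its Young subgroup\<close>

text \<open>The ends of the blocks, together with 0. This set is what can be read off from the Young
  subgroup.\<close>

definition psums :: "nat list \<Rightarrow> nat set" where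
  "psums \<mu> = (\<lambda>j. sum_list (take j \<mu>)) ` {..length \<mu>}"

lemma psums_Nil [simp]: "psums [] = {0}"
  by (simp add: psums_def)

lemma psums_Cons: "psums (x # xs) = insert 0 ((+) x ` psums xs)"
  by (simp add: psums_def lessThan_Suc_atMost[symmetric] lessThan_Suc_eq_insert_0 image_image)

text \<open>The least positive partial sum is the first part; shifting the positive partial sums
  down by it gives those of the remaining list.\<close>

lemma psums_eq_imp_eq:
  assumes "psums xs = psums ys" "\<forall>x\<in>set xs. 0 < x" "\<forall>y\<in>set ys. 0 < y"
  shows "xs = ys"
  using assms
proof (induction xs arbitrary: ys)
  have zero: "0 \<in> psums zs" for zs by (cases zs) (simp_all add: psums_Cons)
  case Nil
  then show ?case
  proof (cases ys)
    case (Cons y ys')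
    have "y + 0 \<in> psums ys" unfolding Cons psums_Cons using zero[of ys'] by blast
    then have "y \<in> {0}" using Nil.prems(1) by simp
    then show ?thesis using Nil Cons by auto
  qed simp
next
  have zero: "0 \<in> psums zs" for zs by (cases zs) (simp_all add: psums_Cons)
  have least: "(LEAST i. i \<in> psums (z # zs) \<and> 0 < i) = z" if "0 < z" for z zs
    using that zero[of zs] by (intro Least_equality) (auto simp: psums_Cons)
  have tail: "psums zs = (\<lambda>i. i - z) ` (psums (z # zs) - {0})" if "0 < z" for z zs
    using that by (auto simp: psums_Cons image_iff)
  case (Cons x xs)
  show ?case
  proof (cases ys)
    case Nil
    have "x + 0 \<in> psums (x # xs)" unfolding psums_Cons using zero[of xs] by blast
    then show ?thesis using Cons.prems Nil by auto
  next
    case (Cons y ys')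
    have xy: "0 < x" "0 < y" using Cons.prems Cons by auto
    have eq: "x = y" using least[OF xy(1), of xs] least[OF xy(2), of ys'] Cons.prems(1) Cons by simp
    have "psums xs = psums ys'"
      using tail[OF xy(1), of xs] tail[OF xy(2), of ys'] Cons.prems(1) Cons eq by simp
    then show ?thesis using Cons.IH[of ys'] Cons.prems Cons eq by simp
  qed
qed

text \<open>The swap breaks a block exactly when some block ends at \<open>i\<close>.\<close>

lemma transpose_in_young_subgroup:
  assumes i: "1 \<le> i" "i < sum_list \<mu>"
  shows "Transposition.transpose i (i + 1) \<in> young_subgroup \<mu> \<longleftrightarrow> i \<notin> psums \<mu>"
proof
  assume mem: "Transposition.transpose i (i + 1) \<in> young_subgroup \<mu>"
  show "i \<notin> psums \<mu>"
  proof
    assume "i \<in> psums \<mu>"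
    then obtain j where j: "j \<le> length \<mu>" "i = sum_list (take j \<mu>)" by (auto simp: psums_def)
    have "j \<noteq> 0" using i j by (intro notI) simp
    then obtain k where k: "j = Suc k" by (cases j) auto
    \<comment> \<open>Parts may be 0 here, so the block just before index \<open>j\<close> may be
      empty. The last index with a partial sum below \<open>i\<close> starts the nonempty block that
      ends at \<open>i\<close>.\<close>
    define B where "B = {m. m < j \<and> sum_list (take m \<mu>) < i}"
    have fB: "finite B" by (rule finite_subset[of _ "{..<j}"]) (auto simp: B_def)
    have neB: "B \<noteq> {}" using i j k by (auto simp: B_def intro!: exI[of _ 0])
    define m where "m = Max B"
    have m: "m < j" "sum_list (take m \<mu>) < i" using Max_in[OF fB neB] by (auto simp: B_def m_def)
    have mS: "sum_list (take (Suc m) \<mu>) = i"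
    proof (cases "Suc m = j")
      case False
      then have "Suc m \<notin> B" using Max_ge[OF fB, of "Suc m"] by (auto simp: m_def)
      then have ge: "sum_list (take (Suc m) \<mu>) \<ge> i" using m False by (auto simp: B_def)
      have "sum_list (take j \<mu>) = sum_list (take (Suc m) \<mu>) + sum_list (drop (Suc m) (take j \<mu>))"
        using m by (metis append_take_drop_id less_eq_Suc_le min.absorb1 sum_list_append take_take)
      then show ?thesis using ge j by simp
    qed (use j in simp)
    let ?I = "{sum_list (take m \<mu>) <.. sum_list (take (Suc m) \<mu>)}"
    have "Transposition.transpose i (i + 1) ` ?I = ?I"
      using mem m j by (auto simp: young_subgroup_def)
    moreover have "i \<in> ?I" using m mS by simp
    ultimately have "Transposition.transpose i (i + 1) i \<in> ?I" by blast
    then show False using mS by simp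
  qed
next
  assume nin: "i \<notin> psums \<mu>"
  have "Transposition.transpose i (i + 1) ` {sum_list (take j \<mu>) <.. sum_list (take (Suc j) \<mu>)}
        = {sum_list (take j \<mu>) <.. sum_list (take (Suc j) \<mu>)}" if "j < length \<mu>" for j
  proof -
    have "i \<noteq> sum_list (take j \<mu>)" "i \<noteq> sum_list (take (Suc j) \<mu>)"
      using nin that by (auto simp: psums_def)
    then show ?thesis by (intro transpose_image_eq) auto
  qed
  then show "Transposition.transpose i (i + 1) \<in> young_subgroup \<mu>"
    using i by (auto simp: young_subgroup_def intro!: permutes_swap_id)
qed

text \<open>The uniqueness behind the definite description in \<open>mu\<close>. Interior block ends
  are detected by adjacent transpositions; 0 and \<open>n\<close> are partial sums of every
  composition of \<open>n\<close>.\<close>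

lemma young_subgroup_inj:
  assumes mu: "is_composition n \<mu>" and nu: "is_composition n \<nu>"
    and eq: "young_subgroup \<mu> = young_subgroup \<nu>"
  shows "\<mu> = \<nu>"
proof (rule psums_eq_imp_eq)
  have bounds: "0 \<in> psums \<kappa>" "n \<in> psums \<kappa>" "\<And>i. i \<in> psums \<kappa> \<Longrightarrow> i \<le> n"
    if "is_composition n \<kappa>" for \<kappa>
  proof -
    have n: "sum_list \<kappa> = n" using that by (simp add: is_composition_def)
    show "0 \<in> psums \<kappa>" unfolding psums_def by (rule image_eqI[of _ _ 0]) auto
    show "n \<in> psums \<kappa>" unfolding psums_def by (rule image_eqI[of _ _ "length \<kappa>"]) (auto simp: n)
    fix i assume "i \<in> psums \<kappa>"
    then obtain j where "i = sum_list (take j \<kappa>)" by (auto simp: psums_def)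
    then show "i \<le> n" unfolding n[symmetric]
      by (metis append_take_drop_id le_add1 sum_list_append)
  qed
  have "i \<in> psums \<mu> \<longleftrightarrow> i \<in> psums \<nu>" for i
  proof (cases "1 \<le> i \<and> i < n")
    case True
    then show ?thesis
      using transpose_in_young_subgroup[of i \<mu>] transpose_in_young_subgroup[of i \<nu>] eq mu nu
      by (auto simp: is_composition_def)
  next
    case False
    then consider "i = 0" | "i = n" | "i > n" by linarith
    then show ?thesis using bounds[OF mu] bounds[OF nu] by cases (auto dest: leD)
  qed
  then show "psums \<mu> = psums \<nu>" by blast
qed (use mu nu in \<open>auto simp: is_composition_def\<close>)

text \<open>Bubble sort. If \<open>p\<close> preserves the values of \<open>f\<close> and has a
  descent at \<open>i\<close>, monotonicity forces f i = f (i + 1), so the swap that removes the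
  descent is one of the generators.\<close>

lemma generate_adjacent_transpositions:
  fixes f :: "nat \<Rightarrow> 'k::linorder"
  assumes mono: "mono_on {1..n} f"
  shows "generate (sym_group n) {Transposition.transpose i (i + 1) | i. 1 \<le> i \<and> i < n \<and> f i = f (i + 1)} =
    {p. p permutes {1..n} \<and> (\<forall>i\<in>{1..n}. f (p i) = f i)}" (is "generate ?G ?H = ?Y")
proof (intro equalityI subsetI)
  have HY: "h \<in> ?Y" if hH: "h \<in> ?H" for h
  proof -
    obtain i where i: "h = Transposition.transpose i (i + 1)" "1 \<le> i" "i < n" "f i = f (i + 1)"
      using hH by blast
    have "f (h j) = f j" for j using i by (auto simp: Transposition.transpose_def)
    then show ?thesis using i by (auto intro!: permutes_swap_id)
  qed
  fix p assume "p \<in> generate ?G ?H"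
  then show "p \<in> ?Y"
  proof induction
    case one
    show ?case unfolding sym_group_one mem_Collect_eq by (intro conjI permutes_id ballI) simp
  next
    case (incl h)
    then show ?case by (rule HY)
  next
    case (inv h)
    then have Y: "h \<in> ?Y" by (rule HY)
    have "h \<circ> h = id" using inv by (auto simp: fun_eq_iff)
    then have "inv\<^bsub>?G\<^esub> h = h"
      using Y by (intro group.inv_equality[OF sym_group_is_group])
        (auto simp: sym_group_mult sym_group_one sym_group_carrier)
    then show ?case using Y by simp
  next
    case (eng h1 h2)
    then have h: "h1 permutes {1..n}" "h2 permutes {1..n}"
      "\<And>i. i \<in> {1..n} \<Longrightarrow> f (h1 i) = f i" "\<And>i. i \<in> {1..n} \<Longrightarrow> f (h2 i) = f i" by blast+
    have "f (h1 (h2 i)) = f i" if "i \<in> {1..n}" for i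
      using h(3)[of "h2 i"] h(4)[OF that] permutes_in_image[OF h(2), of i] that by simp
    then show ?case
      unfolding sym_group_mult mem_Collect_eq using permutes_compose[OF h(2,1)] by simp
  qed
next
  fix p assume "p \<in> ?Y"
  then show "p \<in> generate ?G ?H"
  \<comment> \<open>The sum of the i * p i is at most n * (n * n), and removing a descent at i
    raises it by p i - p (i + 1).\<close>
  proof (induction "n * (n * n) - (\<Sum>i\<in>{1..n}. i * p i)" arbitrary: p rule: less_induct)
    case less
    then have p: "p permutes {1..n}" and fp: "\<And>i. i \<in> {1..n} \<Longrightarrow> f (p i) = f i" by auto
    show ?case
    proof (cases "\<exists>i. 1 \<le> i \<and> i < n \<and> p (i + 1) < p i")
      case False
      then have inc: "p i < p (i + 1)" if "1 \<le> i" "i < n" for i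
      proof -
        have "p i \<noteq> p (i + 1)" using permutes_inj[OF p] by (simp add: inj_eq)
        then show ?thesis using False that by (metis linorder_neqE_nat)
      qed
      have "i \<le> p i" if "i \<in> {1..n}" for i
        using that
      proof (induction i)
        case (Suc i)
        show ?case
        proof (cases "i = 0")
          case True
          then show ?thesis using permutes_in_image[OF p, of "Suc i"] Suc.prems by auto
        next
          case False
          then show ?thesis using Suc inc[of i] by simp
        qed
      qed simp
      then have "p = id" using p by (intro permutes_natset_ge) auto
      then show ?thesis using generate.one[of ?G ?H] by (simp add: sym_group_one)
    next
      case True
      then obtain i where i: "1 \<le> i" "i < n" "p (i + 1) < p i" by blast
      let ?s = "Transposition.transpose i (i + 1)"
      have "f (p (i + 1)) \<le> f (p i)"
        using i permutes_in_image[OF p, of i] permutes_in_image[OF p, of "i + 1"]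
        by (intro mono_onD[OF mono]) (auto simp del: permutes_in_image)
      moreover have "f i \<le> f (i + 1)" using i by (intro mono_onD[OF mono]) auto
      ultimately have fi: "f i = f (i + 1)" using fp[of i] fp[of "i + 1"] i by auto
      have s: "?s \<in> ?H" using i fi by blast
      have sp: "?s permutes {1..n}" using i by (intro permutes_swap_id) auto
      have fs: "f (?s j) = f j" for j using fi by (auto simp: Transposition.transpose_def)
      have Y: "p \<circ> ?s \<in> ?Y"
        using p sp fp fs permutes_in_image[OF sp] by (auto intro: permutes_compose)
      have bound: "(\<Sum>j\<in>{1..n}. j * r j) \<le> n * (n * n)" if "r permutes {1..n}" for r
      proof -
        have "(\<Sum>j\<in>{1..n}. j * r j) \<le> (\<Sum>j\<in>{1..n}. n * n)"
          using permutes_in_image[OF that] by (intro sum_mono mult_mono) auto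
        then show ?thesis by simp
      qed
      have "int (\<Sum>j\<in>{1..n}. j * (p \<circ> ?s) j) - int (\<Sum>j\<in>{1..n}. j * p j) = int (p i) - int (p (i + 1))"
      proof -
        have "(\<Sum>j\<in>{1..n}. int j * int ((p \<circ> ?s) j)) - (\<Sum>j\<in>{1..n}. int j * int (p j)) =
          (int i * int ((p \<circ> ?s) i) - int i * int (p i)) +
          (int (i + 1) * int ((p \<circ> ?s) (i + 1)) - int (i + 1) * int (p (i + 1)))"
          using i by (intro sum_diff_two_points) auto
        then show ?thesis by (simp add: algebra_simps)
      qed
      then have "n * (n * n) - (\<Sum>j\<in>{1..n}. j * (p \<circ> ?s) j) < n * (n * n) - (\<Sum>j\<in>{1..n}. j * p j)"
      proof -
        assume d: "int (\<Sum>j\<in>{1..n}. j * (p \<circ> ?s) j) - int (\<Sum>j\<in>{1..n}. j * p j) = int (p i) - int (p (i + 1))"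
        have "(\<Sum>j\<in>{1..n}. j * p j) < (\<Sum>j\<in>{1..n}. j * (p \<circ> ?s) j)"
          using d i(3) by linarith
        moreover have "(\<Sum>j\<in>{1..n}. j * (p \<circ> ?s) j) \<le> n * (n * n)" using Y by (intro bound) blast
        ultimately show ?thesis by linarith
      qed
      then have "p \<circ> ?s \<in> generate ?G ?H" using less.hyps Y by blast
      then have "(p \<circ> ?s) \<otimes>\<^bsub>?G\<^esub> ?s \<in> generate ?G ?H"
        using s by (rule generate.eng[OF _ generate.incl])
      then show ?thesis by (simp add: sym_group_mult comp_assoc)
    qed
  qed
qed

text \<open>The level sets of a monotone function are consecutive intervals, ordered by their
  values, so they are the blocks of the composition formed by their sizes.\<close>

lemma young_subgroup_fibres:
  fixes f :: "nat \<Rightarrow> 'k::linorder"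
  assumes mono: "mono_on {1..n} f"
    and \<mu>: "\<mu> = map (\<lambda>k. card {i \<in> {1..n}. f i = k}) (sorted_list_of_set (f ` {1..n}))"
  shows "is_composition n \<mu>"
    and "young_subgroup \<mu> = {p. p permutes {1..n} \<and> (\<forall>i\<in>{1..n}. f (p i) = f i)}"
proof -
  define ks where "ks = sorted_list_of_set (f ` {1..n})"
  have ks: "set ks = f ` {1..n}" "distinct ks" "sorted ks" by (auto simp: ks_def)
  \<comment> \<open>The union of the first \<open>j\<close> level sets. It is an initial segment of
    {1..n}, and its size is the \<open>j\<close>-th partial sum.\<close>
  define L where "L j = {i \<in> {1..n}. f i \<in> set (take j ks)}" for j
  have ps: "sum_list (take j \<mu>) = card (L j)" for j
  proof -
    have "sum_list (take j \<mu>) = (\<Sum>k\<in>set (take j ks). card {i \<in> {1..n}. f i = k})"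
      using ks(2) unfolding \<mu> ks_def[symmetric] take_map by (intro sum_list_distinct_conv_sum_set) auto
    also have "\<dots> = card (\<Union>k\<in>set (take j ks). {i \<in> {1..n}. f i = k})"
      by (intro card_UN_disjoint[symmetric]) auto
    also have "(\<Union>k\<in>set (take j ks). {i \<in> {1..n}. f i = k}) = L j" by (auto simp: L_def)
    finally show ?thesis .
  qed
  have LI: "L j = {1..card (L j)}" for j
  proof (rule down_closed_eq_atLeastAtMost)
    show "L j \<subseteq> {1..n}" by (auto simp: L_def)
    fix i' i assume i: "i \<in> L j" "1 \<le> i'" "i' \<le> i"
    then obtain a where a: "a < j" "a < length ks" "f i = ks ! a"
      by (auto simp: L_def in_set_conv_nth)
    have "f i' \<in> set ks" using i ks(1) by (auto simp: L_def)
    then obtain b where b: "b < length ks" "f i' = ks ! b" by (auto simp: in_set_conv_nth)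
    have "f i' \<le> f i" using i by (intro mono_onD[OF mono]) (auto simp: L_def)
    have "\<exists>b'<length ks. b' \<le> a \<and> f i' = ks ! b'"
    proof (cases "b \<le> a")
      case False
      then have "ks ! a \<le> ks ! b" using ks(3) b by (intro sorted_nth_mono) auto
      then show ?thesis using \<open>f i' \<le> f i\<close> a b by (intro exI[of _ a]) auto
    qed (use b in auto)
    then obtain b' where b': "b' < length ks" "b' \<le> a" "f i' = ks ! b'" by blast
    then have "take j ks ! b' \<in> set (take j ks)" using a by (intro nth_mem) auto
    then show "i' \<in> L j" using a i b' by (simp add: L_def)
  qed
  have all: "L (length ks) = {1..n}" using ks(1) by (auto simp: L_def)
  have len: "length \<mu> = length ks" by (simp add: \<mu> ks_def)
  have total: "sum_list \<mu> = n" using ps[of "length ks"] all len by simp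
  have "0 < card {i \<in> {1..n}. f i = k}" if "k \<in> f ` {1..n}" for k
    using that by (auto simp: card_gt_0_iff)
  then show "is_composition n \<mu>" using total by (auto simp: is_composition_def \<mu>)
  have block: "{sum_list (take j \<mu>) <.. sum_list (take (Suc j) \<mu>)} = {i \<in> {1..n}. f i = ks ! j}"
    if "j < length ks" for j
  proof -
    have "{sum_list (take j \<mu>) <.. sum_list (take (Suc j) \<mu>)} = {1..card (L (Suc j))} - {1..card (L j)}"
      unfolding ps by auto
    also have "\<dots> = L (Suc j) - L j" using LI by simp
    also have "\<dots> = {i \<in> {1..n}. f i = ks ! j}"
      using that ks(2) distinct_take[OF ks(2), of "Suc j"]
      by (auto simp: L_def take_Suc_conv_app_nth)
    finally show ?thesis .
  qed
  show "young_subgroup \<mu> = {p. p permutes {1..n} \<and> (\<forall>i\<in>{1..n}. f (p i) = f i)}"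
  proof (intro equalityI subsetI)
    fix p assume "p \<in> young_subgroup \<mu>"
    then have p: "p permutes {1..n}" and
      bl: "\<And>j. j < length ks \<Longrightarrow> p ` {i \<in> {1..n}. f i = ks ! j} = {i \<in> {1..n}. f i = ks ! j}"
      using block by (auto simp: young_subgroup_def total len)
    have "f (p i) = f i" if "i \<in> {1..n}" for i
    proof -
      have "f i \<in> set ks" using that unfolding ks(1) by (rule imageI)
      then obtain j where j: "j < length ks" "f i = ks ! j" unfolding in_set_conv_nth by metis
      then have "p i \<in> p ` {i \<in> {1..n}. f i = ks ! j}" using that by blast
      then show ?thesis unfolding bl[OF j(1)] using j(2) by simp
    qed
    then show "p \<in> {p. p permutes {1..n} \<and> (\<forall>i\<in>{1..n}. f (p i) = f i)}" using p by blast
  next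
    fix p assume "p \<in> {p. p permutes {1..n} \<and> (\<forall>i\<in>{1..n}. f (p i) = f i)}"
    then have p: "p permutes {1..n}" and fp: "\<forall>i\<in>{1..n}. f (p i) = f i" by auto
    have "p ` {i \<in> {1..n}. f i = k} = {i \<in> {1..n}. f i = k}" for k
    proof (rule endo_inj_surj)
      show "p ` {i \<in> {1..n}. f i = k} \<subseteq> {i \<in> {1..n}. f i = k}"
      proof (rule image_subsetI)
        fix i assume "i \<in> {i \<in> {1..n}. f i = k}"
        then show "p i \<in> {i \<in> {1..n}. f i = k}" using fp permutes_in_image[OF p, of i] by simp
      qed
      show "inj_on p {i \<in> {1..n}. f i = k}" using permutes_inj_on[OF p] by blast
    qed simp
    then show "p \<in> young_subgroup \<mu>"
      using p block by (auto simp: young_subgroup_def total len)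
  qed
qed

subsection \<open>The minimal tableau\<close>

text \<open>Sets of predecessors in a strict linear order are nested, so their sizes compare like
  the elements. Finiteness is asked only of these sets, which lets the lemma serve the infinite
  diagram.\<close>

lemma card_predecessors_less_iff:
  assumes fin: "finite {z \<in> D. R z y}" and x: "x \<in> D" and y: "y \<in> D"
    and tr: "\<And>x y z. R x y \<Longrightarrow> R y z \<Longrightarrow> R x z" and irr: "\<And>x. \<not> R x x"
    and tot: "\<And>x y. x \<in> D \<Longrightarrow> y \<in> D \<Longrightarrow> x \<noteq> y \<Longrightarrow> R x y \<or> R y x"
    and fin': "finite {z \<in> D. R z x}"
  shows "card {z \<in> D. R z x} < card {z \<in> D. R z y} \<longleftrightarrow> R x y"
proof
  assume R: "R x y"
  have "{z \<in> D. R z x} \<subset> {z \<in> D. R z y}" using R tr irr x by blast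
  then show "card {z \<in> D. R z x} < card {z \<in> D. R z y}" by (rule psubset_card_mono[OF fin])
next
  assume less: "card {z \<in> D. R z x} < card {z \<in> D. R z y}"
  show "R x y"
  proof (rule ccontr)
    assume "\<not> R x y"
    then have "x = y \<or> R y x" using tot x y by blast
    then have "{z \<in> D. R z y} \<subseteq> {z \<in> D. R z x}" using tr by blast
    then show False using card_mono[OF fin'] less by (metis not_less)
  qed
qed

lemma rank_bij_betw:
  assumes D: "finite D"
    and tr: "\<And>x y z. R x y \<Longrightarrow> R y z \<Longrightarrow> R x z" and irr: "\<And>x. \<not> R x x"
    and tot: "\<And>x y. x \<in> D \<Longrightarrow> y \<in> D \<Longrightarrow> x \<noteq> y \<Longrightarrow> R x y \<or> R y x"
  shows "bij_betw (\<lambda>x. Suc (card {z \<in> D. R z x})) D {1..card D}"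
proof -
  let ?r = "\<lambda>x. Suc (card {z \<in> D. R z x})"
  have less: "?r x < ?r y \<longleftrightarrow> R x y" if "x \<in> D" "y \<in> D" for x y
    using card_predecessors_less_iff[of D R y x] that D tr irr tot by simp
  have inj: "inj_on ?r D"
  proof (rule inj_onI)
    fix x y assume xy: "x \<in> D" "y \<in> D" and eq: "?r x = ?r y"
    have "\<not> R x y" "\<not> R y x" using less[OF xy] less[OF xy(2,1)] unfolding eq by auto
    then show "x = y" using tot xy by blast
  qed
  have "?r x \<le> card D" if "x \<in> D" for x
  proof -
    have "{z \<in> D. R z x} \<subset> D" using that irr by blast
    then show ?thesis using psubset_card_mono[OF D] by (simp add: Suc_le_eq)
  qed
  then have "?r ` D \<subseteq> {1..card D}" by auto
  then have "?r ` D = {1..card D}"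
    by (intro card_subset_eq) (simp_all add: card_image[OF inj])
  then show ?thesis using inj by (simp add: bij_betw_def)
qed

lemma bij_betw_iff_ex1:
  assumes "\<And>x. x \<in> D \<Longrightarrow> f x \<in> I"
  shows "bij_betw f D I \<longleftrightarrow> (\<forall>j\<in>I. \<exists>!x. x \<in> D \<and> f x = j)"
proof
  assume bij: "bij_betw f D I"
  show "\<forall>j\<in>I. \<exists>!x. x \<in> D \<and> f x = j"
  proof
    fix j assume "j \<in> I"
    then obtain x where "x \<in> D" "f x = j" using bij by (auto simp: bij_betw_def)
    then show "\<exists>!x. x \<in> D \<and> f x = j"
      using bij by (intro ex1I[of _ x]) (auto simp: bij_betw_def inj_on_def)
  qed
next
  assume ex1: "\<forall>j\<in>I. \<exists>!x. x \<in> D \<and> f x = j"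
  have "inj_on f D" using ex1 assms by (intro inj_onI) metis
  moreover have "f ` D = I" using ex1 assms by blast
  ultimately show "bij_betw f D I" by (simp add: bij_betw_def)
qed

section \<open>Tableaux with prescribed powers of q\<close>

definition row_increasing :: "box set \<Rightarrow> (box \<Rightarrow> nat) \<Rightarrow> (box \<Rightarrow> nat) \<Rightarrow> bool" where
  "row_increasing D T \<sigma> \<longleftrightarrow>
     (\<forall>x\<in>D. \<forall>y\<in>D. snd x = snd y \<and> T x = T y \<and> fst x < fst y \<longrightarrow> \<sigma> x < \<sigma> y)"

(* The reading order that numbers the boxes in S(T). *)
definition prec :: "(box \<Rightarrow> nat) \<Rightarrow> box \<Rightarrow> box \<Rightarrow> bool" where
  "prec T x y \<longleftrightarrow> T y < T x \<or> (T x = T y \<and> col_precedes x y)"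

lemma prec_trans: "prec T x y \<Longrightarrow> prec T y z \<Longrightarrow> prec T x z"
  by (auto simp: prec_def col_precedes_def)

lemma prec_irrefl: "\<not> prec T x x"
  by (auto simp: prec_def col_precedes_def)

lemma prec_asym: "prec T x y \<Longrightarrow> \<not> prec T y x"
  by (auto simp: prec_def col_precedes_def)

lemma prec_linear: "x \<noteq> y \<Longrightarrow> prec T x y \<or> prec T y x"
  by (cases x; cases y) (auto simp: prec_def col_precedes_def)

text \<open>\<open>T'\<close> stands for \<open>snd \<circ> \<tau>\<close>, which agrees with
  \<open>T\<close> on the diagram only.\<close>

lemma S_lab_less_iff:
  assumes eq: "\<And>x. x \<in> D \<Longrightarrow> T' x = T x" and fin: "\<And>y. y \<in> D \<Longrightarrow> finite {z \<in> D. prec T z y}"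
    and xy: "x \<in> D" "y \<in> D"
  shows "S_lab D T' x < S_lab D T' y \<longleftrightarrow> prec T x y"
proof -
  have "S_lab D T' z = Suc (card {y \<in> D. prec T y z})" if "z \<in> D" for z
    unfolding S_lab_def using that eq
    by (intro arg_cong[where f = Suc] arg_cong[where f = card]) (auto simp: prec_def)
  then show ?thesis
    using card_predecessors_less_iff[of D "prec T" y x] fin xy prec_trans prec_irrefl prec_linear
    by (metis (no_types, lifting) Suc_less_eq)
qed

text \<open>Shared by the infinite diagram and its truncations; \<open>lower\<close> expresses that
  \<open>D\<close> has the shape of a Young diagram.\<close>

locale strict_filling =
  fixes D :: "box set" and T :: "box \<Rightarrow> nat"
  assumes pos: "x \<in> D \<Longrightarrow> 1 \<le> fst x \<and> 1 \<le> snd x"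
    and lower: "(a, b) \<in> D \<Longrightarrow> 1 \<le> a' \<Longrightarrow> a' \<le> a \<Longrightarrow> 1 \<le> b' \<Longrightarrow> b' \<le> b \<Longrightarrow> (a', b') \<in> D"
    and row: "x \<in> D \<Longrightarrow> y \<in> D \<Longrightarrow> snd x = snd y \<Longrightarrow> fst x < fst y \<Longrightarrow> T y \<le> T x"
    and col: "x \<in> D \<Longrightarrow> y \<in> D \<Longrightarrow> fst x = fst y \<Longrightarrow> snd x < snd y \<Longrightarrow> T y < T x"
begin

lemma row_le: "x \<in> D \<Longrightarrow> y \<in> D \<Longrightarrow> snd x = snd y \<Longrightarrow> fst x \<le> fst y \<Longrightarrow> T y \<le> T x"
  by (metis le_neq_implies_less order_refl prod_eqI row)

text \<open>A higher power of q makes a smaller label. Columns are therefore in order already, since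
  \<open>T\<close> drops strictly along them, and in a row only boxes with equal \<open>T\<close>
  leave a condition.\<close>

lemma strictly_increasing_iff:
  assumes T: "\<And>x. x \<in> D \<Longrightarrow> snd (\<tau> x) = T x"
  shows "strictly_increasing D \<tau> \<longleftrightarrow> row_increasing D T (fst \<circ> \<tau>)"
  unfolding strictly_increasing_def row_increasing_def label_less_def o_def
  using T row col by (smt (verit, best) le_neq_implies_less less_irrefl)

(* A level set of T is a horizontal strip. *)
lemma strip:
  assumes "x \<in> D" "y \<in> D" "T x = T y" "snd x < snd y"
  shows "fst y < fst x"
proof (rule ccontr)
  assume "\<not> fst y < fst x"
  then have le: "fst x \<le> fst y" by simp
  have z: "(fst x, snd y) \<in> D"
    using assms le pos[of x] pos[of y] lower[of "fst y" "snd y" "fst x" "snd y"] by simp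
  have "T y \<le> T (fst x, snd y)" using row_le[OF z assms(2)] le by simp
  moreover have "T (fst x, snd y) < T x" using col[OF assms(1) z] assms(4) by simp
  ultimately show False using assms(3) by simp
qed

text \<open>Inside a horizontal strip the reading order moves strictly right and never down. This is
  what keeps the denominators 1 - t r from vanishing.\<close>

lemma prec_content:
  assumes "x \<in> D" "y \<in> D" "T x = T y" "prec T x y"
  shows "box_content x < box_content y"
proof -
  have "fst x < fst y"
    using assms col[of x y] by (auto simp: prec_def col_precedes_def)
  moreover have "snd y \<le> snd x" using strip[OF assms(1-3)] \<open>fst x < fst y\<close> by linarith
  ultimately show ?thesis by (simp add: box_content_def)
qed

end

(* The order in which the minimal tableau numbers the boxes. *)
definition mprec :: "(box \<Rightarrow> nat) \<Rightarrow> box \<Rightarrow> box \<Rightarrow> bool" where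
  "mprec T x y \<longleftrightarrow> T x < T y \<or> (T x = T y \<and> (snd x < snd y \<or> (snd x = snd y \<and> fst x < fst y)))"

lemma mprec_trans: "mprec T x y \<Longrightarrow> mprec T y z \<Longrightarrow> mprec T x z"
  by (auto simp: mprec_def)

lemma mprec_irrefl: "\<not> mprec T x x"
  by (auto simp: mprec_def)

lemma mprec_asym: "mprec T x y \<Longrightarrow> \<not> mprec T y x"
  by (auto simp: mprec_def)

lemma mprec_linear: "x \<noteq> y \<Longrightarrow> mprec T x y \<or> mprec T y x"
  by (cases x; cases y) (auto simp: mprec_def)

definition min_rank :: "box set \<Rightarrow> (box \<Rightarrow> nat) \<Rightarrow> box \<Rightarrow> nat" where
  "min_rank D T x = Suc (card {z \<in> D. mprec T z x})"

text \<open>The explicit tableau that turns out to be \<open>Min_tab\<close>.\<close>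

definition min_lab :: "box set \<Rightarrow> (box \<Rightarrow> nat) \<Rightarrow> box \<Rightarrow> label" where
  "min_lab D T = (\<lambda>x\<in>D. (min_rank D T x, T x))"

lemma PSYT_bij:
  assumes "\<tau> \<in> PSYT D"
  shows "bij_betw (fst \<circ> \<tau>) D {1..card D}"
proof (subst bij_betw_iff_ex1)
  show "(fst \<circ> \<tau>) x \<in> {1..card D}" if "x \<in> D" for x
    using assms that unfolding PSYT_def by (auto dest: PiE_mem)
  show "\<forall>j\<in>{1..card D}. \<exists>!x. x \<in> D \<and> (fst \<circ> \<tau>) x = j"
    using assms unfolding PSYT_def by auto
qed

lemma box_of:
  assumes "bij_betw (fst \<circ> \<tau>) D I" and "i \<in> I"
  shows "box_of D \<tau> i \<in> D" "fst (\<tau> (box_of D \<tau> i)) = i"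
proof -
  have "(fst \<circ> \<tau>) x \<in> I" if "x \<in> D" for x using bij_betwE[OF assms(1)] that by blast
  then have "\<forall>j\<in>I. \<exists>!x. x \<in> D \<and> (fst \<circ> \<tau>) x = j"
    by (rule bij_betw_iff_ex1[THEN iffD1, OF _ assms(1)])
  then have "\<exists>!x. x \<in> D \<and> fst (\<tau> x) = i" unfolding o_apply by (rule bspec[OF _ assms(2)])
  from theI'[OF this] show "box_of D \<tau> i \<in> D" "fst (\<tau> (box_of D \<tau> i)) = i"
    unfolding box_of_def by auto
qed

lemma box_of_eq:
  assumes "bij_betw (fst \<circ> \<tau>) D I" and "x \<in> D" "fst (\<tau> x) = i"
  shows "box_of D \<tau> i = x"
  unfolding box_of_def using assms by (intro the_equality) (auto simp: bij_betw_def inj_on_def)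

section \<open>Antisymmetry of the order on tableaux\<close>

text \<open>One statistic for each kind of generating relation. \<open>Psi\<close> raises
  \<open>weight\<close> on a nonempty diagram; swaps keep it, \<open>swap_w\<close> lowers
  \<open>weight_stat\<close>, and \<open>swap_c\<close> keeps \<open>weight_stat\<close> and raises
  \<open>content_stat\<close>.\<close>

definition weight :: "box set \<Rightarrow> (box \<Rightarrow> label) \<Rightarrow> int" where
  "weight D \<tau> = (\<Sum>x\<in>D. int (snd (\<tau> x)))"

definition weight_stat :: "box set \<Rightarrow> (box \<Rightarrow> label) \<Rightarrow> int" where
  "weight_stat D \<tau> = (\<Sum>x\<in>D. int (fst (\<tau> x)) * int (snd (\<tau> x)))"

definition content_stat :: "box set \<Rightarrow> (box \<Rightarrow> label) \<Rightarrow> int" where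
  "content_stat D \<tau> = (\<Sum>x\<in>D. int (fst (\<tau> x)) * box_content x)"

(* A lexicographic potential that every generating step of the order increases. *)
definition below :: "box set \<Rightarrow> (box \<Rightarrow> label) \<Rightarrow> (box \<Rightarrow> label) \<Rightarrow> bool" where
  "below D \<tau> \<sigma> \<longleftrightarrow> weight D \<tau> < weight D \<sigma> \<or> (weight D \<tau> = weight D \<sigma> \<and>
     (weight_stat D \<sigma> < weight_stat D \<tau> \<or> (weight_stat D \<sigma> = weight_stat D \<tau> \<and>
        content_stat D \<tau> < content_stat D \<sigma>)))"

lemma swap_stats:
  assumes D: "finite D" and \<tau>: "\<tau> \<in> PSYT D" and i: "1 \<le> i" "i < card D"
  shows "weight D (swap_idx D i \<tau>) = weight D \<tau>"
    and "weight_stat D (swap_idx D i \<tau>) - weight_stat D \<tau> =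
      int (w_idx D \<tau> i) - int (w_idx D \<tau> (i + 1))"
    and "content_stat D (swap_idx D i \<tau>) - content_stat D \<tau> = c_idx D \<tau> i - c_idx D \<tau> (i + 1)"
proof -
  note bij = PSYT_bij[OF \<tau>]
  define x y where "x = box_of D \<tau> i" and "y = box_of D \<tau> (i + 1)"
  have x: "x \<in> D" "fst (\<tau> x) = i" unfolding x_def using box_of[OF bij, of i] i by auto
  have y: "y \<in> D" "fst (\<tau> y) = i + 1" unfolding y_def using box_of[OF bij, of "i + 1"] i by auto
  have xy: "x \<noteq> y" using x y by auto
  have other: "fst (swap_idx D i \<tau> z) = fst (\<tau> z)" if "z \<in> D" "z \<noteq> x" "z \<noteq> y" for z
    using that box_of_eq[OF bij that(1)] by (auto simp: swap_idx_def Transposition.transpose_def x_def y_def)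
  have snd: "snd (swap_idx D i \<tau> z) = snd (\<tau> z)" if "z \<in> D" for z
    using that by (simp add: swap_idx_def)
  have fx: "fst (swap_idx D i \<tau> x) = i + 1" "fst (swap_idx D i \<tau> y) = i"
    using x y by (simp_all add: swap_idx_def)
  show "weight D (swap_idx D i \<tau>) = weight D \<tau>"
    by (simp add: weight_def snd)
  have "weight_stat D (swap_idx D i \<tau>) - weight_stat D \<tau> =
    (int (i + 1) * int (snd (\<tau> x)) - int i * int (snd (\<tau> x))) +
    (int i * int (snd (\<tau> y)) - int (i + 1) * int (snd (\<tau> y)))"
    unfolding weight_stat_def using D x y xy other snd fx
    by (subst sum_diff_two_points[of D x y]) auto
  then show "weight_stat D (swap_idx D i \<tau>) - weight_stat D \<tau> =
      int (w_idx D \<tau> i) - int (w_idx D \<tau> (i + 1))"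
    unfolding w_idx_def x_def[symmetric] y_def[symmetric] by (simp add: algebra_simps)
  have "content_stat D (swap_idx D i \<tau>) - content_stat D \<tau> =
    (int (i + 1) * box_content x - int i * box_content x) +
    (int i * box_content y - int (i + 1) * box_content y)"
    unfolding content_stat_def using D x y xy other snd fx
    by (subst sum_diff_two_points[of D x y]) auto
  then show "content_stat D (swap_idx D i \<tau>) - content_stat D \<tau> = c_idx D \<tau> i - c_idx D \<tau> (i + 1)"
    unfolding c_idx_def x_def[symmetric] y_def[symmetric] by (simp add: algebra_simps)
qed

lemma psyt_step_below:
  assumes D: "finite D" and step: "psyt_step D \<tau> \<sigma>"
  shows "below D \<tau> \<sigma> \<or> \<tau> = \<sigma>"
  using step
proof cases
  case Psi
  show ?thesis
  \<comment> \<open>The empty diagram has a single tableau, which \<open>Psi\<close> relates to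
    itself. This is the source of the alternative \<open>\<tau> = \<sigma>\<close>.\<close>
  proof (cases "D = {}")
    case True
    then show ?thesis using Psi by (auto simp: PSYT_def)
  next
    case False
    note bij = PSYT_bij[OF Psi(2)]
    define x where "x = box_of D \<tau> 1"
    have one: "1 \<in> {1..card D}" using False D by (simp add: Suc_le_eq card_gt_0_iff)
    have x: "x \<in> D" "fst (\<tau> x) = 1" unfolding x_def using box_of[OF bij one] by auto
    have ge2: "2 \<le> fst (\<tau> z)" if "z \<in> D" "z \<noteq> x" for z
    proof -
      have "fst (\<tau> z) \<in> {1..card D}" using bij that by (auto dest: bij_betwE)
      moreover have "fst (\<tau> z) \<noteq> 1" using box_of_eq[OF bij that(1)] that by (auto simp: x_def)
      ultimately show ?thesis by auto
    qed
    have other: "snd (\<sigma> z) = snd (\<tau> z)" if "z \<in> D" "z \<noteq> x" for z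
      using ge2[OF that] that(1) by (cases "\<tau> z") (simp add: Psi(1) Psi_def)
    have sx: "snd (\<sigma> x) = snd (\<tau> x) + 1"
      using x by (auto simp: Psi(1) Psi_def split: prod.splits)
    have "weight D \<sigma> = int (snd (\<sigma> x)) + (\<Sum>z\<in>D - {x}. int (snd (\<sigma> z)))"
      unfolding weight_def using D x by (simp add: sum.remove)
    also have "(\<Sum>z\<in>D - {x}. int (snd (\<sigma> z))) = (\<Sum>z\<in>D - {x}. int (snd (\<tau> z)))"
      using other by (intro sum.cong) auto
    also have "int (snd (\<sigma> x)) + \<dots> = weight D \<tau> + 1"
      unfolding weight_def sx using D x by (simp add: sum.remove)
    finally show ?thesis by (simp add: below_def)
  qed
next
  case (swap_w i)
  then show ?thesis
    using swap_stats[OF D, of \<tau> i] by (simp add: below_def)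
next
  case (swap_c i)
  then show ?thesis
    using swap_stats[OF D, of \<tau> i] by (simp add: below_def)
qed

text \<open>The order is only a reflexive transitive closure of generators, so antisymmetry comes
  from the potential \<open>below\<close>. It makes a least element of \<open>PSYT_of\<close>
  unique.\<close>

lemma psyt_le_antisym:
  assumes D: "finite D" and "psyt_le D \<tau> \<sigma>" "psyt_le D \<sigma> \<tau>"
  shows "\<tau> = \<sigma>"
proof -
  have "below D a b \<or> a = b" if "psyt_le D a b" for a b
    using that unfolding psyt_le_def
  proof (induction rule: rtranclp_induct)
    case (step y z)
    then show ?case using psyt_step_below[OF D step(2)] by (auto simp: below_def)
  qed simp
  from this[OF assms(2)] this[OF assms(3)] show ?thesis by (auto simp: below_def)
qed

section \<open>The minimum found by sorting with adjacent swaps\<close>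

locale finite_strict_filling = strict_filling +
  assumes finite_D: "finite D"
begin

lemma PSYT_of_iff:
  "\<tau> \<in> PSYT_of D T \<longleftrightarrow> \<tau> \<in> extensional D \<and> (\<forall>x\<in>D. snd (\<tau> x) = T x) \<and>
     bij_betw (fst \<circ> \<tau>) D {1..card D} \<and> row_increasing D T (fst \<circ> \<tau>)"
proof (cases "\<forall>x\<in>D. snd (\<tau> x) = T x")
  case True
  have si: "strictly_increasing D \<tau> \<longleftrightarrow> row_increasing D T (fst \<circ> \<tau>)"
    using True by (intro strictly_increasing_iff) auto
  show ?thesis
  proof
    assume "\<tau> \<in> PSYT_of D T"
    then show "\<tau> \<in> extensional D \<and> (\<forall>x\<in>D. snd (\<tau> x) = T x) \<and>
     bij_betw (fst \<circ> \<tau>) D {1..card D} \<and> row_increasing D T (fst \<circ> \<tau>)"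
      using PSYT_bij[of \<tau> D] si by (auto simp: PSYT_of_def PSYT_def PiE_def)
  next
    assume R: "\<tau> \<in> extensional D \<and> (\<forall>x\<in>D. snd (\<tau> x) = T x) \<and>
     bij_betw (fst \<circ> \<tau>) D {1..card D} \<and> row_increasing D T (fst \<circ> \<tau>)"
    then have mem: "(fst \<circ> \<tau>) x \<in> {1..card D}" if "x \<in> D" for x using that by (blast dest: bij_betwE)
    then have "\<tau> \<in> D \<rightarrow>\<^sub>E {1..card D} \<times> UNIV" using R by (force simp: PiE_def mem_Times_iff)
    moreover have "\<forall>j\<in>{1..card D}. \<exists>!x. x \<in> D \<and> fst (\<tau> x) = j"
      using R bij_betw_iff_ex1[of D "fst \<circ> \<tau>" "{1..card D}"] mem by auto
    ultimately show "\<tau> \<in> PSYT_of D T" using R si by (simp add: PSYT_of_def PSYT_def)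
  qed
next
  case False
  then show ?thesis unfolding PSYT_of_def by blast
qed

lemma min_rank_bij: "bij_betw (min_rank D T) D {1..card D}"
  unfolding min_rank_def[abs_def]
  by (rule rank_bij_betw[OF finite_D]) (use mprec_trans mprec_irrefl mprec_linear in blast)+

lemma min_rank_less_iff:
  assumes "x \<in> D" "y \<in> D"
  shows "min_rank D T x < min_rank D T y \<longleftrightarrow> mprec T x y"
proof -
  have "card {z \<in> D. mprec T z x} < card {z \<in> D. mprec T z y} \<longleftrightarrow> mprec T x y"
    using assms finite_D
    by (intro card_predecessors_less_iff) (simp_all add: mprec_irrefl, (use mprec_trans mprec_linear in blast)+)
  then show ?thesis by (simp add: min_rank_def)
qed

lemma min_lab_PSYT: "min_lab D T \<in> PSYT_of D T"
proof -
  have "bij_betw (fst \<circ> min_lab D T) D {1..card D}"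
    using min_rank_bij by (rule bij_betw_cong[THEN iffD1, rotated]) (simp add: min_lab_def)
  moreover have "row_increasing D T (fst \<circ> min_lab D T)"
    using min_rank_less_iff by (simp add: row_increasing_def min_lab_def mprec_def)
  ultimately show ?thesis by (simp add: PSYT_of_iff min_lab_def)
qed

text \<open>A step down the order. If the two boxes have different powers, the relation is
  \<open>swap_w\<close>. If the powers agree, the row condition puts the boxes in different rows,
  and the strip property makes their contents differ by more than 1, as \<open>swap_c\<close>
  requires.\<close>

lemma descent_step:
  assumes \<sigma>: "\<sigma> \<in> PSYT_of D T" and i: "1 \<le> i" "i < card D"
    and desc: "mprec T (box_of D \<sigma> (i + 1)) (box_of D \<sigma> i)"
  shows "swap_idx D i \<sigma> \<in> PSYT_of D T" "psyt_step D (swap_idx D i \<sigma>) \<sigma>"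
proof -
  have P: "\<sigma> \<in> extensional D" "\<And>x. x \<in> D \<Longrightarrow> snd (\<sigma> x) = T x"
    and bij: "bij_betw (fst \<circ> \<sigma>) D {1..card D}" and inc: "row_increasing D T (fst \<circ> \<sigma>)"
    using \<sigma> by (auto simp: PSYT_of_iff)
  define x y where "x = box_of D \<sigma> (i + 1)" and "y = box_of D \<sigma> i"
  have x: "x \<in> D" "fst (\<sigma> x) = i + 1" unfolding x_def using box_of[OF bij, of "i + 1"] i by auto
  have y: "y \<in> D" "fst (\<sigma> y) = i" unfolding y_def using box_of[OF bij, of i] i by auto
  have xy: "mprec T x y" using desc by (simp add: x_def y_def)
  let ?s = "Transposition.transpose i (i + 1)"
  let ?\<rho> = "swap_idx D i \<sigma>"
  have \<rho>: "fst (?\<rho> z) = ?s (fst (\<sigma> z))" "snd (?\<rho> z) = T z" if "z \<in> D" for z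
    using that P by (simp_all add: swap_idx_def)
  have nsame: "\<not> (T x = T y \<and> snd x = snd y)"
  proof
    assume s: "T x = T y \<and> snd x = snd y"
    then have "fst x < fst y" using xy by (auto simp: mprec_def)
    then have "(fst \<circ> \<sigma>) x < (fst \<circ> \<sigma>) y"
      using inc s x(1) y(1) unfolding row_increasing_def by blast
    then show False using x y by simp
  qed
  have "?s permutes {1..card D}" using i by (intro permutes_swap_id) auto
  then have "bij_betw (?s \<circ> (fst \<circ> \<sigma>)) D {1..card D}"
    by (intro bij_betw_trans[OF bij] permutes_imp_bij)
  then have bij': "bij_betw (fst \<circ> ?\<rho>) D {1..card D}"
    by (rule bij_betw_cong[THEN iffD1, rotated]) (simp add: \<rho>)
  have inc': "row_increasing D T (fst \<circ> ?\<rho>)"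
    unfolding row_increasing_def
  proof (intro ballI impI)
    fix u v assume uv: "u \<in> D" "v \<in> D" and s: "snd u = snd v \<and> T u = T v \<and> fst u < fst v"
    have lt: "fst (\<sigma> u) < fst (\<sigma> v)" using inc uv s by (auto simp: row_increasing_def)
    have "\<not> (fst (\<sigma> u) = i \<and> fst (\<sigma> v) = i + 1)"
    proof
      assume "fst (\<sigma> u) = i \<and> fst (\<sigma> v) = i + 1"
      then have "u = y" "v = x"
        using box_of_eq[OF bij] uv by (auto simp: x_def y_def)
      then show False using nsame s by auto
    qed
    then show "(fst \<circ> ?\<rho>) u < (fst \<circ> ?\<rho>) v" using lt uv by (auto simp: \<rho> Transposition.transpose_def)
  qed
  show mem: "?\<rho> \<in> PSYT_of D T"
    using bij' inc' \<rho> by (auto simp: PSYT_of_iff) (simp add: swap_idx_def)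
  have undo: "swap_idx D i ?\<rho> = \<sigma>"
    using P(1) by (auto simp: swap_idx_def restrict_def fun_eq_iff extensional_def)
  have bx: "box_of D ?\<rho> i = x" "box_of D ?\<rho> (i + 1) = y"
    by (rule box_of_eq[OF bij' x(1)], simp add: \<rho>(1)[OF x(1)] x(2))
      (rule box_of_eq[OF bij' y(1)], simp add: \<rho>(1)[OF y(1)] y(2))
  have w: "w_idx D ?\<rho> i = T x" "w_idx D ?\<rho> (i + 1) = T y"
    unfolding w_idx_def bx using \<rho> x y by auto
  have mem': "?\<rho> \<in> PSYT D" "swap_idx D i ?\<rho> \<in> PSYT D"
    using mem \<sigma> unfolding undo by (auto simp: PSYT_of_def)
  have "psyt_step D ?\<rho> (swap_idx D i ?\<rho>)"
  proof (cases "T x < T y")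
    case True
    then show ?thesis using mem' i w by (intro psyt_step.swap_w) auto
  next
    case False
    then have e: "T x = T y" "snd x < snd y" using xy nsame by (auto simp: mprec_def)
    have "fst y < fst x" using strip[OF x(1) y(1) e] .
    then have "c_idx D ?\<rho> i - c_idx D ?\<rho> (i + 1) > 1"
      unfolding c_idx_def bx using e by (simp add: box_content_def)
    then show ?thesis using mem' i w e by (intro psyt_step.swap_c) auto
  qed
  then show "psyt_step D ?\<rho> \<sigma>" by (simp only: undo)
qed

text \<open>Without descents the boxes, listed by index, ascend in \<open>mprec\<close>, so each
  index is the rank of its box.\<close>

lemma no_descent_imp_min_lab:
  assumes \<sigma>: "\<sigma> \<in> PSYT_of D T"
    and nd: "\<And>i. 1 \<le> i \<Longrightarrow> i < card D \<Longrightarrow> \<not> mprec T (box_of D \<sigma> (i + 1)) (box_of D \<sigma> i)"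
  shows "\<sigma> = min_lab D T"
proof -
  have P: "\<sigma> \<in> extensional D" "\<And>x. x \<in> D \<Longrightarrow> snd (\<sigma> x) = T x"
    and bij: "bij_betw (fst \<circ> \<sigma>) D {1..card D}"
    using \<sigma> by (auto simp: PSYT_of_iff)
  have suc: "mprec T (box_of D \<sigma> i) (box_of D \<sigma> (Suc i))" if i: "1 \<le> i" "i < card D" for i
  proof -
    have "box_of D \<sigma> i \<noteq> box_of D \<sigma> (Suc i)"
      using box_of(2)[OF bij, of i] box_of(2)[OF bij, of "Suc i"] i by auto
    then show ?thesis using nd[OF i] mprec_linear[of "box_of D \<sigma> i" "box_of D \<sigma> (Suc i)" T]
      unfolding Suc_eq_plus1 by blast
  qed
  have chain: "mprec T (box_of D \<sigma> i) (box_of D \<sigma> j)" if "i < j" "1 \<le> i" "j \<le> card D" for i j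
    using that
  proof (induction j)
    case (Suc j)
    then show ?case using suc[of j] suc[of i] by (cases "i = j") (auto intro: mprec_trans)
  qed simp
  have iff: "mprec T y x \<longleftrightarrow> fst (\<sigma> y) < fst (\<sigma> x)" if xy: "x \<in> D" "y \<in> D" for x y
  proof -
    have range: "fst (\<sigma> x) \<in> {1..card D}" "fst (\<sigma> y) \<in> {1..card D}"
      using bij xy by (auto dest: bij_betwE)
    have b: "box_of D \<sigma> (fst (\<sigma> x)) = x" "box_of D \<sigma> (fst (\<sigma> y)) = y"
      using box_of_eq[OF bij] xy by auto
    show ?thesis
    proof (cases "fst (\<sigma> x)" "fst (\<sigma> y)" rule: linorder_cases)
      case less
      then have "mprec T x y" using chain[of "fst (\<sigma> x)" "fst (\<sigma> y)"] range b by simp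
      then show ?thesis using less mprec_asym by auto
    next
      case equal
      then have "x = y" using b by metis
      then show ?thesis using mprec_irrefl[of T x] by simp
    next
      case greater
      then show ?thesis using chain[of "fst (\<sigma> y)" "fst (\<sigma> x)"] range b by simp
    qed
  qed
  have "fst (\<sigma> x) = min_rank D T x" if x: "x \<in> D" for x
  proof -
    have range: "fst (\<sigma> x) \<in> {1..card D}" using bij x by (auto dest: bij_betwE)
    have img: "(fst \<circ> \<sigma>) ` {z \<in> D. mprec T z x} = {1..<fst (\<sigma> x)}"
    proof (intro equalityI subsetI)
      fix j assume j: "j \<in> {1..<fst (\<sigma> x)}"
      then have "j \<in> {1..card D}" using range by auto
      from box_of[OF bij this] j show "j \<in> (fst \<circ> \<sigma>) ` {z \<in> D. mprec T z x}"
        using iff[OF x] by (intro image_eqI[of _ _ "box_of D \<sigma> j"]) auto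
    next
      fix j assume "j \<in> (fst \<circ> \<sigma>) ` {z \<in> D. mprec T z x}"
      then show "j \<in> {1..<fst (\<sigma> x)}" using iff[OF x] bij by (auto dest: bij_betwE)
    qed
    have "card {z \<in> D. mprec T z x} = card {1..<fst (\<sigma> x)}"
      unfolding img[symmetric] using bij
      by (intro card_image[symmetric]) (auto simp: bij_betw_def inj_on_def)
    then show ?thesis using range by (simp add: min_rank_def)
  qed
  then show ?thesis
    using P by (auto simp: min_lab_def fun_eq_iff extensional_def prod_eq_iff)
qed

text \<open>Every descent step lowers the number of pairs numbered against \<open>mprec\<close>. All
  tableaux on the way have the same \<open>T\<close>, so the chain consists of swaps alone.\<close>

lemma psyt_le_min_lab:
  assumes "\<sigma> \<in> PSYT_of D T"
  shows "psyt_le D (min_lab D T) \<sigma>"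
  using assms
proof (induction "card {(x, y). x \<in> D \<and> y \<in> D \<and> mprec T x y \<and> fst (\<sigma> y) < fst (\<sigma> x)}"
    arbitrary: \<sigma> rule: less_induct)
  case less
  let ?E = "\<lambda>\<sigma>. {(x, y). x \<in> D \<and> y \<in> D \<and> mprec T x y \<and> fst (\<sigma> y) < fst (\<sigma> x)}"
  show ?case
  proof (cases "\<exists>i. 1 \<le> i \<and> i < card D \<and> mprec T (box_of D \<sigma> (i + 1)) (box_of D \<sigma> i)")
    case False
    then have "\<sigma> = min_lab D T" using no_descent_imp_min_lab less.prems by blast
    then show ?thesis by (simp add: psyt_le_def)
  next
    case True
    then obtain i where i: "1 \<le> i" "i < card D"
      and desc: "mprec T (box_of D \<sigma> (i + 1)) (box_of D \<sigma> i)" by blast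
    note step = descent_step[OF less.prems i desc]
    have bij: "bij_betw (fst \<circ> \<sigma>) D {1..card D}" using less.prems by (auto simp: PSYT_of_iff)
    define x y where "x = box_of D \<sigma> (i + 1)" and "y = box_of D \<sigma> i"
    have x: "x \<in> D" "fst (\<sigma> x) = i + 1" unfolding x_def using box_of[OF bij, of "i + 1"] i by auto
    have y: "y \<in> D" "fst (\<sigma> y) = i" unfolding y_def using box_of[OF bij, of i] i by auto
    have xy: "mprec T x y" using desc by (simp add: x_def y_def)
    have fst': "fst (swap_idx D i \<sigma> z) = Transposition.transpose i (i + 1) (fst (\<sigma> z))"
      if "z \<in> D" for z using that by (simp add: swap_idx_def)
    have sub: "?E (swap_idx D i \<sigma>) \<subseteq> ?E \<sigma> - {(x, y)}"
    proof (rule subsetI)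
      fix e assume "e \<in> ?E (swap_idx D i \<sigma>)"
      then obtain a b where e: "e = (a, b)" and ab: "a \<in> D" "b \<in> D" "mprec T a b"
        "fst (swap_idx D i \<sigma> b) < fst (swap_idx D i \<sigma> a)" by blast
      have ne: "(a, b) \<noteq> (x, y)" using ab x y by (auto simp: fst')
      have "\<not> (fst (\<sigma> a) = i \<and> fst (\<sigma> b) = i + 1)"
      proof
        assume "fst (\<sigma> a) = i \<and> fst (\<sigma> b) = i + 1"
        then have "a = y" "b = x" using box_of_eq[OF bij] ab by (auto simp: x_def y_def)
        then show False using ab(3) xy mprec_trans mprec_irrefl by blast
      qed
      moreover have "fst (\<sigma> a) \<noteq> fst (\<sigma> b)"
        using bij ab mprec_irrefl by (auto simp: bij_betw_def inj_on_def)
      ultimately have "fst (\<sigma> b) < fst (\<sigma> a)"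
        using ab(4) ab(1,2) by (auto simp: fst' Transposition.transpose_def split: if_splits)
      then show "e \<in> ?E \<sigma> - {(x, y)}" using ab ne e by simp
    qed
    have fin: "finite (?E \<sigma>)" by (rule finite_subset[of _ "D \<times> D"]) (auto simp: finite_D)
    have "(x, y) \<in> ?E \<sigma>" using x y xy by auto
    then have "card (?E (swap_idx D i \<sigma>)) < card (?E \<sigma>)"
      using sub by (intro psubset_card_mono[OF fin]) blast
    from less.hyps[OF this step(1)] step(2) show ?thesis
      unfolding psyt_le_def by simp
  qed
qed

lemma Min_tab_eq: "Min_tab D T = min_lab D T"
  unfolding Min_tab_def
  using min_lab_PSYT psyt_le_min_lab psyt_le_antisym[OF finite_D]
  by (intro the_equality) auto

text \<open>From one row of a level set to another, the reading order goes up while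
  \<open>mprec\<close> goes down; for different values of \<open>T\<close> the two orders are
  opposite by definition. They agree exactly inside row blocks.\<close>

lemma I_set_eq:
  "I_set D T = {(x, y). x \<in> D \<and> y \<in> D \<and> prec T x y \<and> \<not> (T x = T y \<and> snd x = snd y)}"
proof -
  have eq: "(snd \<circ> min_lab D T) x = T x" if "x \<in> D" for x using that by (simp add: min_lab_def)
  have S: "S_lab D (snd \<circ> min_lab D T) x < S_lab D (snd \<circ> min_lab D T) y \<longleftrightarrow> prec T x y"
    if "x \<in> D" "y \<in> D" for x y
    by (rule S_lab_less_iff[OF eq]) (simp_all add: finite_D that)
  have M: "fst (min_lab D T x) > fst (min_lab D T y) \<longleftrightarrow> mprec T y x"
    if "x \<in> D" "y \<in> D" for x y
    using min_rank_less_iff that by (simp add: min_lab_def)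
  have P: "mprec T y x \<longleftrightarrow> \<not> (T x = T y \<and> snd x = snd y)"
    if xy: "x \<in> D" "y \<in> D" and p: "prec T x y" for x y
  proof (cases "T x = T y")
    case True
    then have "fst x < fst y"
      using p col[OF xy] by (auto simp: prec_def col_precedes_def)
    moreover from this have "\<not> snd x < snd y" using strip[OF xy True] by linarith
    ultimately show ?thesis using True by (auto simp: mprec_def)
  next
    case False
    then show ?thesis using p by (auto simp: prec_def mprec_def)
  qed
  show ?thesis
    unfolding I_set_def Inv_def Min_tab_eq using S M P by blast
qed

section \<open>Row blocks and the composition mu\<close>

text \<open>The pair of \<open>T x\<close> and the row, ordered lexicographically and encoded in one
  number: the factor of \<open>T x\<close> exceeds every row index.\<close>

definition block_key :: "box \<Rightarrow> nat" where
  "block_key x = T x * Suc (\<Sum>z\<in>D. snd z) + snd x"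

lemma block_key_less_iff:
  assumes "x \<in> D" "y \<in> D"
  shows "block_key x < block_key y \<longleftrightarrow> T x < T y \<or> (T x = T y \<and> snd x < snd y)"
    and "block_key x = block_key y \<longleftrightarrow> T x = T y \<and> snd x = snd y"
proof -
  define K where "K = Suc (\<Sum>z\<in>D. snd z)"
  have K: "snd z < K" if "z \<in> D" for z
    unfolding K_def using finite_D that by (simp add: less_Suc_eq_le member_le_sum)
  have lt: "a * K + b < a' * K + b'" if "b < K" "a < a'" for a b a' b' :: nat
  proof -
    have "Suc a * K \<le> a' * K" using that by (intro mult_le_mono1) simp
    then show ?thesis using that by simp
  qed
  show "block_key x < block_key y \<longleftrightarrow> T x < T y \<or> (T x = T y \<and> snd x < snd y)"
    unfolding block_key_def K_def[symmetric]
    using lt[of "snd x" "T x" "T y" "snd y"] lt[of "snd y" "T y" "T x" "snd x"] K assms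
    by (cases "T x" "T y" rule: linorder_cases) auto
  show "block_key x = block_key y \<longleftrightarrow> T x = T y \<and> snd x = snd y"
    unfolding block_key_def K_def[symmetric]
    using lt[of "snd x" "T x" "T y" "snd y"] lt[of "snd y" "T y" "T x" "snd x"] K assms
    by (cases "T x" "T y" rule: linorder_cases) auto
qed

text \<open>The minimal tableau numbers the row blocks one after another, so the row generators are
  the adjacent transpositions inside blocks, and the parts of \<open>mu\<close> are the block
  sizes.\<close>

lemma mu_eq:
  "mu D T = map (\<lambda>k. card {x \<in> D. block_key x = k}) (sorted_list_of_set (block_key ` D))"
proof -
  let ?n = "card D"
  \<comment> \<open>\<open>b i\<close> is the box with index \<open>i\<close> in the minimal
    tableau.\<close>
  define b where "b = inv_into D (min_rank D T)"
  define f where "f i = block_key (b i)" for i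
  have bb: "bij_betw b {1..?n} D" unfolding b_def by (rule bij_betw_inv_into[OF min_rank_bij])
  have bD: "b i \<in> D" "min_rank D T (b i) = i" if "i \<in> {1..?n}" for i
    using that bij_betwE[OF bb] bij_betw_inv_into_right[OF min_rank_bij, of i] by (auto simp: b_def)
  have mono: "mono_on {1..?n} f"
  proof (rule mono_onI)
    fix i j assume ij: "i \<in> {1..?n}" "j \<in> {1..?n}" "i \<le> j"
    have "\<not> min_rank D T (b j) < min_rank D T (b i)" using bD ij by simp
    then have "\<not> mprec T (b j) (b i)" using min_rank_less_iff bD ij by blast
    then show "f i \<le> f j"
      using block_key_less_iff(1)[of "b j" "b i"] bD ij by (auto simp: f_def mprec_def not_less[symmetric])
  qed
  have fib: "card {i \<in> {1..?n}. f i = k} = card {x \<in> D. block_key x = k}" for k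
  proof (rule bij_betw_same_card)
    show "bij_betw b {i \<in> {1..?n}. f i = k} {x \<in> D. block_key x = k}"
    proof (rule bij_betw_subset[OF bb])
      show "b ` {i \<in> {1..?n}. f i = k} = {x \<in> D. block_key x = k}"
      proof (intro equalityI subsetI)
        fix x assume "x \<in> b ` {i \<in> {1..?n}. f i = k}"
        then show "x \<in> {x \<in> D. block_key x = k}" using bD(1) by (auto simp: f_def)
      next
        fix x assume x: "x \<in> {x \<in> D. block_key x = k}"
        then have "x \<in> b ` {1..?n}" using bij_betw_imp_surj_on[OF bb] by simp
        then show "x \<in> b ` {i \<in> {1..?n}. f i = k}" using x by (auto simp: f_def)
      qed
    qed blast
  qed
  have img: "f ` {1..?n} = block_key ` D"
    using bb by (auto simp: f_def bij_betw_def image_image[symmetric, of block_key b])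
  have gens: "row_generators D T =
    {Transposition.transpose i (i + 1) | i. 1 \<le> i \<and> i < ?n \<and> f i = f (i + 1)}"
  proof -
    have "(\<exists>x\<in>D. \<exists>y\<in>D. \<exists>a. snd x = snd y \<and> Min_tab D T x = (i, a) \<and> Min_tab D T y = (i + 1, a)) \<longleftrightarrow>
        f i = f (i + 1)" if i: "1 \<le> i" "i < ?n" for i
    proof -
      have i': "i \<in> {1..?n}" "i + 1 \<in> {1..?n}" using i by auto
      have inj: "x = b j" if "x \<in> D" "min_rank D T x = j" for x j
        using bij_betw_inv_into_left[OF min_rank_bij that(1)] that(2) by (simp add: b_def)
      have "(\<exists>x\<in>D. \<exists>y\<in>D. \<exists>a. snd x = snd y \<and> Min_tab D T x = (i, a) \<and> Min_tab D T y = (i + 1, a)) \<longleftrightarrow>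
          (T (b i) = T (b (i + 1)) \<and> snd (b i) = snd (b (i + 1)))"
      proof
        assume "\<exists>x\<in>D. \<exists>y\<in>D. \<exists>a. snd x = snd y \<and> Min_tab D T x = (i, a) \<and> Min_tab D T y = (i + 1, a)"
        then obtain x y a where xy: "x \<in> D" "y \<in> D" "snd x = snd y"
          "Min_tab D T x = (i, a)" "Min_tab D T y = (i + 1, a)" by blast
        then have rT: "min_rank D T x = i" "min_rank D T y = i + 1" "T x = T y"
          by (simp_all add: Min_tab_eq min_lab_def)
        then show "T (b i) = T (b (i + 1)) \<and> snd (b i) = snd (b (i + 1))"
          using inj[OF xy(1) rT(1)] inj[OF xy(2) rT(2)] xy(3) by simp
      next
        assume "T (b i) = T (b (i + 1)) \<and> snd (b i) = snd (b (i + 1))"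
        then show "\<exists>x\<in>D. \<exists>y\<in>D. \<exists>a. snd x = snd y \<and> Min_tab D T x = (i, a) \<and> Min_tab D T y = (i + 1, a)"
          using bD i' by (intro bexI[of _ "b i"] bexI[of _ "b (i + 1)"]) (auto simp: Min_tab_eq min_lab_def)
      qed
      then show ?thesis using block_key_less_iff(2)[of "b i" "b (i + 1)"] bD i' by (simp add: f_def)
    qed
    then show ?thesis unfolding row_generators_def by blast
  qed
  define \<mu> where "\<mu> = map (\<lambda>k. card {i \<in> {1..?n}. f i = k}) (sorted_list_of_set (f ` {1..?n}))"
  have Y: "young_subgroup \<mu> = generate (sym_group ?n) (row_generators D T)"
    unfolding gens generate_adjacent_transpositions[OF mono] by (rule young_subgroup_fibres(2)[OF mono \<mu>_def])
  have C: "is_composition ?n \<mu>" by (rule young_subgroup_fibres(1)[OF mono \<mu>_def])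
  have "mu D T = \<mu>"
    unfolding mu_def using Y C young_subgroup_inj by (intro the_equality) auto
  then show ?thesis unfolding \<mu>_def fib img .
qed

lemma t_fact_comp_mu:
  "t_fact_comp (mu D T) = (\<Prod>k\<in>block_key ` D. t_fact (card {x \<in> D. block_key x = k}))"
proof -
  have "t_fact_comp (mu D T) =
      prod_list (map (\<lambda>k. t_fact (card {x \<in> D. block_key x = k})) (sorted_list_of_set (block_key ` D)))"
    by (simp add: mu_eq t_fact_comp_def o_def)
  also have "\<dots> = (\<Prod>k\<in>block_key ` D. t_fact (card {x \<in> D. block_key x = k}))"
    using finite_D by (subst prod.distinct_set_conv_list[symmetric]) auto
  finally show ?thesis .
qed

end

subsection \<open>The t-adic valuation\<close>

text \<open>Valuation at least \<open>m\<close>, with 0 included. Coefficients are used because the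
  convention \<open>fls_subdegree 0 = 0\<close> would make 0 a special case everywhere.\<close>

definition fls_vge :: "int \<Rightarrow> 'a::zero fls \<Rightarrow> bool" where
  "fls_vge m f \<longleftrightarrow> (\<forall>i<m. fls_nth f i = 0)"

lemma fls_vge_iff: "fls_vge m f \<longleftrightarrow> f = 0 \<or> m \<le> fls_subdegree f"
proof
  assume "fls_vge m f"
  then show "f = 0 \<or> m \<le> fls_subdegree f"
    by (metis fls_vge_def nth_fls_subdegree_nonzero not_le)
next
  assume "f = 0 \<or> m \<le> fls_subdegree f"
  then show "fls_vge m f" by (auto simp: fls_vge_def)
qed

lemma fls_vge_mono: "fls_vge m f \<Longrightarrow> k \<le> m \<Longrightarrow> fls_vge k f"
  by (auto simp: fls_vge_def)

lemma fls_vge_0 [simp]: "fls_vge m 0"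
  by (simp add: fls_vge_def)

lemma fls_vge_1: "m \<le> 0 \<Longrightarrow> fls_vge m 1"
  by (auto simp: fls_vge_def)

lemma fls_vge_add: "fls_vge m f \<Longrightarrow> fls_vge m g \<Longrightarrow> fls_vge m (f + g)"
  for f :: "'a::monoid_add fls"
  by (auto simp: fls_vge_def)

lemma fls_vge_uminus: "fls_vge m (- f) \<longleftrightarrow> fls_vge m f"
  for f :: "'a::group_add fls"
  by (auto simp: fls_vge_def)

lemma fls_vge_diff: "fls_vge m f \<Longrightarrow> fls_vge m g \<Longrightarrow> fls_vge m (f - g)"
  for f :: "'a::group_add fls"
  by (auto simp: fls_vge_def)

lemma fls_vge_mult: "fls_vge m f \<Longrightarrow> fls_vge k g \<Longrightarrow> fls_vge (m + k) (f * g)"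
  for f :: "'a::field fls"
  by (cases "f = 0 \<or> g = 0") (auto simp: fls_vge_iff)

lemma fls_vge_sum: "(\<And>x. x \<in> A \<Longrightarrow> fls_vge m (f x)) \<Longrightarrow> fls_vge m (sum f A)"
  for f :: "'b \<Rightarrow> 'a::comm_monoid_add fls"
  by (induction A rule: infinite_finite_induct) (auto intro: fls_vge_add)

lemma fls_vge_prod_card:
  fixes f :: "'b \<Rightarrow> 'a::field fls"
  assumes "\<And>x. x \<in> A \<Longrightarrow> fls_vge 1 (f x)"
  shows "fls_vge (int (card A)) (prod f A)"
  using assms
proof (induction A rule: infinite_finite_induct)
  case (insert x F)
  have "fls_vge (1 + int (card F)) (f x * prod f F)" using insert by (intro fls_vge_mult) auto
  then show ?case using insert by simp
qed (auto simp: fls_vge_1)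

lemma fls_vge_mult_diff_1:
  fixes f g :: "'a::field fls"
  assumes "fls_vge m (f - 1)" "fls_vge m (g - 1)" "0 \<le> m"
  shows "fls_vge m (f * g - 1)"
proof -
  have eq: "f * g - 1 = (f - 1) * (g - 1) + ((f - 1) + (g - 1))" by (simp add: algebra_simps)
  have "fls_vge (m + m) ((f - 1) * (g - 1))" using assms by (intro fls_vge_mult)
  then have "fls_vge m ((f - 1) * (g - 1))" using assms(3) by (auto intro: fls_vge_mono)
  then show ?thesis unfolding eq by (intro fls_vge_add assms)
qed

lemma fls_vge_prod_diff_1:
  fixes f :: "'b \<Rightarrow> 'a::field fls"
  assumes "\<And>x. x \<in> A \<Longrightarrow> fls_vge m (f x - 1)" "0 \<le> m"
  shows "fls_vge m (prod f A - 1)"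
  using assms
  by (induction A rule: infinite_finite_induct) (auto intro: fls_vge_mult_diff_1)

lemma fls_subdegree_eq_0_if_vge:
  fixes f :: "'a::field fls"
  assumes "fls_vge 1 (f - 1)"
  shows "f \<noteq> 0" "fls_subdegree f = 0"
proof -
  have nth: "fls_nth f i = fls_nth 1 i" if "i < 1" for i
    using assms that by (auto simp: fls_vge_def)
  have 0: "fls_nth f 0 = 1" using nth[of 0] by simp
  then show "f \<noteq> 0" by auto
  have "fls_nth f i = 0" if "i < 0" for i using nth[of i] that by simp
  then show "fls_subdegree f = 0" using 0 by (intro fls_subdegree_eqI) auto
qed

lemma fls_vge_inverse_0: "fls_vge 1 (f - 1) \<Longrightarrow> fls_vge 0 (inverse f)"
  for f :: "'a::field fls"
  using fls_subdegree_eq_0_if_vge[of f] by (simp add: fls_vge_iff)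

lemma fls_vge_inverse_diff_1:
  fixes f :: "'a::field fls"
  assumes "fls_vge m (f - 1)" "1 \<le> m"
  shows "fls_vge m (inverse f - 1)"
proof -
  have 1: "fls_vge 1 (f - 1)" using assms fls_vge_mono by blast
  have "inverse f - 1 = - ((f - 1) * inverse f)"
    using fls_subdegree_eq_0_if_vge[OF 1] by (simp add: field_simps)
  moreover have "fls_vge (m + 0) ((f - 1) * inverse f)"
    using assms fls_vge_inverse_0[OF 1] by (intro fls_vge_mult)
  ultimately show ?thesis by (simp only: fls_vge_uminus add_0_right)
qed

lemma fls_vge_imp_dist_le:
  assumes "fls_vge (int m) (f - g)"
  shows "dist f g \<le> inverse (2 ^ m)"
proof (cases "f = g")
  case False
  then have d: "int m \<le> fls_subdegree (f - g)" using assms by (auto simp: fls_vge_iff)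
  then have "dist f g = inverse (2 ^ nat (fls_subdegree (f - g)))"
    using False by (simp add: dist_fls_def)
  also have "\<dots> \<le> inverse (2 ^ m)"
    using d by (intro le_imp_inverse_le power_increasing) auto
  finally show ?thesis .
qed simp

text \<open>Divisibility by a power of t passes to sums. Hence one good partial sum with small terms
  outside it controls every larger finite partial sum.\<close>

lemma has_sum_flsI:
  fixes f :: "'b \<Rightarrow> 'a::field fls"
  assumes "\<And>m. \<exists>F. finite F \<and> F \<subseteq> A \<and> (\<forall>x\<in>A - F. fls_vge m (f x)) \<and> fls_vge m (sum f F - L)"
  shows "(f has_sum L) A"
  unfolding has_sum_def
proof (rule tendstoI)
  fix e :: real assume e: "0 < e"
  obtain n where n: "inverse (2 ^ n) < e"
    using real_arch_pow_inv[OF e, of "1 / 2"] by (auto simp: power_one_over inverse_eq_divide)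
  obtain F where F: "finite F" "F \<subseteq> A" "\<And>x. x \<in> A - F \<Longrightarrow> fls_vge (int n) (f x)"
    "fls_vge (int n) (sum f F - L)"
    using assms[of "int n"] by blast
  have "dist (sum f G) L < e" if G: "finite G" "F \<subseteq> G" "G \<subseteq> A" for G
  proof -
    have "sum f G - L = (sum f F - L) + sum f (G - F)"
      using G by (simp add: sum_diff)
    moreover have "fls_vge (int n) (sum f (G - F))" using F(3) G by (intro fls_vge_sum) auto
    ultimately have "fls_vge (int n) (sum f G - L)" using F(4) by (simp only: fls_vge_add)
    then show ?thesis using fls_vge_imp_dist_le n by fastforce
  qed
  then show "\<forall>\<^sub>F G in finite_subsets_at_top A. dist (sum f G) L < e"
    unfolding eventually_finite_subsets_at_top using F by blast
qed

section \<open>Monomials in q and t, and t-factorials\<close>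

lemma t_nz [simp]: "t \<noteq> 0"
  by (simp add: t_def)

lemma q_nz [simp]: "q \<noteq> 0"
  by (simp add: q_def fls_const_nonzero eq_fract(1) Zero_fract_def)

lemma subdegree_q [simp]: "fls_subdegree q = 0"
  by (simp add: q_def)

lemma subdegree_t [simp]: "fls_subdegree t = 1"
  by (simp add: t_def)

lemma q_power_eq_1_iff: "q ^ n = 1 \<longleftrightarrow> n = 0"
proof
  assume "q ^ n = 1"
  then have "Fraction_Field.Fract [:0, 1::rat:] 1 ^ n = 1"
    unfolding q_def fls_const_power[symmetric] fls_const_eq_1_iff .
  moreover have "Fraction_Field.Fract [:0, 1::rat:] 1 ^ n = Fraction_Field.Fract ([:0, 1:] ^ n) 1"
    by (induction n) (simp_all add: One_fract_def)
  ultimately have "[:0, 1::rat:] ^ n = 1"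
    by (simp add: One_fract_def eq_fract)
  then have "degree ([:0, 1::rat:] ^ n) = 0" by simp
  then show "n = 0" by (simp add: degree_power_eq)
qed simp

text \<open>The valuation isolates the exponent of t, then the degree that of q. The nonvanishing of
  1 - r and 1 - t r for boxes in reading order rests on this.\<close>

lemma q_powi_t_powi_eq_1_iff: "q powi a * t powi b = 1 \<longleftrightarrow> a = 0 \<and> b = 0"
proof
  assume eq: "q powi a * t powi b = 1"
  have "fls_subdegree (q powi a * t powi b) = b" by simp
  then have b: "b = 0" unfolding eq by simp
  then have "q powi a = 1" using eq by simp
  then have "q ^ nat \<bar>a\<bar> = 1" by (auto simp: power_int_def power_inverse split: if_splits)
  then show "a = 0 \<and> b = 0" using b by (simp add: q_power_eq_1_iff)
qed simp

lemma fls_vge_q_powi_t_powi: "m \<le> b \<Longrightarrow> fls_vge m (q powi a * t powi b)"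
  by (simp add: fls_vge_iff)

lemma t_power_neq_1: "0 < n \<Longrightarrow> t ^ n \<noteq> 1"
  using q_powi_t_powi_eq_1_iff[of 0 "int n"] by simp

lemma t_neq_1 [simp]: "t \<noteq> 1"
  using t_power_neq_1[of 1] by simp

lemma t_fact_nz [simp]: "t_fact m \<noteq> 0"
  using t_power_neq_1 by (simp add: t_fact_def)

lemma t_fact_Suc: "t_fact (Suc m) = t_fact m * ((1 - t ^ Suc m) / (1 - t))"
  by (simp add: t_fact_def)

text \<open>Used with \<open>n = N\<close>: up to factors tending to 1 as \<open>k\<close> grows,
  the quotient of the factorials of N + k and k is the inverse of (1 - t)^N.\<close>

lemma t_fact_add: "(1 - t) ^ n * t_fact (n + k) = t_fact k * (\<Prod>i=1..n. 1 - t ^ (k + i))"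
proof (induction n)
  case (Suc n)
  have "(1 - t) ^ Suc n * t_fact (Suc n + k) = ((1 - t) ^ n * t_fact (n + k)) * (1 - t ^ (Suc n + k))"
    by (simp add: t_fact_Suc)
  also have "\<dots> = t_fact k * (\<Prod>i=1..Suc n. 1 - t ^ (k + i))"
    unfolding Suc.IH by (simp add: ac_simps)
  finally show ?case .
qed simp

text \<open>A new right end adds the pairs at distances 1, ..., m. Their factors telescope to (1 -
  t) / (1 - t^(m+1)), the inverse of the last factor of \<open>t_fact (Suc m)\<close>.\<close>

lemma prod_interval_pairs:
  "(\<Prod>(i, j)\<in>rel_pairs (<) {a..<a + m}. (1 - t ^ (j - i)) / (1 - t ^ Suc (j - i))) = 1 / t_fact m"
proof (induction m)
  case 0
  then show ?case by (simp add: rel_pairs_def t_fact_def)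
next
  case (Suc m)
  let ?h = "\<lambda>i j. (1 - t ^ (j - i)) / (1 - t ^ Suc (j - i))"
  have I: "{a..<a + Suc m} - {a + m} = {a..<a + m}" by auto
  have "(\<Prod>(i, j)\<in>rel_pairs (<) {a..<a + Suc m}. ?h i j) =
      (\<Prod>(i, j)\<in>rel_pairs (<) {a..<a + m}. ?h i j) *
      (\<Prod>i\<in>{a..<a + m}. if i < a + m then ?h i (a + m) else ?h (a + m) i)"
    unfolding I[symmetric] by (rule prod_rel_pairs_remove) auto
  also have "(\<Prod>i\<in>{a..<a + m}. if i < a + m then ?h i (a + m) else ?h (a + m) i) =
      (\<Prod>l<m. (1 - t ^ Suc l) / (1 - t ^ Suc (Suc l)))"
    by (rule prod.reindex_bij_witness[where i = "\<lambda>l. a + m - Suc l" and j = "\<lambda>i. a + m - Suc i"])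
      (auto simp: Suc_diff_Suc simp del: power_Suc)
  also have "\<dots> = (1 - t ^ Suc 0) / (1 - t ^ Suc m)"
    using t_power_neq_1 by (intro prod_lessThan_telescope') (auto simp del: power_Suc)
  finally show ?case
    unfolding Suc.IH t_fact_Suc by simp
qed

subsection \<open>Truncations of the infinite diagram\<close>

lemma diagram_lower:
  assumes "sorted_wrt (\<ge>) \<kappa>" "(a, b) \<in> diagram \<kappa>" "1 \<le> a'" "a' \<le> a" "1 \<le> b'" "b' \<le> b"
  shows "(a', b') \<in> diagram \<kappa>"
proof -
  have "\<kappa> ! (b - 1) \<le> \<kappa> ! (b' - 1)"
  proof (cases "b' = b")
    case False
    then show ?thesis
      using assms by (intro sorted_wrt_nth_less[of "(\<ge>)"]) (auto simp: diagram_def)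
  qed simp
  then show ?thesis using assms by (auto simp: diagram_def)
qed

lemma finite_diagram: "finite (diagram \<kappa>)" and card_diagram: "card (diagram \<kappa>) = sum_list \<kappa>"
proof -
  have D: "diagram \<kappa> = prod.swap ` (SIGMA b:{1..length \<kappa>}. {1..\<kappa> ! (b - 1)})"
    by (auto simp: diagram_def image_iff)
  show "finite (diagram \<kappa>)" unfolding D by auto
  have "card (diagram \<kappa>) = (\<Sum>b\<in>{1..length \<kappa>}. \<kappa> ! (b - 1))"
    unfolding D by (subst card_image) auto
  also have "\<dots> = (\<Sum>i<length \<kappa>. \<kappa> ! i)"
    by (rule sum.reindex_bij_witness[where i = Suc and j = "\<lambda>b. b - 1"]) auto
  finally show "card (diagram \<kappa>) = sum_list \<kappa>"
    by (simp add: sum_list_sum_nth atLeast0LessThan)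
qed

lemma mem_diagram_padded:
  "(a, b) \<in> diagram (padded lam n) \<longleftrightarrow>
     1 \<le> a \<and> (b = 1 \<and> a \<le> n - sum_list lam \<or> 2 \<le> b \<and> b \<le> Suc (length lam) \<and> a \<le> lam ! (b - 2))"
proof (cases "b \<le> 1")
  case True
  then have "b = 0 \<or> b = 1" by auto
  then show ?thesis by (auto simp: diagram_def padded_def)
next
  case False
  then obtain c where "b = Suc (Suc c)" by (metis Suc_le_D not_less_eq_eq One_nat_def not0_implies_Suc le0)
  then show ?thesis by (auto simp: diagram_def padded_def)
qed

lemma mem_inf_diagram:
  "(a, b) \<in> inf_diagram lam \<longleftrightarrow>
     1 \<le> a \<and> (b = 1 \<or> 2 \<le> b \<and> b \<le> Suc (length lam) \<and> a \<le> lam ! (b - 2))" (is "?L \<longleftrightarrow> ?R")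
proof
  assume ?L
  then show ?R unfolding inf_diagram_def by (auto simp: mem_diagram_padded)
next
  assume ?R
  then have "(a, b) \<in> diagram (padded lam (n_min lam + a + sum_list lam))"
    unfolding mem_diagram_padded by auto
  then show ?L unfolding inf_diagram_def by (rule UN_I[rotated]) simp
qed

lemma sorted_padded:
  assumes "is_partition lam" "n_min lam \<le> n"
  shows "sorted_wrt (\<ge>) (padded lam n)"
proof -
  have "x \<le> n - sum_list lam" if x: "x \<in> set lam" for x
  proof -
    have "lam \<noteq> []" using x by auto
    then have "x \<le> hd lam" using assms(1) x by (cases lam) (auto simp: is_partition_def)
    then show ?thesis using assms(2) \<open>lam \<noteq> []\<close> by (simp add: n_min_def)
  qed
  then show ?thesis using assms(1) by (auto simp: padded_def is_partition_def)
qed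

locale stable_filling =
  fixes lam :: "nat list" and T :: "box \<Rightarrow> nat"
  assumes part: "is_partition lam" and Omega: "T \<in> Omega lam"
begin

definition D where "D = inf_diagram lam"
definition N where "N = rk lam T"
text \<open>The length of the first row of lambda^(N); the tail starts in column
  \<open>Suc M\<close>.\<close>

definition M where "M = N - sum_list lam"
(* Diagrams: core = lambda^(N) and trunc k = lambda^(N + k), which adds the k boxes of tail k to the first row. *)
definition core where "core = diagram (padded lam N)"
definition tail where "tail k = (\<lambda>a. (a, 1 :: nat)) ` {Suc M..<Suc M + k}"
definition trunc where "trunc k = diagram (padded lam (N + k))"

lemma n_min_le_N: "n_min lam \<le> N" and T_outside: "x \<in> D \<Longrightarrow> x \<notin> core \<Longrightarrow> T x = 0"
proof -
  let ?P = "\<lambda>n. n_min lam \<le> n \<and> (\<forall>x \<in> inf_diagram lam - diagram (padded lam n). T x = 0)"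
  have "finite (fst ` {x \<in> inf_diagram lam. T x \<noteq> 0})"
    using Omega by (auto simp: Omega_def)
  then obtain B where "\<forall>a \<in> fst ` {x \<in> inf_diagram lam. T x \<noteq> 0}. a \<le> B"
    unfolding finite_nat_set_iff_bounded_le by blast
  then have B: "T (a, b) = 0" if "(a, b) \<in> inf_diagram lam" "B < a" for a b
    using that by force
  \<comment> \<open>The first row of this truncation has at least \<open>B\<close> boxes, so a box
    outside it lies in the first row beyond column \<open>B\<close>. This witness makes the
    \<open>LEAST\<close> in \<open>rk\<close> meaningful.\<close>
  have "?P (n_min lam + sum_list lam + B)"
  proof (intro conjI ballI)
    fix x assume x: "x \<in> inf_diagram lam - diagram (padded lam (n_min lam + sum_list lam + B))"
    obtain a b where ab: "x = (a, b)" by fastforce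
    have "B < a"
      using x unfolding ab by (auto simp: mem_inf_diagram mem_diagram_padded not_le)
    then show "T x = 0" using B[of a b] x ab by simp
  qed simp
  then have "?P (rk lam T)" unfolding rk_def by (rule LeastI)
  then show "n_min lam \<le> N" "x \<in> D \<Longrightarrow> x \<notin> core \<Longrightarrow> T x = 0"
    by (auto simp: N_def D_def core_def)
qed

lemma N_eq: "N = M + sum_list lam"
  using n_min_le_N by (simp add: M_def n_min_def split: if_splits)

lemma core_trunc: "core = trunc 0"
  by (simp add: core_def trunc_def)

lemma finite_trunc: "finite (trunc k)" and card_trunc: "card (trunc k) = N + k"
  by (simp_all add: trunc_def finite_diagram card_diagram padded_def N_eq)

lemma mem_trunc:
  "(a, b) \<in> trunc k \<longleftrightarrow>
     1 \<le> a \<and> (b = 1 \<and> a \<le> M + k \<or> 2 \<le> b \<and> b \<le> Suc (length lam) \<and> a \<le> lam ! (b - 2))"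
  by (simp add: trunc_def mem_diagram_padded N_eq)

lemma trunc_subset: "trunc k \<subseteq> D"
proof (rule subrelI)
  show "(a, b) \<in> D" if "(a, b) \<in> trunc k" for a b
    using that by (auto simp: mem_trunc D_def mem_inf_diagram)
qed

lemma mem_D_cases: "x \<in> D \<Longrightarrow> x \<in> trunc k \<or> (\<exists>a>M + k. x = (a, 1))"
  by (cases x) (auto simp: D_def mem_inf_diagram mem_trunc)

lemma tail_mem_D: "1 \<le> a \<Longrightarrow> (a, 1) \<in> D"
  by (simp add: D_def mem_inf_diagram)

lemma mem_tail: "x \<in> tail k \<longleftrightarrow> (\<exists>a. x = (a, 1) \<and> M < a \<and> a \<le> M + k)"
  by (auto simp: tail_def)

lemma trunc_eq: "trunc k = core \<union> tail k"
proof -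
  have "(a, b) \<in> trunc k \<longleftrightarrow> (a, b) \<in> core \<union> tail k" for a b
    by (auto simp: mem_tail core_trunc mem_trunc)
  then show ?thesis by auto
qed

lemma core_tail_disjoint: "core \<inter> tail k = {}"
  by (auto simp: core_trunc mem_tail mem_trunc)

lemma core_fst_le:
  assumes "x \<in> core"
  shows "fst x \<le> M"
proof -
  obtain a b where x: "x = (a, b)" by fastforce
  have ab: "(a, b) \<in> diagram (padded lam N)" using assms x by (simp add: core_def)
  then have "1 \<le> a" "1 \<le> b" by (auto simp: diagram_def)
  then have "(a, 1) \<in> diagram (padded lam N)"
    using diagram_lower[OF sorted_padded[OF part n_min_le_N] ab] by simp
  then show ?thesis by (simp add: x mem_diagram_padded M_def)
qed

sublocale strict_filling D T
proof
  show "1 \<le> fst x \<and> 1 \<le> snd x" if "x \<in> D" for x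
    using that by (cases x) (auto simp: D_def mem_inf_diagram)
  show "(a', b') \<in> D" if ab: "(a, b) \<in> D" and le: "1 \<le> a'" "a' \<le> a" "1 \<le> b'" "b' \<le> b" for a b a' b'
  proof -
    obtain n where n: "n_min lam \<le> n" "(a, b) \<in> diagram (padded lam n)"
      using ab by (auto simp: D_def inf_diagram_def)
    then have "(a', b') \<in> diagram (padded lam n)"
      using le diagram_lower[OF sorted_padded[OF part n(1)] n(2)] by blast
    then show ?thesis using n(1) by (auto simp: D_def inf_diagram_def)
  qed
  show "T y \<le> T x" if "x \<in> D" "y \<in> D" "snd x = snd y" "fst x < fst y" for x y
    using Omega that unfolding Omega_def D_def by blast
  show "T y < T x" if "x \<in> D" "y \<in> D" "fst x = fst y" "snd x < snd y" for x y
    using Omega that unfolding Omega_def D_def by blast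
qed

text \<open>Stated for any \<open>T'\<close> that agrees with \<open>T\<close> on the truncation,
  since both \<open>T\<close> and its restriction T_N are needed.\<close>

lemma finite_strict_filling_trunc:
  assumes T': "\<And>x. x \<in> trunc k \<Longrightarrow> T' x = T x"
  shows "finite_strict_filling (trunc k) T'"
proof
  show "1 \<le> fst x \<and> 1 \<le> snd x" if "x \<in> trunc k" for x
    using that pos trunc_subset by blast
  show "(a', b') \<in> trunc k" if "(a, b) \<in> trunc k" "1 \<le> a'" "a' \<le> a" "1 \<le> b'" "b' \<le> b" for a b a' b'
    using that n_min_le_N diagram_lower[OF sorted_padded[OF part]] unfolding trunc_def
    by (meson trans_le_add1)
  show "T' y \<le> T' x" if "x \<in> trunc k" "y \<in> trunc k" "snd x = snd y" "fst x < fst y" for x y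
    using T' that row trunc_subset by (metis subsetD)
  show "T' y < T' x" if "x \<in> trunc k" "y \<in> trunc k" "fst x = fst y" "snd x < snd y" for x y
    using T' that col trunc_subset by (metis subsetD)
  show "finite (trunc k)" by (rule finite_trunc)
qed

lemma T_tail: "M < a \<Longrightarrow> T (a, 1) = 0"
  using T_outside[of "(a, 1)"] tail_mem_D[of a] core_fst_le[of "(a, 1)"] by auto

text \<open>On the tail \<open>T\<close> vanishes, its smallest value, and the tail lies to the
  right of every core box.\<close>

lemma core_prec_tail:
  assumes "x \<in> core" "M < a"
  shows "prec T x (a, 1)"
  using T_tail[OF assms(2)] core_fst_le[OF assms(1)] assms(2)
  by (auto simp: prec_def col_precedes_def)

lemma prec_tail_tail: "M < a \<Longrightarrow> M < a' \<Longrightarrow> prec T (a, 1) (a', 1) \<longleftrightarrow> a < a'"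
  using T_tail[of a] T_tail[of a'] by (simp add: prec_def col_precedes_def)

lemma core_content_less: "x \<in> core \<Longrightarrow> box_content x < int M"
  using core_fst_le[of x] pos[of x] trunc_subset[of 0] by (force simp: box_content_def core_trunc)

lemma finite_predecessors:
  assumes "y \<in> D"
  shows "finite {z \<in> D. prec T z y}"
proof -
  have "{z \<in> D. prec T z y} \<subseteq> trunc (fst y)"
  proof
    fix z assume z: "z \<in> {z \<in> D. prec T z y}"
    show "z \<in> trunc (fst y)"
    proof (rule ccontr)
      assume "z \<notin> trunc (fst y)"
      then obtain a where a: "z = (a, 1)" "M + fst y < a" using mem_D_cases z by blast
      then have "T z = 0" using T_tail by simp
      then show False using z a by (auto simp: prec_def col_precedes_def)
    qed
  qed
  then show ?thesis using finite_trunc finite_subset by blast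
qed

section \<open>Labellings determined by a truncation\<close>

text \<open>The labellings counted at stage \<open>k\<close>. A bound on the core is enough: it
  forces the labels up to N + k into \<open>trunc k\<close> and fixes every label beyond it.\<close>

definition restricted_labs :: "nat \<Rightarrow> (box \<Rightarrow> label) set" where
  "restricted_labs k = {\<tau> \<in> APSYT_of lam T. \<forall>x\<in>core. fst (\<tau> x) \<le> N + k}"

lemma APSYT_of_iff:
  "\<tau> \<in> APSYT_of lam T \<longleftrightarrow> \<tau> \<in> extensional D \<and> (\<forall>x\<in>D. snd (\<tau> x) = T x) \<and>
     bij_betw (fst \<circ> \<tau>) D {1..} \<and> row_increasing D T (fst \<circ> \<tau>)"
proof (cases "\<forall>x\<in>D. snd (\<tau> x) = T x")
  case True
  have si: "strictly_increasing D \<tau> \<longleftrightarrow> row_increasing D T (fst \<circ> \<tau>)"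
    using True by (intro strictly_increasing_iff) auto
  have supp: "finite {x \<in> D. 0 < snd (\<tau> x)}"
  proof -
    have "finite {x \<in> D. T x \<noteq> 0}" using Omega by (simp add: Omega_def D_def)
    moreover have "{x \<in> D. 0 < snd (\<tau> x)} = {x \<in> D. T x \<noteq> 0}" using True by auto
    ultimately show ?thesis by simp
  qed
  show ?thesis
  proof
    assume L: "\<tau> \<in> APSYT_of lam T"
    then have A: "\<tau> \<in> D \<rightarrow>\<^sub>E {1..} \<times> UNIV" "strictly_increasing D \<tau>"
      "\<forall>i\<ge>1. \<exists>!x. x \<in> D \<and> fst (\<tau> x) = i" by (auto simp: APSYT_of_def APSYT_def D_def)
    have mem: "(fst \<circ> \<tau>) x \<in> {1..}" if "x \<in> D" for x
      using PiE_mem[OF A(1) that] by (auto simp: mem_Times_iff)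
    have "bij_betw (fst \<circ> \<tau>) D {1..}"
      using bij_betw_iff_ex1[of D "fst \<circ> \<tau>" "{1..}"] mem A(3) by simp
    then show "\<tau> \<in> extensional D \<and> (\<forall>x\<in>D. snd (\<tau> x) = T x) \<and>
     bij_betw (fst \<circ> \<tau>) D {1..} \<and> row_increasing D T (fst \<circ> \<tau>)"
      using A si True by (simp add: PiE_def)
  next
    assume R: "\<tau> \<in> extensional D \<and> (\<forall>x\<in>D. snd (\<tau> x) = T x) \<and>
     bij_betw (fst \<circ> \<tau>) D {1..} \<and> row_increasing D T (fst \<circ> \<tau>)"
    then have mem: "(fst \<circ> \<tau>) x \<in> {1..}" if "x \<in> D" for x using that by (blast dest: bij_betwE)
    then have "\<tau> \<in> D \<rightarrow>\<^sub>E {1..} \<times> UNIV" using R by (force simp: PiE_def mem_Times_iff)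
    moreover have "\<forall>i\<ge>1. \<exists>!x. x \<in> D \<and> fst (\<tau> x) = i"
      using R bij_betw_iff_ex1[of D "fst \<circ> \<tau>" "{1..}"] mem by auto
    ultimately show "\<tau> \<in> APSYT_of lam T"
      using R si supp by (simp add: APSYT_of_def APSYT_def D_def)
  qed
next
  case False
  then show ?thesis unfolding APSYT_of_def D_def by blast
qed

lemma Inv_eq:
  assumes "\<tau> \<in> APSYT_of lam T"
  shows "Inv D \<tau> = {(x, y). x \<in> D \<and> y \<in> D \<and> prec T x y \<and> fst (\<tau> y) < fst (\<tau> x)}"
proof -
  have "S_lab D (snd \<circ> \<tau>) x < S_lab D (snd \<circ> \<tau>) y \<longleftrightarrow> prec T x y" if "x \<in> D" "y \<in> D" for x y
    using assms that finite_predecessors by (intro S_lab_less_iff) (auto simp: APSYT_of_iff)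
  then show ?thesis unfolding Inv_def by blast
qed

text \<open>The set \<open>U\<close> of boxes with labels up to N + k is as large as
  \<open>trunc k\<close>. The labels increase along the tail, so a box of \<open>U\<close> outside
  \<open>trunc k\<close> would pull all of \<open>trunc k\<close> into \<open>U\<close>, making
  \<open>U\<close> too large.\<close>

lemma APSYT_image_trunc:
  assumes \<tau>: "\<tau> \<in> restricted_labs k"
  shows "(fst \<circ> \<tau>) ` trunc k = {1..N + k}"
proof -
  have bij: "bij_betw (fst \<circ> \<tau>) D {1..}" and inc: "row_increasing D T (fst \<circ> \<tau>)"
    and core_le: "\<And>x. x \<in> core \<Longrightarrow> fst (\<tau> x) \<le> N + k"
    using \<tau> by (auto simp: restricted_labs_def APSYT_of_iff)
  define U where "U = {x \<in> D. fst (\<tau> x) \<le> N + k}"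
  have img: "(fst \<circ> \<tau>) ` U = {1..N + k}"
  proof (intro equalityI subsetI)
    fix j assume j: "j \<in> {1..N + k}"
    then have "j \<in> (fst \<circ> \<tau>) ` D" using bij_betw_imp_surj_on[OF bij] by simp
    then show "j \<in> (fst \<circ> \<tau>) ` U" using j by (auto simp: U_def)
  next
    fix j assume "j \<in> (fst \<circ> \<tau>) ` U"
    then show "j \<in> {1..N + k}" using bij_betwE[OF bij] by (auto simp: U_def)
  qed
  have injU: "inj_on (fst \<circ> \<tau>) U"
    using bij_betw_imp_inj_on[OF bij] by (rule inj_on_subset) (auto simp: U_def)
  have cardU: "card U = N + k" using card_image[OF injU] img by simp
  have finU: "finite U" using finite_image_iff[OF injU] img by simp
  have "U \<subseteq> trunc k"
  proof (rule ccontr)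
    assume "\<not> U \<subseteq> trunc k"
    then obtain y where y: "y \<in> U" "y \<notin> trunc k" by blast
    then obtain a where a: "y = (a, 1)" "M + k < a" using mem_D_cases[of y k] by (auto simp: U_def)
    have "trunc k \<subseteq> U"
    proof
      fix x assume x: "x \<in> trunc k"
      then have xD: "x \<in> D" using trunc_subset by blast
      have "fst (\<tau> x) \<le> N + k"
      proof (cases "x \<in> core")
        case False
        then obtain c where c: "x = (c, 1)" "M < c" "c \<le> M + k"
          using x by (auto simp: trunc_eq mem_tail)
        have "T x = T y" using T_tail a c by simp
        moreover have "snd x = snd y" "fst x < fst y" using a c by auto
        moreover have "y \<in> D" using y by (simp add: U_def)
        ultimately have "(fst \<circ> \<tau>) x < (fst \<circ> \<tau>) y"
          using inc xD unfolding row_increasing_def by blast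
        then show ?thesis using y by (simp add: U_def)
      qed (rule core_le)
      then show "x \<in> U" using xD by (simp add: U_def)
    qed
    then have "insert y (trunc k) \<subseteq> U" using y by blast
    then have "card (insert y (trunc k)) \<le> card U" by (rule card_mono[OF finU])
    then show False using y finite_trunc by (simp add: card_trunc cardU)
  qed
  then have "U = trunc k"
    using card_subset_eq[OF finite_trunc, of U k] by (simp add: cardU card_trunc)
  then show ?thesis using img by simp
qed

lemma restricted_labs_mono: "k \<le> l \<Longrightarrow> restricted_labs k \<subseteq> restricted_labs l"
  by (force simp: restricted_labs_def)

text \<open>Consecutive truncations differ by one box, which takes the one label by which their
  images differ. For the box in column M + l + 1 this is N + l + 1, the column plus
  |lambda|.\<close>

lemma APSYT_tail:
  assumes \<tau>: "\<tau> \<in> restricted_labs k" and a: "M + k < a"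
  shows "fst (\<tau> (a, 1)) = a + sum_list lam"
proof -
  have bij: "bij_betw (fst \<circ> \<tau>) D {1..}"
    using \<tau> by (auto simp: restricted_labs_def APSYT_of_iff)
  define l where "l = a - M - 1"
  have l: "k \<le> l" "a = M + l + 1" using a by (auto simp: l_def)
  have \<tau>l: "\<tau> \<in> restricted_labs l" "\<tau> \<in> restricted_labs (Suc l)"
    using \<tau> restricted_labs_mono[of k l] restricted_labs_mono[of k "Suc l"] l by auto
  have "(a, 1) \<in> trunc (Suc l)" using l by (simp add: mem_trunc)
  then have "(fst \<circ> \<tau>) (a, 1) \<in> {1..N + Suc l}"
    using APSYT_image_trunc[OF \<tau>l(2)] by blast
  moreover have "(fst \<circ> \<tau>) (a, 1) \<notin> {1..N + l}"
  proof
    assume "(fst \<circ> \<tau>) (a, 1) \<in> {1..N + l}"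
    then obtain x where x: "x \<in> trunc l" "(fst \<circ> \<tau>) x = (fst \<circ> \<tau>) (a, 1)"
      using APSYT_image_trunc[OF \<tau>l(1)] by (metis imageE)
    then have "x = (a, 1)"
      using bij_betw_imp_inj_on[OF bij] trunc_subset tail_mem_D[of a] l
      by (auto simp: inj_on_def)
    then show False using x l by (simp add: mem_trunc)
  qed
  ultimately show ?thesis using l by (simp add: N_eq)
qed

end

subsection \<open>Sums over truncations\<close>

lemma finite_vge_bound: "finite F \<Longrightarrow> \<exists>m. \<forall>f\<in>F. fls_vge m f"
proof (induction F rule: finite_induct)
  case (insert f F)
  then obtain m where "\<forall>f\<in>F. fls_vge m f" by blast
  then have "\<forall>g\<in>insert f F. fls_vge (min m (fls_subdegree f)) g"
    by (auto simp: fls_vge_iff)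
  then show ?case by blast
qed simp

lemma convex_nat_eq_interval:
  assumes "finite S" "S \<noteq> {}" and conv: "\<And>a b c. a \<in> S \<Longrightarrow> c \<in> S \<Longrightarrow> a \<le> b \<Longrightarrow> b \<le> c \<Longrightarrow> b \<in> S"
  shows "\<exists>a. S = {a..<a + card S}"
proof -
  have S: "S = {Min S..Max S}"
  proof (intro equalityI subsetI)
    show "x \<in> {Min S..Max S}" if "x \<in> S" for x using assms(1) that by simp
    show "x \<in> S" if "x \<in> {Min S..Max S}" for x
      using conv[OF Min_in[OF assms(1,2)] Max_in[OF assms(1,2)]] that by simp
  qed
  have "Min S \<le> Max S" using assms(1,2) by simp
  moreover have "card S = Suc (Max S) - Min S" by (subst S) simp
  ultimately have "{Min S..Max S} = {Min S..<Min S + card S}" by auto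
  with S have "S = {Min S..<Min S + card S}" by (rule trans)
  then show ?thesis by blast
qed

context stable_filling
begin

section \<open>The symmetrization on a truncation\<close>

definition z :: "box \<Rightarrow> Qqt" where
  "z x = q powi int (T x) * t powi box_content x"

definition r :: "box \<Rightarrow> box \<Rightarrow> Qqt" where
  "r x y = q powi (int (T y) - int (T x)) * t powi (box_content y - box_content x)"

definition wt :: "box \<Rightarrow> box \<Rightarrow> Qqt" where
  "wt x y = (t - r x y) / (1 - t * r x y)"

definition ratio :: "box \<Rightarrow> box \<Rightarrow> Qqt" where
  "ratio x y = (1 - r x y) / (1 - t * r x y)"

lemma z_nz [simp]: "z x \<noteq> 0"
  by (simp add: z_def)

lemma r_eq: "r x y = z y / z x"
  by (simp add: r_def z_def power_int_diff)

lemma t_times_r: "t * r x y = q powi (int (T y) - int (T x)) * t powi (box_content y - box_content x + 1)"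
  by (simp add: r_def power_int_add)

lemma statement_weight_eq:
  "t * ((1 - q powi (int (T y) - int (T x)) * t powi (box_content y - box_content x - 1)) /
     (1 - q powi (int (T y) - int (T x)) * t powi (box_content y - box_content x + 1))) = wt x y"
proof -
  have "t * (1 - q powi (int (T y) - int (T x)) * t powi (box_content y - box_content x - 1)) = t - r x y"
    by (simp add: r_def power_int_diff[of t "box_content y - box_content x" 1] right_diff_distrib)
  then show ?thesis unfolding wt_def t_times_r[symmetric] times_divide_eq_right by simp
qed

lemma statement_ratio_eq:
  "(1 - q powi (int (T y) - int (T x)) * t powi (box_content y - box_content x)) /
     (1 - q powi (int (T y) - int (T x)) * t powi (box_content y - box_content x + 1)) = ratio x y"
  unfolding ratio_def t_times_r by (simp add: r_def)

text \<open>If the exponent of q is 0, both boxes lie in one level set, and there the exponent of t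
  is positive.\<close>

lemma prec_nz:
  assumes "x \<in> D" "y \<in> D" "prec T x y"
  shows "r x y \<noteq> 1" "t * r x y \<noteq> 1"
proof -
  have "int (T y) - int (T x) = 0 \<Longrightarrow> box_content x < box_content y"
    using prec_content[OF assms(1,2) _ assms(3)] by simp
  then show "r x y \<noteq> 1" "t * r x y \<noteq> 1"
    unfolding t_times_r unfolding r_def q_powi_t_powi_eq_1_iff by auto
qed

text \<open>This is \<open>hall_littlewood\<close> at u = t divided by \<open>P\<close>: a pair
  whose labels follow the reading order contributes 1, an inverted pair its \<open>wt\<close>. The
  variables are distinct because r differs from 1.\<close>

lemma sum_bij_labs_trunc:
  "(\<Sum>\<sigma>\<in>bij_labs (trunc k). \<Prod>(x, y)\<in>rel_pairs (prec T) (trunc k). if \<sigma> x < \<sigma> y then 1 else wt x y) =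
   t_fact (N + k) * (\<Prod>(x, y)\<in>rel_pairs (prec T) (trunc k). ratio x y)"
proof -
  let ?R = "rel_pairs (prec T) (trunc k)"
  have R: "x \<in> D" "y \<in> D" "prec T x y" if "(x, y) \<in> ?R" for x y
    using that trunc_subset by (auto simp: rel_pairs_def)
  have den: "z x - t * z y = z x * (1 - t * r x y)" for x y
    by (simp add: r_eq right_diff_distrib)
  define P where "P = (\<Prod>(x, y)\<in>?R. z x - t * z y)"
  have den_nz: "z x - t * z y \<noteq> 0" if "(x, y) \<in> ?R" for x y
    unfolding den using prec_nz(2)[OF R[OF that]] by simp
  then have P: "P \<noteq> 0"
    unfolding P_def using finite_rel_pairs[OF finite_trunc] by (auto simp: prod_zero_iff)
  have inj: "inj_on z (trunc k)"
  proof (rule inj_onI)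
    fix x y assume xy: "x \<in> trunc k" "y \<in> trunc k" "z x = z y"
    have "\<not> prec T x y" "\<not> prec T y x"
      using prec_nz(1)[of x y] prec_nz(1)[of y x] xy trunc_subset by (auto simp: r_eq)
    then show "x = y" using prec_linear by blast
  qed
  have HL: "(\<Sum>\<sigma>\<in>bij_labs (trunc k). \<Prod>(x, y)\<in>?R. if \<sigma> x < \<sigma> y then z x - t * z y else t * z x - z y) =
    (\<Prod>i=1..card (trunc k). (1 - t ^ i) / (1 - t)) * (\<Prod>(x, y)\<in>?R. z x - z y)"
    by (rule hall_littlewood[OF finite_trunc inj z_nz t_neq_1])
      (use prec_linear prec_asym prec_irrefl in blast)+
  have "(\<Sum>\<sigma>\<in>bij_labs (trunc k). \<Prod>(x, y)\<in>?R. if \<sigma> x < \<sigma> y then 1 else wt x y) * P =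
    (\<Sum>\<sigma>\<in>bij_labs (trunc k). \<Prod>(x, y)\<in>?R. if \<sigma> x < \<sigma> y then z x - t * z y else t * z x - z y)"
    unfolding sum_distrib_right
  proof (rule sum.cong)
    fix \<sigma>
    show "(\<Prod>(x, y)\<in>?R. if \<sigma> x < \<sigma> y then 1 else wt x y) * P =
      (\<Prod>(x, y)\<in>?R. if \<sigma> x < \<sigma> y then z x - t * z y else t * z x - z y)"
      unfolding P_def prod.distrib[symmetric]
    proof (rule prod.cong)
      fix p assume p: "p \<in> ?R"
      obtain x y where xy: "p = (x, y)" by (cases p)
      have "wt x y * (z x - t * z y) = t * z x - z y"
        unfolding den wt_def using prec_nz(2)[OF R[of x y]] p xy
        by (simp add: r_eq field_simps)
      then show "(case p of (x, y) \<Rightarrow> if \<sigma> x < \<sigma> y then 1 else wt x y) * (case p of (x, y) \<Rightarrow> z x - t * z y) =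
        (case p of (x, y) \<Rightarrow> if \<sigma> x < \<sigma> y then z x - t * z y else t * z x - z y)"
        by (simp add: xy)
    qed simp
  qed simp
  also have "\<dots> = t_fact (N + k) * (\<Prod>(x, y)\<in>?R. z x - z y)"
    unfolding HL card_trunc t_fact_def ..
  also have "(\<Prod>(x, y)\<in>?R. z x - z y) = (\<Prod>(x, y)\<in>?R. ratio x y) * P"
    unfolding P_def prod.distrib[symmetric]
  proof (rule prod.cong)
    fix p assume p: "p \<in> ?R"
    obtain x y where xy: "p = (x, y)" by (cases p)
    have "ratio x y * (z x - t * z y) = z x - z y"
      unfolding den ratio_def using prec_nz(2)[OF R[of x y]] p xy
      by (simp add: r_eq field_simps)
    then show "(case p of (x, y) \<Rightarrow> z x - z y) =
      (case p of (x, y) \<Rightarrow> ratio x y) * (case p of (x, y) \<Rightarrow> z x - t * z y)"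
      by (simp add: xy)
  qed simp
  finally show ?thesis using P by (simp add: mult.assoc[symmetric])
qed

lemma wt_adjacent: "T (a, b) = T (Suc a, b) \<Longrightarrow> wt (a, b) (Suc a, b) = 0"
  by (simp add: wt_def r_def box_content_def)

(* Adjacent boxes of a row block have wt = 0, so labellings with a descent in a block do not contribute. *)
lemma prod_wt_not_row_increasing:
  assumes \<sigma>: "\<sigma> \<in> bij_labs (trunc k)" and nri: "\<not> row_increasing (trunc k) T \<sigma>"
  shows "(\<Prod>(x, y)\<in>rel_pairs (prec T) (trunc k). if \<sigma> x < \<sigma> y then 1 else wt x y) = 0"
proof -
  obtain x y where xy: "x \<in> trunc k" "y \<in> trunc k" "snd x = snd y" "T x = T y" "fst x < fst y"
    and desc: "\<not> \<sigma> x < \<sigma> y"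
    using nri unfolding row_increasing_def by blast
  define a a' b where "a = fst x" and "a' = fst y" and "b = snd x"
  have x: "x = (a, b)" and y: "y = (a', b)" by (simp_all add: a_def a'_def b_def prod_eq_iff xy(3))
  interpret F: finite_strict_filling "trunc k" T by (rule finite_strict_filling_trunc) simp
  have between: "(c, b) \<in> trunc k \<and> T (c, b) = T x" if c: "a \<le> c" "c \<le> a'" for c
  proof -
    have mem: "(c, b) \<in> trunc k"
      using F.lower[of a' b c b] xy(1,2) c F.pos[of x] unfolding x y by simp
    then have "T y \<le> T (c, b)" "T (c, b) \<le> T x"
      using F.row_le[of "(c, b)" y] F.row_le[of x "(c, b)"] xy(1,2) c unfolding x y by auto
    then show ?thesis using mem xy(4) by simp
  qed
  \<comment> \<open>If the labels rose at every step from \<open>x\<close> to \<open>y\<close>, they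
    would rise from \<open>x\<close> to \<open>y\<close>. So the condition already fails between
    neighbours, where \<open>wt_adjacent\<close> applies.\<close>
  have "\<exists>c. a \<le> c \<and> c < a' \<and> \<not> \<sigma> (c, b) < \<sigma> (Suc c, b)"
  proof (rule ccontr)
    assume "\<nexists>c. a \<le> c \<and> c < a' \<and> \<not> \<sigma> (c, b) < \<sigma> (Suc c, b)"
    then have up: "\<sigma> (c, b) < \<sigma> (Suc c, b)" if "a \<le> c" "c < a'" for c using that by blast
    have "\<sigma> (a, b) < \<sigma> (Suc c, b)" if "a \<le> c" "c < a'" for c
      using that
    proof (induction c rule: dec_induct)
      case base
      then show ?case using up by simp
    next
      case (step n)
      then show ?case using up[of "Suc n"] by simp
    qed
    from this[of "a' - 1"] have "\<sigma> (a, b) < \<sigma> (a', b)" using xy(5) by (simp add: x y)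
    then show False using desc by (simp add: x y)
  qed
  then obtain c where c: "a \<le> c" "c < a'" "\<not> \<sigma> (c, b) < \<sigma> (Suc c, b)" by blast
  have B: "(c, b) \<in> trunc k \<and> T (c, b) = T x" "(Suc c, b) \<in> trunc k \<and> T (Suc c, b) = T x"
    using between[of c] between[of "Suc c"] c by simp_all
  show ?thesis
  proof (rule prod_zero)
    show "\<exists>p\<in>rel_pairs (prec T) (trunc k). (case p of (x, y) \<Rightarrow> if \<sigma> x < \<sigma> y then 1 else wt x y) = 0"
      using B c(3) wt_adjacent[of c b]
      by (intro bexI[of _ "((c, b), (Suc c, b))"]) (auto simp: rel_pairs_def prec_def col_precedes_def)
  qed (rule finite_rel_pairs[OF finite_trunc])
qed

definition inv_pairs :: "nat \<Rightarrow> (box \<Rightarrow> nat) \<Rightarrow> (box \<times> box) set" where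
  "inv_pairs k \<sigma> = {(x, y). x \<in> trunc k \<and> y \<in> trunc k \<and> prec T x y \<and> \<sigma> y < \<sigma> x}"

lemma finite_inv_pairs: "finite (inv_pairs k \<sigma>)"
  by (rule finite_subset[of _ "trunc k \<times> trunc k"]) (auto simp: inv_pairs_def finite_trunc)

lemma sum_row_increasing_trunc:
  "(\<Sum>\<sigma>\<in>{\<sigma> \<in> bij_labs (trunc k). row_increasing (trunc k) T \<sigma>}. \<Prod>(x, y)\<in>inv_pairs k \<sigma>. wt x y) =
   t_fact (N + k) * (\<Prod>(x, y)\<in>rel_pairs (prec T) (trunc k). ratio x y)"
proof -
  let ?R = "rel_pairs (prec T) (trunc k)"
  let ?f = "\<lambda>\<sigma>. \<Prod>(x, y)\<in>?R. if \<sigma> x < \<sigma> y then 1 else wt x y"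
  have "(\<Prod>(x, y)\<in>inv_pairs k \<sigma>. wt x y) = ?f \<sigma>" if \<sigma>: "\<sigma> \<in> bij_labs (trunc k)" for \<sigma>
  proof (rule prod.mono_neutral_cong_left)
    show "inv_pairs k \<sigma> \<subseteq> ?R" by (auto simp: inv_pairs_def rel_pairs_def)
    show "\<forall>p\<in>?R - inv_pairs k \<sigma>. (case p of (x, y) \<Rightarrow> if \<sigma> x < \<sigma> y then 1 else wt x y) = 1"
    proof
      fix p assume p: "p \<in> ?R - inv_pairs k \<sigma>"
      obtain x y where xy: "p = (x, y)" by (cases p)
      have "x \<in> trunc k" "y \<in> trunc k" "prec T x y" "\<not> \<sigma> y < \<sigma> x"
        using p xy by (auto simp: inv_pairs_def rel_pairs_def)
      moreover from this have "x \<noteq> y" using prec_irrefl by blast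
      ultimately have "\<sigma> x < \<sigma> y"
        using \<sigma> unfolding bij_labs_def bij_betw_def inj_on_def by (metis (mono_tags, lifting) linorder_neqE_nat mem_Collect_eq)
      then show "(case p of (x, y) \<Rightarrow> if \<sigma> x < \<sigma> y then 1 else wt x y) = 1" by (simp add: xy)
    qed
  qed (auto simp: finite_rel_pairs finite_trunc inv_pairs_def)
  then have "(\<Sum>\<sigma>\<in>{\<sigma> \<in> bij_labs (trunc k). row_increasing (trunc k) T \<sigma>}. \<Prod>(x, y)\<in>inv_pairs k \<sigma>. wt x y) =
      (\<Sum>\<sigma>\<in>{\<sigma> \<in> bij_labs (trunc k). row_increasing (trunc k) T \<sigma>}. ?f \<sigma>)"
    by (intro sum.cong) auto
  also have "\<dots> = (\<Sum>\<sigma>\<in>bij_labs (trunc k). ?f \<sigma>)"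
    using prod_wt_not_row_increasing finite_bij_labs[OF finite_trunc]
    by (intro sum.mono_neutral_left) auto
  finally show ?thesis unfolding sum_bij_labs_trunc .
qed

section \<open>Passing between a truncation and the infinite diagram\<close>

text \<open>Outside \<open>trunc k\<close> the labels exceed N + k and increase in reading order, so
  no inversion involves a box there.\<close>

lemma Inv_restricted:
  assumes \<tau>: "\<tau> \<in> restricted_labs k"
  shows "Inv D \<tau> = inv_pairs k (fst \<circ> \<tau>)"
proof -
  have A: "\<tau> \<in> APSYT_of lam T" using \<tau> by (simp add: restricted_labs_def)
  have "x \<in> trunc k \<and> y \<in> trunc k"
    if xy: "x \<in> D" "y \<in> D" "prec T x y" "fst (\<tau> y) < fst (\<tau> x)" for x y
  proof -
    have out: "N + k < fst (\<tau> (a, 1))" if "M + k < a" for a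
      using APSYT_tail[OF \<tau> that] that by (simp add: N_eq)
    have inn: "fst (\<tau> u) \<le> N + k" if "u \<in> trunc k" for u
      using APSYT_image_trunc[OF \<tau>] that by auto
    have x: "x \<in> trunc k"
    proof (rule ccontr)
      assume "x \<notin> trunc k"
      then obtain a where a: "x = (a, 1)" "M + k < a" using mem_D_cases xy(1) by blast
      show False
      proof (cases "y \<in> core")
        case True
        then show ?thesis using core_prec_tail[OF True, of a] prec_asym[OF xy(3)] a by simp
      next
        case False
        then obtain c where c: "y = (c, 1)" "M < c"
          using mem_D_cases[OF xy(2), of 0] by (auto simp: core_trunc)
        then have "a < c" using xy(3) prec_tail_tail[of a c] a by simp
        then show ?thesis using APSYT_tail[OF \<tau>, of a] APSYT_tail[OF \<tau>, of c] a c xy(4) by simp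
      qed
    qed
    moreover have "y \<in> trunc k"
    proof (rule ccontr)
      assume "y \<notin> trunc k"
      then obtain a where "y = (a, 1)" "M + k < a" using mem_D_cases xy(2) by blast
      then show False using out[of a] inn[OF x] xy(4) by simp
    qed
    ultimately show ?thesis ..
  qed
  then show ?thesis
    unfolding Inv_eq[OF A] inv_pairs_def o_apply using trunc_subset by blast
qed

text \<open>The continuation beyond \<open>trunc k\<close> that \<open>APSYT_tail\<close>
  forces.\<close>

definition extend_lab :: "nat \<Rightarrow> (box \<Rightarrow> nat) \<Rightarrow> box \<Rightarrow> label" where
  "extend_lab k \<sigma> = (\<lambda>x\<in>D. (if x \<in> trunc k then \<sigma> x else fst x + sum_list lam, T x))"

lemma restrict_restricted_labs:
  assumes \<tau>: "\<tau> \<in> restricted_labs k"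
  shows "restrict (fst \<circ> \<tau>) (trunc k) \<in> {\<sigma> \<in> bij_labs (trunc k). row_increasing (trunc k) T \<sigma>}"
    and "extend_lab k (restrict (fst \<circ> \<tau>) (trunc k)) = \<tau>"
proof -
  have P: "\<tau> \<in> extensional D" "\<And>x. x \<in> D \<Longrightarrow> snd (\<tau> x) = T x" "bij_betw (fst \<circ> \<tau>) D {1..}"
    "row_increasing D T (fst \<circ> \<tau>)"
    using \<tau> by (auto simp: restricted_labs_def APSYT_of_iff)
  have "bij_betw (fst \<circ> \<tau>) (trunc k) {1..card (trunc k)}"
    unfolding card_trunc using P(3) trunc_subset APSYT_image_trunc[OF \<tau>] by (rule bij_betw_subset)
  then have "bij_betw (restrict (fst \<circ> \<tau>) (trunc k)) (trunc k) {1..card (trunc k)}"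
    by (rule bij_betw_cong[THEN iffD1, rotated]) simp
  moreover have "row_increasing (trunc k) T (restrict (fst \<circ> \<tau>) (trunc k))"
    unfolding row_increasing_def
  proof (intro ballI impI)
    fix x y assume "x \<in> trunc k" "y \<in> trunc k" "snd x = snd y \<and> T x = T y \<and> fst x < fst y"
    moreover from this have "(fst \<circ> \<tau>) x < (fst \<circ> \<tau>) y"
      using P(4) trunc_subset unfolding row_increasing_def by blast
    ultimately show "restrict (fst \<circ> \<tau>) (trunc k) x < restrict (fst \<circ> \<tau>) (trunc k) y" by simp
  qed
  ultimately show "restrict (fst \<circ> \<tau>) (trunc k) \<in> {\<sigma> \<in> bij_labs (trunc k). row_increasing (trunc k) T \<sigma>}"
    by (simp add: bij_labs_def)
  show "extend_lab k (restrict (fst \<circ> \<tau>) (trunc k)) = \<tau>"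
  proof
    fix x
    consider "x \<notin> D" | "x \<in> trunc k" | a where "x = (a, 1)" "M + k < a" "x \<notin> trunc k" "x \<in> D"
      using mem_D_cases by blast
    then show "extend_lab k (restrict (fst \<circ> \<tau>) (trunc k)) x = \<tau> x"
    proof cases
      case 1
      then show ?thesis using extensional_arb[OF P(1)] by (simp add: extend_lab_def)
    next
      case 2
      then show ?thesis using P(2)[of x] trunc_subset by (auto simp: extend_lab_def prod_eq_iff)
    next
      case 3
      have "fst (\<tau> x) = fst x + sum_list lam" using APSYT_tail[OF \<tau> 3(2)] 3(1) by simp
      then show ?thesis using P(2)[OF 3(4)] 3(3,4) by (simp add: extend_lab_def prod_eq_iff)
    qed
  qed
qed

lemma extend_lab_restricted:
  assumes \<sigma>: "\<sigma> \<in> bij_labs (trunc k)" and inc: "row_increasing (trunc k) T \<sigma>"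
  shows "extend_lab k \<sigma> \<in> restricted_labs k"
    and "restrict (fst \<circ> extend_lab k \<sigma>) (trunc k) = \<sigma>"
proof -
  let ?\<tau> = "extend_lab k \<sigma>"
  have bij\<sigma>: "bij_betw \<sigma> (trunc k) {1..N + k}" and ext: "\<sigma> \<in> extensional (trunc k)"
    using \<sigma> by (auto simp: bij_labs_def card_trunc)
  have inn: "fst (?\<tau> x) = \<sigma> x" if "x \<in> trunc k" for x
    using that trunc_subset by (auto simp: extend_lab_def)
  have out: "fst (?\<tau> x) = fst x + sum_list lam" if "x \<in> D" "x \<notin> trunc k" for x
    using that by (auto simp: extend_lab_def)
  have le: "\<sigma> x \<le> N + k" if "x \<in> trunc k" for x using bij_betwE[OF bij\<sigma>] that by auto
  have b1: "bij_betw (fst \<circ> ?\<tau>) (trunc k) {1..N + k}"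
    using bij\<sigma> by (rule bij_betw_cong[THEN iffD1, rotated]) (simp add: inn)
  have b2: "bij_betw (fst \<circ> ?\<tau>) (D - trunc k) {N + k<..}"
  proof (rule bij_betw_byWitness[where f' = "\<lambda>i. (i - sum_list lam, 1)"])
    show "\<forall>x\<in>D - trunc k. ((fst \<circ> ?\<tau>) x - sum_list lam, 1) = x"
    proof
      fix x assume "x \<in> D - trunc k"
      then show "((fst \<circ> ?\<tau>) x - sum_list lam, 1) = x"
        using out[of x] mem_D_cases[of x k] by auto
    qed
    have mem: "(i - sum_list lam, 1) \<in> D - trunc k" if "i > N + k" for i
    proof -
      have "1 \<le> i - sum_list lam" "\<not> i - sum_list lam \<le> M + k" using that N_eq by linarith+
      then show ?thesis using tail_mem_D[of "i - sum_list lam"] by (simp add: mem_trunc)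
    qed
    show "\<forall>i\<in>{N + k<..}. (fst \<circ> ?\<tau>) (i - sum_list lam, 1) = i"
    proof
      fix i assume "i \<in> {N + k<..}"
      then have i: "i > N + k" by simp
      show "(fst \<circ> ?\<tau>) (i - sum_list lam, 1) = i"
        using out[of "(i - sum_list lam, 1)"] mem[OF i] i by (simp add: N_eq)
    qed
    show "(fst \<circ> ?\<tau>) ` (D - trunc k) \<subseteq> {N + k<..}"
    proof (rule image_subsetI)
      fix x assume x: "x \<in> D - trunc k"
      then obtain a where "x = (a, 1)" "M + k < a" using mem_D_cases[of x k] by auto
      then show "(fst \<circ> ?\<tau>) x \<in> {N + k<..}" using out[of x] x by (simp add: N_eq)
    qed
    show "(\<lambda>i. (i - sum_list lam, 1)) ` {N + k<..} \<subseteq> D - trunc k" using mem by blast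
  qed
  have bij: "bij_betw (fst \<circ> ?\<tau>) D {1..}"
  proof -
    have "bij_betw (fst \<circ> ?\<tau>) (trunc k \<union> (D - trunc k)) ({1..N + k} \<union> {N + k<..})"
      using b1 b2 by (rule bij_betw_combine) auto
    moreover have "trunc k \<union> (D - trunc k) = D" using trunc_subset by blast
    moreover have "{1..N + k} \<union> {N + k<..} = {1..}" if "0 < N + k" using that by auto
    moreover have "{1..N + k} \<union> {N + k<..} = {1..}" if "N + k = 0" using that by auto
    ultimately show ?thesis by (cases "N + k = 0") auto
  qed
  have "row_increasing D T (fst \<circ> ?\<tau>)"
    unfolding row_increasing_def
  proof (intro ballI impI)
    fix x y assume xy: "x \<in> D" "y \<in> D" and s: "snd x = snd y \<and> T x = T y \<and> fst x < fst y"
    show "(fst \<circ> ?\<tau>) x < (fst \<circ> ?\<tau>) y"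
    proof (cases "y \<in> trunc k")
      case True
      interpret F: finite_strict_filling "trunc k" T by (rule finite_strict_filling_trunc) simp
      have "(fst x, snd x) \<in> trunc k"
        using F.lower[of "fst y" "snd y" "fst x" "snd x"] True s pos[OF xy(1)] by simp
      then have "x \<in> trunc k" by simp
      then show ?thesis using inc s True unfolding row_increasing_def o_apply by (simp add: inn)
    next
      case False
      then obtain a where a: "y = (a, 1)" "M + k < a" using mem_D_cases[of y k] xy by auto
      then have y: "fst (?\<tau> y) = a + sum_list lam" using out[OF xy(2) False] by simp
      show ?thesis
      proof (cases "x \<in> trunc k")
        case True
        then show ?thesis using le[OF True] y a by (simp add: inn N_eq)
      next
        case x: False
        then show ?thesis using out[OF xy(1) x] y a s by simp
      qed
    qed
  qed
  then have "?\<tau> \<in> APSYT_of lam T"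
    using bij by (simp add: APSYT_of_iff) (simp add: extend_lab_def)
  moreover have "core \<subseteq> trunc k" by (simp add: trunc_eq)
  ultimately show "?\<tau> \<in> restricted_labs k"
    using le inn by (auto simp: restricted_labs_def)
  show "restrict (fst \<circ> ?\<tau>) (trunc k) = \<sigma>"
    using ext inn by (auto simp: fun_eq_iff restrict_def extensional_def)
qed

lemma finite_restricted_labs: "finite (restricted_labs k)"
proof (rule finite_subset)
  show "restricted_labs k \<subseteq> extend_lab k ` bij_labs (trunc k)"
    using restrict_restricted_labs by (metis (no_types, lifting) image_eqI mem_Collect_eq subsetI)
  show "finite (extend_lab k ` bij_labs (trunc k))"
    using finite_bij_labs[OF finite_trunc] by blast
qed

lemma sum_restricted_labs:
  "(\<Sum>\<tau>\<in>restricted_labs k. \<Prod>(x, y)\<in>Inv D \<tau>. wt x y) =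
   t_fact (N + k) * (\<Prod>(x, y)\<in>rel_pairs (prec T) (trunc k). ratio x y)"
  unfolding sum_row_increasing_trunc[symmetric]
proof (rule sum.reindex_bij_witness[where i = "extend_lab k" and j = "\<lambda>\<tau>. restrict (fst \<circ> \<tau>) (trunc k)"])
  fix \<tau> assume \<tau>: "\<tau> \<in> restricted_labs k"
  show "extend_lab k (restrict (fst \<circ> \<tau>) (trunc k)) = \<tau>"
    and "restrict (fst \<circ> \<tau>) (trunc k) \<in> {\<sigma> \<in> bij_labs (trunc k). row_increasing (trunc k) T \<sigma>}"
    using restrict_restricted_labs[OF \<tau>] by blast+
  have "inv_pairs k (restrict (fst \<circ> \<tau>) (trunc k)) = inv_pairs k (fst \<circ> \<tau>)"
    by (auto simp: inv_pairs_def)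
  then show "(\<Prod>(x, y)\<in>inv_pairs k (restrict (fst \<circ> \<tau>) (trunc k)). wt x y) = (\<Prod>(x, y)\<in>Inv D \<tau>. wt x y)"
    unfolding Inv_restricted[OF \<tau>] by simp
next
  fix \<sigma> assume "\<sigma> \<in> {\<sigma> \<in> bij_labs (trunc k). row_increasing (trunc k) T \<sigma>}"
  then show "restrict (fst \<circ> extend_lab k \<sigma>) (trunc k) = \<sigma>" "extend_lab k \<sigma> \<in> restricted_labs k"
    using extend_lab_restricted by blast+
qed

end

subsection \<open>Convergence\<close>

context stable_filling
begin

section \<open>Telescoping of the product over pairs\<close>

text \<open>In a row block the powers of q cancel and contents differ like columns, so r is t^(j -
  i) and \<open>prod_interval_pairs\<close> applies.\<close>

lemma row_block_ratio:
  assumes T: "\<And>i. i \<in> {a..<a + m} \<Longrightarrow> T (i, b) = v"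
  shows "(\<Prod>(x, y)\<in>rel_pairs (prec T) ((\<lambda>i. (i, b)) ` {a..<a + m}). ratio x y) = 1 / t_fact m"
  unfolding prod_interval_pairs[of a m, symmetric]
proof (rule prod.reindex_bij_witness[where i = "\<lambda>(i, j). ((i, b), (j, b))" and j = "\<lambda>(x, y). (fst x, fst y)"])
  fix p assume "p \<in> rel_pairs (prec T) ((\<lambda>i. (i, b)) ` {a..<a + m})"
  then obtain i j where p: "p = ((i, b), (j, b))" and i: "i \<in> {a..<a + m}" and j: "j \<in> {a..<a + m}"
    and pr: "prec T (i, b) (j, b)"
    by (auto simp: rel_pairs_def)
  have less: "i < j" using pr T[OF i] T[OF j] by (simp add: prec_def col_precedes_def)
  show "(case case p of (x, y) \<Rightarrow> (fst x, fst y) of (i, j) \<Rightarrow> ((i, b), (j, b))) = p"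
    by (simp add: p)
  show "(case p of (x, y) \<Rightarrow> (fst x, fst y)) \<in> rel_pairs (<) {a..<a + m}"
    using i j less by (simp add: p rel_pairs_def)
  have r: "r (i, b) (j, b) = t ^ (j - i)"
  proof -
    have c: "box_content (j, b) - box_content (i, b) = int (j - i)"
      using less by (simp add: box_content_def)
    show ?thesis
      unfolding r_def c T[OF i] T[OF j]
      by (simp only: diff_self power_int_0_right mult_1_left power_int_of_nat)
  qed
  show "(case case p of (x, y) \<Rightarrow> (fst x, fst y) of (i, j) \<Rightarrow> (1 - t ^ (j - i)) / (1 - t ^ Suc (j - i))) =
      (case p of (x, y) \<Rightarrow> ratio x y)"
    by (simp add: p ratio_def r)
next
  fix p assume "p \<in> rel_pairs (<) {a..<a + m}"
  then obtain i j where p: "p = (i, j)" and i: "i \<in> {a..<a + m}" and j: "j \<in> {a..<a + m}" and less: "i < j"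
    by (auto simp: rel_pairs_def)
  show "(case case p of (i, j) \<Rightarrow> ((i, b), (j, b)) of (x, y) \<Rightarrow> (fst x, fst y)) = p"
    by (simp add: p)
  show "(case p of (i, j) \<Rightarrow> ((i, b), (j, b))) \<in> rel_pairs (prec T) ((\<lambda>i. (i, b)) ` {a..<a + m})"
    using i j less T[OF i] T[OF j] by (simp add: p rel_pairs_def prec_def col_precedes_def)
qed

text \<open>\<open>T\<close> is monotone along a row, so equal values occupy consecutive
  columns.\<close>

lemma core_block_interval:
  assumes "x \<in> core"
  shows "\<exists>a. {y \<in> core. T y = T x \<and> snd y = snd x} =
     (\<lambda>i. (i, snd x)) ` {a..<a + card {y \<in> core. T y = T x \<and> snd y = snd x}}"
proof -
  interpret F: finite_strict_filling core T
    unfolding core_trunc by (rule finite_strict_filling_trunc) simp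
  define S where "S = {i. (i, snd x) \<in> core \<and> T (i, snd x) = T x}"
  have B: "{y \<in> core. T y = T x \<and> snd y = snd x} = (\<lambda>i. (i, snd x)) ` S"
  proof (intro equalityI subsetI)
    fix y assume y: "y \<in> {y \<in> core. T y = T x \<and> snd y = snd x}"
    then have "y = (fst y, snd x)" by (simp add: prod_eq_iff)
    then show "y \<in> (\<lambda>i. (i, snd x)) ` S" using y unfolding S_def
      by (intro image_eqI[of _ _ "fst y"]) auto
  qed (auto simp: S_def)
  have inj: "inj_on (\<lambda>i. (i, snd x)) S" by (simp add: inj_on_def)
  have "finite ((\<lambda>i. (i, snd x)) ` S)"
    unfolding B[symmetric] using F.finite_D by simp
  then have fin: "finite S" using finite_image_iff[OF inj] by simp
  have "fst x \<in> S" using assms by (simp add: S_def)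
  then have ne: "S \<noteq> {}" by blast
  have "j \<in> S" if ik: "i \<in> S" "l \<in> S" "i \<le> j" "j \<le> l" for i j l
  proof -
    have mem: "(i, snd x) \<in> core" "(l, snd x) \<in> core" "T (i, snd x) = T x" "T (l, snd x) = T x"
      using ik by (simp_all add: S_def)
    then have j: "(j, snd x) \<in> core"
      using F.lower[OF mem(2), of j "snd x"] F.pos[OF mem(1)] F.pos[OF mem(2)] ik by simp
    then have "T (j, snd x) = T x"
      using F.row_le[OF mem(1) j] F.row_le[OF j mem(2)] mem ik by simp
    then show ?thesis using j by (simp add: S_def)
  qed
  then obtain a where a: "S = {a..<a + card S}" using convex_nat_eq_interval[OF fin ne] by blast
  have "card {y \<in> core. T y = T x \<and> snd y = snd x} = card S"
    unfolding B by (rule card_image[OF inj])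
  then show ?thesis using a B by metis
qed

text \<open>The pairs outside \<open>I_set\<close> form \<open>J\<close>, which splits into the
  pairs inside the single row blocks. Each block of size m contributes the inverse of
  \<open>t_fact m\<close>, and the block sizes are the parts of \<open>mu\<close>.\<close>

lemma core_ratio:
  "(\<Prod>(x, y)\<in>rel_pairs (prec T) core. ratio x y) =
   (\<Prod>(x, y)\<in>I_set core (restrict T core). ratio x y) / t_fact_comp (mu core (restrict T core))"
proof -
  let ?T = "restrict T core"
  interpret F: finite_strict_filling core ?T
    using finite_strict_filling_trunc[of 0 ?T] by (simp add: core_trunc)
  have precT: "prec ?T x y \<longleftrightarrow> prec T x y" if "x \<in> core" "y \<in> core" for x y
    using that by (simp add: prec_def)
  define J where "J = {(x, y). x \<in> core \<and> y \<in> core \<and> prec T x y \<and> T x = T y \<and> snd x = snd y}"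
  have I: "I_set core ?T = {(x, y). x \<in> core \<and> y \<in> core \<and> prec T x y \<and> \<not> (T x = T y \<and> snd x = snd y)}"
    unfolding F.I_set_eq using precT by auto
  have split: "rel_pairs (prec T) core = I_set core ?T \<union> J"
    unfolding I J_def rel_pairs_def by blast
  have disj: "I_set core ?T \<inter> J = {}" unfolding I J_def by blast
  have fin: "finite (I_set core ?T)" "finite J"
    using finite_rel_pairs[OF F.finite_D, of "prec T"] unfolding split by simp_all
  define block where "block k = {x \<in> core. F.block_key x = k}" for k
  have key: "F.block_key x = F.block_key y \<longleftrightarrow> T x = T y \<and> snd x = snd y"
    if "x \<in> core" "y \<in> core" for x y
    using F.block_key_less_iff(2)[OF that] that by simp
  have J: "J = (\<Union>k\<in>F.block_key ` core. rel_pairs (prec T) (block k))"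
  proof (intro equalityI subrelI)
    fix x y assume xy: "(x, y) \<in> J"
    then have "F.block_key y = F.block_key x" using key[of y x] by (simp add: J_def)
    then have "(x, y) \<in> rel_pairs (prec T) (block (F.block_key x))"
      using xy by (simp add: J_def rel_pairs_def block_def)
    then show "(x, y) \<in> (\<Union>k\<in>F.block_key ` core. rel_pairs (prec T) (block k))"
      using xy by (auto simp: J_def)
  next
    fix x y assume "(x, y) \<in> (\<Union>k\<in>F.block_key ` core. rel_pairs (prec T) (block k))"
    then have "x \<in> core" "y \<in> core" "prec T x y" "F.block_key x = F.block_key y"
      by (auto simp: rel_pairs_def block_def)
    then show "(x, y) \<in> J" using key[of x y] by (simp add: J_def)
  qed
  have "(\<Prod>(x, y)\<in>J. ratio x y) =
      (\<Prod>k\<in>F.block_key ` core. \<Prod>(x, y)\<in>rel_pairs (prec T) (block k). ratio x y)"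
    unfolding J
  proof (rule prod.UNION_disjoint)
    show "\<forall>k\<in>F.block_key ` core. finite (rel_pairs (prec T) (block k))"
      using F.finite_D by (intro ballI finite_rel_pairs) (simp add: block_def)
    show "\<forall>k\<in>F.block_key ` core. \<forall>l\<in>F.block_key ` core. k \<noteq> l \<longrightarrow>
        rel_pairs (prec T) (block k) \<inter> rel_pairs (prec T) (block l) = {}"
      unfolding rel_pairs_def block_def by blast
  qed (use F.finite_D in simp)
  also have "\<dots> = (\<Prod>k\<in>F.block_key ` core. 1 / t_fact (card (block k)))"
  proof (rule prod.cong)
    fix k assume "k \<in> F.block_key ` core"
    then obtain x where x: "x \<in> core" "k = F.block_key x" by blast
    have bl: "block k = {y \<in> core. T y = T x \<and> snd y = snd x}"
      unfolding block_def x(2) using key x(1) by blast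
    obtain a where a: "block k = (\<lambda>i. (i, snd x)) ` {a..<a + card (block k)}"
      using core_block_interval[OF x(1)] unfolding bl by blast
    have Tx: "T (i, snd x) = T x" if "i \<in> {a..<a + card (block k)}" for i
    proof -
      have "(i, snd x) \<in> block k" by (subst a) (use that in blast)
      then show ?thesis unfolding bl by simp
    qed
    have "(\<Prod>(x, y)\<in>rel_pairs (prec T) ((\<lambda>i. (i, snd x)) ` {a..<a + card (block k)}). ratio x y) =
        1 / t_fact (card (block k))"
      by (rule row_block_ratio[OF Tx])
    then show "(\<Prod>(x, y)\<in>rel_pairs (prec T) (block k). ratio x y) = 1 / t_fact (card (block k))"
      unfolding a[symmetric] .
  qed simp
  also have "\<dots> = 1 / t_fact_comp (mu core ?T)"
    unfolding F.t_fact_comp_mu block_def by (simp add: prod_dividef)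
  finally show ?thesis
    unfolding split prod.union_disjoint[OF fin disj] by simp
qed

text \<open>At k = 0 the factor of a box in the numerator of the theorem; in general the same factor
  with N + k for N.\<close>

definition numer :: "nat \<Rightarrow> box \<Rightarrow> Qqt" where
  "numer k x = 1 - q powi (- int (T x)) * t powi (int M + int k - box_content x)"

lemma numer_vge:
  assumes "x \<in> core"
  shows "fls_vge (int k + 1) (numer k x - 1)"
proof -
  have "fls_vge (int k + 1) (q powi (- int (T x)) * t powi (int M + int k - box_content x))"
    using core_content_less[OF assms] by (intro fls_vge_q_powi_t_powi) simp
  then show ?thesis by (simp add: numer_def fls_vge_uminus)
qed

lemma numer_nz:
  assumes "x \<in> core"
  shows "numer k x \<noteq> 0"
  using fls_subdegree_eq_0_if_vge(1) fls_vge_mono[OF numer_vge[OF assms, of k], of 1] by auto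

text \<open>For the i-th tail box, counted from 0, the numerator 1 - r is \<open>numer i x\<close>,
  and 1 - t r is the same expression one step further.\<close>

lemma ratio_core_tail:
  assumes "x \<in> core"
  shows "(\<Prod>y\<in>tail k. ratio x y) = numer 0 x / numer k x"
proof -
  have "(\<Prod>y\<in>tail k. ratio x y) = (\<Prod>i<k. numer i x / numer (Suc i) x)"
  proof (rule prod.reindex_bij_witness[where i = "\<lambda>i. (Suc M + i, 1)" and j = "\<lambda>y. fst y - Suc M"])
    fix y assume "y \<in> tail k"
    then obtain a where a: "y = (a, 1)" "M < a" "a \<le> M + k" by (auto simp: mem_tail)
    define i where "i = a - Suc M"
    have i: "a = Suc M + i" using a by (simp add: i_def)
    \<comment> \<open>The column is \<open>Suc M + i\<close> and the row is 1, so the content is M +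
      i.\<close>
    have c: "box_content y = int M + int i" by (simp add: a i box_content_def)
    have T: "T y = 0" using T_tail a by simp
    have r: "r x y = q powi (- int (T x)) * t powi (int M + int i - box_content x)"
      by (simp add: r_def T c)
    have tr: "t * r x y = q powi (- int (T x)) * t powi (int M + int (Suc i) - box_content x)"
      unfolding t_times_r T c by (simp add: algebra_simps)
    show "numer (fst y - Suc M) x / numer (Suc (fst y - Suc M)) x = ratio x y"
      unfolding ratio_def tr unfolding r by (simp add: numer_def a i)
    show "(Suc M + (fst y - Suc M), 1) = y" "fst y - Suc M \<in> {..<k}" using a by auto
  next
    fix i assume "i \<in> {..<k}"
    then show "fst (Suc M + i, 1::nat) - Suc M = i" "(Suc M + i, 1) \<in> tail k" by (auto simp: mem_tail)
  qed
  also have "\<dots> = numer 0 x / numer k x"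
    using numer_nz[OF assms] by (intro prod_lessThan_telescope')
  finally show ?thesis .
qed

lemma tail_ratio: "(\<Prod>(x, y)\<in>rel_pairs (prec T) (tail k). ratio x y) = 1 / t_fact k"
  unfolding tail_def by (rule row_block_ratio[of _ _ _ 0]) (simp add: T_tail flip: One_nat_def)

text \<open>The reading order puts the core before the tail, so the mixed pairs are all of
  \<open>core \<times> tail k\<close>.\<close>

lemma trunc_ratio:
  "(\<Prod>(x, y)\<in>rel_pairs (prec T) (trunc k). ratio x y) =
   (\<Prod>(x, y)\<in>rel_pairs (prec T) core. ratio x y) * (\<Prod>x\<in>core. numer 0 x / numer k x) * (1 / t_fact k)"
proof -
  let ?R = "rel_pairs (prec T)"
  have split: "?R (trunc k) = (?R core \<union> core \<times> tail k) \<union> ?R (tail k)"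
  proof (intro equalityI subrelI)
    fix x y assume "(x, y) \<in> ?R (trunc k)"
    then have xy: "x \<in> core \<union> tail k" "y \<in> core \<union> tail k" "prec T x y"
      by (auto simp: rel_pairs_def trunc_eq)
    have "\<not> (x \<in> tail k \<and> y \<in> core)"
    proof
      assume "x \<in> tail k \<and> y \<in> core"
      then obtain a where "x = (a, 1)" "M < a" "y \<in> core" unfolding mem_tail by blast
      then show False using core_prec_tail[of y a] prec_asym[OF xy(3)] by simp
    qed
    then show "(x, y) \<in> (?R core \<union> core \<times> tail k) \<union> ?R (tail k)"
      using xy by (auto simp: rel_pairs_def)
  next
    fix x y assume "(x, y) \<in> (?R core \<union> core \<times> tail k) \<union> ?R (tail k)"
    then show "(x, y) \<in> ?R (trunc k)"
      using core_prec_tail[of x "fst y"] by (auto simp: rel_pairs_def trunc_eq mem_tail)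
  qed
  have fin: "finite core" "finite (tail k)" using finite_trunc[of k] by (simp_all add: trunc_eq)
  have finR: "finite (?R core)" "finite (?R (tail k))" using fin by (simp_all add: finite_rel_pairs)
  have disj: "(?R core \<union> core \<times> tail k) \<inter> ?R (tail k) = {}" "?R core \<inter> core \<times> tail k = {}"
    using core_tail_disjoint[of k] unfolding rel_pairs_def by blast+
  have "(\<Prod>(x, y)\<in>?R (trunc k). ratio x y) =
      (\<Prod>(x, y)\<in>?R core \<union> core \<times> tail k. ratio x y) * (\<Prod>(x, y)\<in>?R (tail k). ratio x y)"
    unfolding split using fin finR disj by (intro prod.union_disjoint) simp_all
  also have "(\<Prod>(x, y)\<in>?R core \<union> core \<times> tail k. ratio x y) =
      (\<Prod>(x, y)\<in>?R core. ratio x y) * (\<Prod>(x, y)\<in>core \<times> tail k. ratio x y)"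
    using fin finR disj by (intro prod.union_disjoint) simp_all
  also have "(\<Prod>(x, y)\<in>core \<times> tail k. ratio x y) = (\<Prod>x\<in>core. \<Prod>y\<in>tail k. ratio x y)"
    by (simp add: prod.cartesian_product)
  also have "\<dots> = (\<Prod>x\<in>core. numer 0 x / numer k x)"
    using ratio_core_tail by (intro prod.cong) auto
  finally show ?thesis unfolding tail_ratio .
qed

section \<open>The limit and the terms left out\<close>

definition total :: Qqt where
  "total = (\<Prod>x\<in>core. numer 0 x) / ((1 - t) ^ N * t_fact_comp (mu core (restrict T core))) *
     (\<Prod>(x, y)\<in>I_set core (restrict T core). ratio x y)"

text \<open>The exact factor between the sum at stage \<open>k\<close> and its limit: it gathers
  everything that still depends on \<open>k\<close> after telescoping.\<close>

definition correction :: "nat \<Rightarrow> Qqt" where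
  "correction k = (\<Prod>i=1..N. 1 - t ^ (k + i)) * inverse (\<Prod>x\<in>core. numer k x)"

lemma sum_restricted_eq_total:
  "(\<Sum>\<tau>\<in>restricted_labs k. \<Prod>(x, y)\<in>Inv D \<tau>. wt x y) = total * correction k"
proof -
  have "(1 - t) ^ N * (t_fact (N + k) / t_fact k) = (\<Prod>i=1..N. 1 - t ^ (k + i))"
    using t_fact_add[of N k] by (simp add: field_simps)
  moreover have "(1 - t) ^ N \<noteq> 0" by simp
  ultimately have tf: "t_fact (N + k) / t_fact k = (\<Prod>i=1..N. 1 - t ^ (k + i)) / (1 - t) ^ N"
    by (simp add: field_simps)
  have "(\<Sum>\<tau>\<in>restricted_labs k. \<Prod>(x, y)\<in>Inv D \<tau>. wt x y) =
      (t_fact (N + k) / t_fact k) * (\<Prod>(x, y)\<in>rel_pairs (prec T) core. ratio x y) *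
      ((\<Prod>x\<in>core. numer 0 x) / (\<Prod>x\<in>core. numer k x))"
    unfolding sum_restricted_labs trunc_ratio prod_dividef by (simp add: ac_simps)
  then show ?thesis
    unfolding tf core_ratio total_def correction_def by (simp add: field_simps)
qed

text \<open>Each factor is 1 minus a monomial, or the inverse of such, with exponent of t at least k
  + 1: \<open>i\<close> starts at 1, and contents in the core are below \<open>M\<close>.\<close>

lemma correction_vge: "fls_vge (int k + 1) (correction k - 1)"
  unfolding correction_def
proof (rule fls_vge_mult_diff_1)
  show "fls_vge (int k + 1) ((\<Prod>i=1..N. 1 - t ^ (k + i)) - 1)"
  proof (rule fls_vge_prod_diff_1)
    fix i assume "i \<in> {1..N}"
    then have "fls_vge (int k + 1) (q powi 0 * t powi int (k + i))"
      by (intro fls_vge_q_powi_t_powi) simp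
    then have "fls_vge (int k + 1) (t ^ (k + i))"
      by (simp only: power_int_of_nat power_int_0_right mult_1_left)
    then show "fls_vge (int k + 1) (1 - t ^ (k + i) - 1)" by (simp add: fls_vge_uminus)
  qed simp
  show "fls_vge (int k + 1) (inverse (\<Prod>x\<in>core. numer k x) - 1)"
    using numer_vge by (intro fls_vge_inverse_diff_1 fls_vge_prod_diff_1) auto
qed simp

text \<open>Tail contents are at least \<open>M\<close> and core contents less, so t divides r. Then
  t divides t - r, and 1 - t r is a unit with constant term 1.\<close>

lemma wt_core_tail_vge:
  assumes x: "x \<in> core" and a: "M < a"
  shows "fls_vge 1 (wt x (a, 1))"
proof -
  have e: "1 \<le> box_content (a, 1) - box_content x"
    using core_content_less[OF x] a by (simp add: box_content_def)
  then have r: "fls_vge 1 (r x (a, 1))"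
    unfolding r_def by (rule fls_vge_q_powi_t_powi)
  have t: "fls_vge 1 t" by (simp add: fls_vge_iff)
  have "fls_vge (1 + 1) (t * r x (a, 1))" using t r by (rule fls_vge_mult)
  then have "fls_vge 1 (t * r x (a, 1))" by (rule fls_vge_mono) simp
  then have "fls_vge 0 (inverse (1 - t * r x (a, 1)))"
    by (intro fls_vge_inverse_0) (simp add: fls_vge_uminus)
  then have "fls_vge (1 + 0) ((t - r x (a, 1)) * inverse (1 - t * r x (a, 1)))"
    using t r by (intro fls_vge_mult fls_vge_diff)
  then show ?thesis by (simp add: wt_def divide_inverse)
qed

lemma APSYT_in_restricted:
  assumes "\<tau> \<in> APSYT_of lam T"
  shows "\<exists>k. \<tau> \<in> restricted_labs k"
proof -
  have fin: "finite ((\<lambda>x. fst (\<tau> x)) ` core)" using finite_trunc[of 0] by (simp add: core_trunc)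
  have "fst (\<tau> x) \<le> N + Max ((\<lambda>x. fst (\<tau> x)) ` core)" if "x \<in> core" for x
    using Max_ge[OF fin, of "fst (\<tau> x)"] that by (simp add: trans_le_add2)
  then show ?thesis using assms unfolding restricted_labs_def by blast
qed

(* An entry of the core larger than N + k is inverted with at least k boxes of the tail,
   each contributing a factor divisible by t; the inversions inside the core cost a bounded power of t. *)
lemma weight_vge:
  obtains B where "\<And>k \<tau>. \<tau> \<in> APSYT_of lam T - restricted_labs k \<Longrightarrow>
    fls_vge (int k - B) (\<Prod>(x, y)\<in>Inv D \<tau>. wt x y)"
proof -
  have fc: "finite core" using finite_trunc[of 0] by (simp add: core_trunc)
  have coreD: "core \<subseteq> D" unfolding core_trunc by (rule trunc_subset)
  \<comment> \<open>A factor inside the core may have a pole at t = 0, as contents may decrease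
    where \<open>T\<close> drops. The finitely many sets of core pairs share one bound
    \<open>m\<close>, possibly negative.\<close>
  obtain m where m: "\<And>S. S \<subseteq> core \<times> core \<Longrightarrow> fls_vge m (\<Prod>(x, y)\<in>S. wt x y)"
    using finite_vge_bound[of "(\<lambda>S. \<Prod>(x, y)\<in>S. wt x y) ` Pow (core \<times> core)"] fc by auto
  have "fls_vge (int k - (- m)) (\<Prod>(x, y)\<in>Inv D \<tau>. wt x y)"
    if \<tau>: "\<tau> \<in> APSYT_of lam T - restricted_labs k" for k \<tau>
  proof -
    have A: "\<tau> \<in> APSYT_of lam T" using \<tau> by simp
    obtain l where l: "\<tau> \<in> restricted_labs l" using APSYT_in_restricted[OF A] by blast
    have finI: "finite (Inv D \<tau>)" unfolding Inv_restricted[OF l] by (rule finite_inv_pairs)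
    have bij: "bij_betw (fst \<circ> \<tau>) D {1..}" and inc: "row_increasing D T (fst \<circ> \<tau>)"
      using A by (auto simp: APSYT_of_iff)
    have I: "Inv D \<tau> = {(x, y). x \<in> D \<and> y \<in> D \<and> prec T x y \<and> fst (\<tau> y) < fst (\<tau> x)}"
      by (rule Inv_eq[OF A])
    have tailE: "\<exists>a. y = (a, 1) \<and> M < a" if "y \<in> D" "y \<notin> core" for y
      using mem_D_cases[OF that(1), of 0] that(2) by (auto simp: core_trunc)
    \<comment> \<open>Whatever follows a tail box in reading order is a tail box further right,
      which has a larger label.\<close>
    have first: "x \<in> core" if xy: "(x, y) \<in> Inv D \<tau>" for x y
    proof (rule ccontr)
      assume nx: "x \<notin> core"
      have xy': "x \<in> D" "y \<in> D" "prec T x y" "fst (\<tau> y) < fst (\<tau> x)" using xy I by auto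
      obtain a where a: "x = (a, 1)" "M < a" using tailE nx xy' by blast
      have "y \<notin> core" using core_prec_tail a prec_asym[OF xy'(3)] by blast
      then obtain c where c: "y = (c, 1)" "M < c" using tailE xy' by blast
      have "a < c" using prec_tail_tail a c xy'(3) by blast
      then have "(fst \<circ> \<tau>) x < (fst \<circ> \<tau>) y"
        using inc xy' a c T_tail unfolding row_increasing_def by simp
      then show False using xy' by simp
    qed
    define C where "C = Inv D \<tau> \<inter> core \<times> core"
    define E where "E = Inv D \<tau> - core \<times> core"
    have "(\<Prod>(x, y)\<in>Inv D \<tau>. wt x y) = (\<Prod>(x, y)\<in>C \<union> E. wt x y)"
      by (rule arg_cong[where f = "prod _"]) (auto simp: C_def E_def)
    also have "\<dots> = (\<Prod>(x, y)\<in>C. wt x y) * (\<Prod>(x, y)\<in>E. wt x y)"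
      using finI by (intro prod.union_disjoint) (auto simp: C_def E_def)
    finally have prod: "(\<Prod>(x, y)\<in>Inv D \<tau>. wt x y) = (\<Prod>(x, y)\<in>C. wt x y) * (\<Prod>(x, y)\<in>E. wt x y)" .
    have vE: "fls_vge (int (card E)) (\<Prod>(x, y)\<in>E. wt x y)"
    proof (rule fls_vge_prod_card)
      fix p assume p: "p \<in> E"
      obtain x y where xy: "p = (x, y)" by (cases p)
      have x: "x \<in> core" using first[of x y] p xy by (simp add: E_def)
      have "y \<in> D" using p xy I by (auto simp: E_def)
      moreover have "y \<notin> core" using p xy x by (auto simp: E_def)
      ultimately obtain a where "y = (a, 1)" "M < a" using tailE by blast
      then show "fls_vge 1 (case p of (x, y) \<Rightarrow> wt x y)" using wt_core_tail_vge[OF x] xy by simp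
    qed
    have vC: "fls_vge m (\<Prod>(x, y)\<in>C. wt x y)" by (rule m) (auto simp: C_def)
    have kE: "k \<le> card E"
    proof -
      obtain x where x: "x \<in> core" "N + k < fst (\<tau> x)"
        using \<tau> by (auto simp: restricted_labs_def not_le)
      \<comment> \<open>At least N + k boxes have a smaller label than \<open>x\<close>. At most N
        of them lie in the core, so \<open>k\<close> or more lie in the tail and come after
        \<open>x\<close> in reading order.\<close>
      define Y where "Y = {y \<in> D. fst (\<tau> y) < fst (\<tau> x)}"
      have imgY: "(fst \<circ> \<tau>) ` Y = {1..<fst (\<tau> x)}"
      proof (intro equalityI subsetI)
        fix j assume j: "j \<in> {1..<fst (\<tau> x)}"
        then have "j \<in> (fst \<circ> \<tau>) ` D" using bij_betw_imp_surj_on[OF bij] by simp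
        then show "j \<in> (fst \<circ> \<tau>) ` Y" using j by (auto simp: Y_def)
      next
        fix j assume "j \<in> (fst \<circ> \<tau>) ` Y"
        then show "j \<in> {1..<fst (\<tau> x)}" using bij_betwE[OF bij] by (auto simp: Y_def)
      qed
      have injY: "inj_on (fst \<circ> \<tau>) Y"
        using bij_betw_imp_inj_on[OF bij] by (rule inj_on_subset) (auto simp: Y_def)
      have "card Y = fst (\<tau> x) - 1" using card_image[OF injY] imgY by simp
      then have "N + k \<le> card Y" using x by simp
      moreover have "card Y - card core \<le> card (Y - core)"
        by (rule diff_card_le_card_Diff[OF fc])
      moreover have "card core = N" using card_trunc[of 0] by (simp add: core_trunc)
      ultimately have "k \<le> card (Y - core)" by simp
      also have "card (Y - core) = card (Pair x ` (Y - core))"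
        by (intro card_image[symmetric]) (simp add: inj_on_def)
      also have "\<dots> \<le> card E"
      proof (rule card_mono)
        show "finite E" using finI by (simp add: E_def)
        show "Pair x ` (Y - core) \<subseteq> E"
        proof (rule image_subsetI)
          fix y assume y: "y \<in> Y - core"
          then have "y \<in> D" "y \<notin> core" by (simp_all add: Y_def)
          then obtain a where "y = (a, 1)" "M < a" using tailE by blast
          then have "prec T x y" using core_prec_tail[OF x(1)] by simp
          then show "(x, y) \<in> E" using x(1) coreD y unfolding E_def I by (auto simp: Y_def)
        qed
      qed
      finally show ?thesis .
    qed
    have "fls_vge (m + int (card E)) (\<Prod>(x, y)\<in>Inv D \<tau>. wt x y)"
      unfolding prod using vC vE by (rule fls_vge_mult)
    then show ?thesis using kE by (auto intro: fls_vge_mono)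
  qed
  then show ?thesis by (rule that)
qed

lemma has_sum_total: "((\<lambda>\<tau>. \<Prod>(x, y)\<in>Inv D \<tau>. wt x y) has_sum total) (APSYT_of lam T)"
proof (rule has_sum_flsI)
  fix m :: int
  obtain B where B: "\<And>k \<tau>. \<tau> \<in> APSYT_of lam T - restricted_labs k \<Longrightarrow>
    fls_vge (int k - B) (\<Prod>(x, y)\<in>Inv D \<tau>. wt x y)"
    using weight_vge by blast
  obtain b where b: "fls_vge b total" using finite_vge_bound[of "{total}"] by auto
  \<comment> \<open>The first bound makes the omitted terms small, the second the error of
    \<open>correction k\<close> multiplied by \<open>total\<close>, whose valuation is at least
    \<open>b\<close>.\<close>
  define k where "k = nat (max (m + B) (m - b))"
  have k: "m \<le> int k - B" "m \<le> b + (int k + 1)" by (auto simp: k_def)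
  show "\<exists>F. finite F \<and> F \<subseteq> APSYT_of lam T \<and>
      (\<forall>\<tau>\<in>APSYT_of lam T - F. fls_vge m (\<Prod>(x, y)\<in>Inv D \<tau>. wt x y)) \<and>
      fls_vge m ((\<Sum>\<tau>\<in>F. \<Prod>(x, y)\<in>Inv D \<tau>. wt x y) - total)"
  proof (intro exI conjI ballI)
    show "finite (restricted_labs k)" by (rule finite_restricted_labs)
    show "restricted_labs k \<subseteq> APSYT_of lam T" by (auto simp: restricted_labs_def)
    show "fls_vge m (\<Prod>(x, y)\<in>Inv D \<tau>. wt x y)" if "\<tau> \<in> APSYT_of lam T - restricted_labs k" for \<tau>
      using B[OF that] k(1) by (rule fls_vge_mono)
    have "fls_vge (b + (int k + 1)) (total * (correction k - 1))"
      using b correction_vge by (rule fls_vge_mult)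
    then have "fls_vge m (total * (correction k - 1))" using k(2) by (rule fls_vge_mono)
    then show "fls_vge m ((\<Sum>\<tau>\<in>restricted_labs k. \<Prod>(x, y)\<in>Inv D \<tau>. wt x y) - total)"
      unfolding sum_restricted_eq_total by (simp add: right_diff_distrib)
  qed
qed

end

theorem theorem6p3:
  fixes lam :: "nat list" and T T_N :: "box \<Rightarrow> nat" and N :: nat and D_N D_inf :: "box set"
  assumes "is_partition lam" and "T \<in> Omega lam"
    and "N = rk lam T"
    and "D_N = diagram (padded lam N)" and "D_inf = inf_diagram lam"
    and "T_N = restrict T D_N"
  shows
    "((\<lambda>\<tau>. t ^ inv_count D_inf \<tau> *
        (\<Prod>(x, y)\<in>Inv D_inf \<tau>.
           (1 - q powi (int (T y) - int (T x)) * t powi (box_content y - box_content x - 1)) /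
           (1 - q powi (int (T y) - int (T x)) * t powi (box_content y - box_content x + 1))))
      has_sum
      ((\<Prod>x\<in>D_N. 1 - q powi (- int (T x)) * t powi (int N - int (sum_list lam) - box_content x)) /
         ((1 - t) ^ N * t_fact_comp (mu D_N T_N)) *
       (\<Prod>(x, y)\<in>I_set D_N T_N.
           (1 - q powi (int (T y) - int (T x)) * t powi (box_content y - box_content x)) /
           (1 - q powi (int (T y) - int (T x)) * t powi (box_content y - box_content x + 1)))))
      (APSYT_of lam T)"
proof -
  interpret S: stable_filling lam T by unfold_locales (fact assms)+
  have N: "N = S.N" and DN: "D_N = S.core" and Dinf: "D_inf = S.D"
    using assms by (simp_all add: S.N_def S.core_def S.D_def)
  have M: "int N - int (sum_list lam) = int S.M + int 0" using S.N_eq N by simp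
  have L: "t ^ inv_count D_inf \<tau> *
        (\<Prod>(x, y)\<in>Inv D_inf \<tau>.
           (1 - q powi (int (T y) - int (T x)) * t powi (box_content y - box_content x - 1)) /
           (1 - q powi (int (T y) - int (T x)) * t powi (box_content y - box_content x + 1))) =
      (\<Prod>(x, y)\<in>Inv S.D \<tau>. S.wt x y)" for \<tau>
    \<comment> \<open>The power of t is a constant product over \<open>Inv\<close>, which hands one
      t to each factor. \<open>L\<close> covers every \<open>\<tau>\<close>: over an infinite
      \<open>Inv\<close>, the power and the products would all be 1.\<close>
    unfolding inv_count_def prod_constant[symmetric] prod.distrib[symmetric] Dinf
    by (intro prod.cong) (auto simp only: S.statement_weight_eq split: prod.splits)
  have R: "(\<Prod>x\<in>D_N. 1 - q powi (- int (T x)) * t powi (int N - int (sum_list lam) - box_content x)) /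
         ((1 - t) ^ N * t_fact_comp (mu D_N T_N)) *
       (\<Prod>(x, y)\<in>I_set D_N T_N.
           (1 - q powi (int (T y) - int (T x)) * t powi (box_content y - box_content x)) /
           (1 - q powi (int (T y) - int (T x)) * t powi (box_content y - box_content x + 1))) = S.total"
    unfolding S.total_def S.numer_def assms(6) DN M unfolding N S.statement_ratio_eq ..
  show ?thesis unfolding L R by (rule S.has_sum_total)
qed

end
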